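(* Let $k$ be a field. Let $R=k\langle x_1,\ldots,x_n\rangle$ and let $I$ be an ideal of $R$. Let $S=k\langle y_1,\ldots,y_m\rangle$ and let $J$ be an ideal of $S$. Here $k\langle\cdot\rangle$ denotes either the formal power series ring in both cases ($k$ an arbitrary field), or the convergent power series ring in both cases ($k$ a complete valued field). Suppose that there exists an isomorphism of $k$-algebras $A:=R/I\cong S/J$. Then there is an isomorphism of $A$-algebras $$\mathrm{gr}_I(R)[y_1,\ldots,y_m]\cong \mathrm{gr}_J(S)[x_1,\ldots,x_n].$$
   Context: Notation: $k\langle x_1,\ldots,x_n\rangle$ stands for either the formal power series ring $k[[x_1,\ldots,x_n]]$ over an arbitrary field $k$, or the ring $k\{x_1,\ldots,x_n\}\subseteq k[[x_1,\ldots,x_n]]$ of convergent power series, where in the latter case $k$ is a complete valued field. For an ideal $I$ of a ring $R$, $\mathrm{gr}_I(R)=\bigoplus_{n\ge0}I^n/I^{n+1}$ is the associated graded ring, an $R/I$-algebra. In the displayed isomorphism, $\mathrm{gr}_I(R)[y_1,\ldots,y_m]$ and $\mathrm{gr}_J(S)[x_1,\ldots,x_n]$ are polynomial rings in $m$, respectively $n$, indeterminates, and $\mathrm{gr}_J(S)$ is viewed as an $A$-algebra through the isomorphism $A=R/I\cong S/J$. *)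

theory Defs
  imports "HOL-Analysis.Analysis" "HOL-Algebra.Algebra"
begin

section \<open>Power series rings over a field\<close>

text \<open>
  As in \<^theory>\<open>HOL-Algebra.Indexed_Polynomials\<close>, a monomial in the indeterminates
  \<open>x\<^sub>0, \<dots>, x\<^sub>n\<^sub>-\<^sub>1\<close> is a multiset over \<open>{..<n}\<close>; multiplication of monomials is
  addition of multisets.  A power series is its coefficient function, which vanishes on
  monomials containing other indeterminates.
\<close>

definition formal_ps_ring :: "nat \<Rightarrow> (nat multiset \<Rightarrow> 'k::field) ring"
  where "formal_ps_ring n = \<lparr>
    carrier = {f. \<forall>a. \<not> set_mset a \<subseteq> {..<n} \<longrightarrow> f a = 0},
    monoid.mult = (\<lambda>f g a. \<Sum>b | b \<subseteq># a. f b * g (a - b)),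
    one = (\<lambda>a. if a = {#} then 1 else 0),
    ring.zero = (\<lambda>a. 0),
    add = (\<lambda>f g a. f a + g a)\<rparr>"

definition ps_const :: "'k::field \<Rightarrow> (nat multiset \<Rightarrow> 'k)"
  where "ps_const c = (\<lambda>a. if a = {#} then c else 0)"

text \<open>
  The absolute value may be archimedean or not, and may be trivial.
\<close>

definition complete_valued_field :: "('k::field \<Rightarrow> real) \<Rightarrow> bool"
  where "complete_valued_field v \<longleftrightarrow>
    (\<forall>x. 0 \<le> v x) \<and>
    (\<forall>x. v x = 0 \<longleftrightarrow> x = 0) \<and>
    (\<forall>x y. v (x * y) = v x * v y) \<and>
    (\<forall>x y. v (x + y) \<le> v x + v y) \<and>
    Metric_space.mcomplete UNIV (\<lambda>x y. v (x - y))"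

text \<open>
  A power series converges if it converges absolutely at some polyradius \<open>r\<close> with positive
  entries.
\<close>

definition convergent_ps :: "('k::field \<Rightarrow> real) \<Rightarrow> nat \<Rightarrow> (nat multiset \<Rightarrow> 'k) \<Rightarrow> bool"
  where "convergent_ps v n f \<longleftrightarrow>
    (\<exists>r :: nat \<Rightarrow> real. (\<forall>i<n. 0 < r i) \<and>
      (\<lambda>a. v (f a) * (\<Prod>i<n. r i ^ count a i)) summable_on {a. set_mset a \<subseteq> {..<n}})"

definition convergent_ps_ring ::
    "('k::field \<Rightarrow> real) \<Rightarrow> nat \<Rightarrow> (nat multiset \<Rightarrow> 'k) ring"
  where "convergent_ps_ring v n =
    formal_ps_ring n \<lparr>carrier := {f \<in> carrier (formal_ps_ring n). convergent_ps v n f}\<rparr>"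


section \<open>The associated graded ring\<close>

abbreviation ideal_power :: "('a, 'b) ring_scheme \<Rightarrow> 'a set \<Rightarrow> nat \<Rightarrow> 'a set"
  where "ideal_power R I i \<equiv> I [^]\<^bsub>ideals_set R\<^esub> i"

text \<open>
  An element of \<open>gr\<^sub>I(R)\<close> is the sequence of its homogeneous components; the component of
  degree \<open>i\<close> is a coset \<open>I\<^sup>i\<^sup>+\<^sup>1 + a\<close> with \<open>a \<in> I\<^sup>i\<close>, and the product of \<open>I\<^sup>j\<^sup>+\<^sup>1 + a\<close> and
  \<open>I\<^sup>l\<^sup>+\<^sup>1 + b\<close> is \<open>I\<^sup>j\<^sup>+\<^sup>l\<^sup>+\<^sup>1 + ab\<close>.
\<close>

definition gr_ring :: "('a, 'b) ring_scheme \<Rightarrow> 'a set \<Rightarrow> (nat \<Rightarrow> 'a set) ring"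
  where "gr_ring R I = \<lparr>
    carrier = {x. (\<forall>i. x i \<in> (\<lambda>a. ideal_power R I (Suc i) +>\<^bsub>R\<^esub> a) ` ideal_power R I i) \<and>
                  finite {i. x i \<noteq> ideal_power R I (Suc i)}},
    monoid.mult = (\<lambda>x y i. \<Oplus>\<^bsub>R Quot ideal_power R I (Suc i)\<^esub>j\<in>{..i}.
                     rcoset_mult R (ideal_power R I (Suc i)) (x j) (y (i - j))),
    one = (\<lambda>i. if i = 0 then ideal_power R I 1 +>\<^bsub>R\<^esub> \<one>\<^bsub>R\<^esub> else ideal_power R I (Suc i)),
    ring.zero = (\<lambda>i. ideal_power R I (Suc i)),
    add = (\<lambda>x y i. x i <+>\<^bsub>R\<^esub> y i)\<rparr>"

text \<open>The structure map \<open>R/I \<rightarrow> gr\<^sub>I(R)\<close> identifies \<open>R/I\<close> with the degree 0 part.\<close>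

definition gr_const :: "('a, 'b) ring_scheme \<Rightarrow> 'a set \<Rightarrow> 'a set \<Rightarrow> (nat \<Rightarrow> 'a set)"
  where "gr_const R I c = (\<lambda>i. if i = 0 then c else ideal_power R I (Suc i))"


section \<open>Polynomial rings in finitely many indeterminates\<close>

text \<open>
  \<^theory>\<open>HOL-Algebra.Indexed_Polynomials\<close> provides the set of polynomials, their addition and
  the constants, but not their product.
\<close>

definition mpoly_ring :: "('a, 'b) ring_scheme \<Rightarrow> nat \<Rightarrow> (nat multiset \<Rightarrow> 'a) ring"
  where "mpoly_ring G n = \<lparr>
    carrier = ring.indexed_pset G {..<n} (carrier G),
    monoid.mult = (\<lambda>p q a. \<Oplus>\<^bsub>G\<^esub>b\<in>{b. b \<subseteq># a}. p b \<otimes>\<^bsub>G\<^esub> q (a - b)),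
    one = ring.indexed_const G \<one>\<^bsub>G\<^esub>,
    ring.zero = ring.indexed_const G \<zero>\<^bsub>G\<^esub>,
    add = ring.indexed_padd G\<rparr>"


section \<open>Isomorphisms of algebras\<close>

text \<open>
  Algebras over a commutative ring with underlying set \<open>A\<close> are given by their structure maps
  \<open>s\<close> into \<open>B\<close> and \<open>t\<close> into \<open>C\<close>.
\<close>

definition algebra_iso ::
    "'a set \<Rightarrow> ('a \<Rightarrow> 'b) \<Rightarrow> ('b, 'p) ring_scheme \<Rightarrow> ('a \<Rightarrow> 'c) \<Rightarrow> ('c, 'q) ring_scheme \<Rightarrow>
      ('b \<Rightarrow> 'c) \<Rightarrow> bool"
  where "algebra_iso A s B t C h \<longleftrightarrow> h \<in> ring_iso B C \<and> (\<forall>a\<in>A. h (s a) = t a)"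

end

theory Submission
  imports Defs
begin

text \<open>
  Write \<open>T\<close> for the power series ring in the variables \<open>x\<close> and \<open>y\<close> together. Choose \<open>f\<^sub>j \<in> R\<close> and
  \<open>g\<^sub>i \<in> S\<close>, all without constant term, that correspond to \<open>y\<^sub>j\<close> and \<open>x\<^sub>i\<close> under the isomorphism
  \<open>R/I \<cong> S/J\<close> (\<open>iso_lift_maximal\<close>). The maps \<open>h \<mapsto> h(x, f(x)) mod I\<close> and \<open>h \<mapsto> h(g(y), y) mod J\<close>
  are two homomorphisms from \<open>T\<close> to \<open>A\<close> over \<open>k\<close> which agree on all variables. They are equal, because
  every ideal of a power series ring is closed in the topology given by the maximal ideal
  (\<open>ideal_closed\<close>, \<open>hom_into_quotient_unique\<close>). Let \<open>K\<close> be their common kernel. With respect to the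
  coordinates \<open>t\<^sub>j = y\<^sub>j - f\<^sub>j\<close>, the ring \<open>T\<close> is again a power series ring over \<open>R\<close>
  (\<open>power_series_coordinate_extension\<close>), and \<open>K\<close> is generated by \<open>I\<close> and the \<open>t\<^sub>j\<close>; hence
  \<open>gr\<^sub>K(T)\<close> is the polynomial ring \<open>gr\<^sub>I(R)[t\<^sub>1, \<dots>, t\<^sub>m]\<close>. By symmetry \<open>gr\<^sub>K(T)\<close> is also
  \<open>gr\<^sub>J(S)[x\<^sub>1 - g\<^sub>1, \<dots>, x\<^sub>n - g\<^sub>n]\<close>, and both identifications respect the structure of an
  \<open>A\<close>-algebra.
  
  The graded ring of \<open>T\<close> does not appear explicitly. Both polynomial rings are images of one ring, the
  finite sequences \<open>(h\<^sub>d)\<close> with \<open>h\<^sub>d \<in> K\<^sup>d\<close>, and both maps identify two sequences exactly when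
  \<open>h\<^sub>d - h'\<^sub>d \<in> K\<^sup>d\<^sup>+\<^sup>1\<close> for all \<open>d\<close> (\<open>gr_coeffs_eq_iff\<close>); two surjections with the same
  fibres have isomorphic targets.
  
  That ideals are closed is Krull's intersection theorem for the quotients of power series rings. It is
  obtained here from the division theorem of Hironaka and Grauert, with the monomials ordered by the numbers
  \<open>\<Prod>\<^sub>i p\<^sub>i\<^bsup>a\<^sub>i\<^esup>\<close> for distinct primes \<open>p\<^sub>i\<close>. The same numbers serve as weights in the norms
  \<open>\<Sum>\<^sub>a |f\<^sub>a| / (\<Prod>\<^sub>i p\<^sub>i\<^bsup>a\<^sub>i\<^esup>)\<^sup>t\<close>; a series converges if and only if one of them is finite.
  Formal power series are the convergent ones for the trivial absolute value, so that one argument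
  covers both cases.
\<close>

section \<open>Multisets as exponents\<close>

lemma finite_multisets_bounded:
  assumes "finite A"
  shows "finite {a. set_mset a \<subseteq> A \<and> size a \<le> d}"
proof (rule finite_subset)
  show "{a. set_mset a \<subseteq> A \<and> size a \<le> d} \<subseteq> mset ` {xs. set xs \<subseteq> A \<and> length xs \<le> d}"
  proof
    fix a assume a: "a \<in> {a. set_mset a \<subseteq> A \<and> size a \<le> d}"
    obtain xs where "mset xs = a" using ex_mset by blast
    with a show "a \<in> mset ` {xs. set xs \<subseteq> A \<and> length xs \<le> d}" by force
  qed
  show "finite (mset ` {xs. set xs \<subseteq> A \<and> length xs \<le> d})"
    using assms by (simp add: finite_lists_length_le)
qed

lemma finite_submultisets [simp]: "finite {b. b \<subseteq># a}"
  by (rule finite_subset[OF _ finite_multisets_bounded[of "set_mset a" "size a"]])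
     (auto dest: mset_subset_eqD size_mset_mono)

text \<open>
  The power product \<open>\<Prod>\<^sub>i g\<^sub>i\<^bsup>a\<^sub>i\<^esup>\<close>. Sorting the exponent turns it into a list of factors, so that
  only the values of \<open>g\<close> on the indices that occur have to lie in the carrier.
\<close>

definition mpow :: "('a, 'b) ring_scheme \<Rightarrow> (nat \<Rightarrow> 'a) \<Rightarrow> nat multiset \<Rightarrow> 'a"
  where "mpow R g a = foldr (\<lambda>i x. g i \<otimes>\<^bsub>R\<^esub> x) (sorted_list_of_multiset a) \<one>\<^bsub>R\<^esub>"

lemma mpow_empty [simp]: "mpow R g {#} = \<one>\<^bsub>R\<^esub>"
  by (simp add: mpow_def)

context cring begin

lemma mpow_foldr_closed:
  "(\<And>i. i \<in> set xs \<Longrightarrow> g i \<in> carrier R) \<Longrightarrow> foldr (\<lambda>i x. g i \<otimes> x) xs \<one> \<in> carrier R"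
  by (induction xs) auto

lemma mpow_closed:
  "(\<And>i. i \<in># a \<Longrightarrow> g i \<in> carrier R) \<Longrightarrow> mpow R g a \<in> carrier R"
  unfolding mpow_def by (rule mpow_foldr_closed) simp

lemma mpow_add_mset:
  assumes "\<And>i. i \<in># add_mset j a \<Longrightarrow> g i \<in> carrier R"
  shows "mpow R g (add_mset j a) = g j \<otimes> mpow R g a"
proof -
  have ins: "foldr (\<lambda>i x. g i \<otimes> x) (insort j xs) \<one> = g j \<otimes> foldr (\<lambda>i x. g i \<otimes> x) xs \<one>"
    if "\<And>i. i \<in> set (j # xs) \<Longrightarrow> g i \<in> carrier R" for xs
    using that
  proof (induction xs)
    case (Cons k xs)
    have "foldr (\<lambda>i x. g i \<otimes> x) xs \<one> \<in> carrier R"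
      by (rule mpow_foldr_closed) (use Cons.prems in auto)
    moreover have "foldr (\<lambda>i x. g i \<otimes> x) (insort j xs) \<one> = g j \<otimes> foldr (\<lambda>i x. g i \<otimes> x) xs \<one>"
      by (rule Cons.IH) (use Cons.prems in auto)
    ultimately show ?case using Cons.prems by (simp add: m_lcomm)
  qed simp
  have "foldr (\<lambda>i x. g i \<otimes> x) (insort j (sorted_list_of_multiset a)) \<one>
      = g j \<otimes> foldr (\<lambda>i x. g i \<otimes> x) (sorted_list_of_multiset a) \<one>"
    by (rule ins) (use assms in auto)
  thus ?thesis by (simp add: mpow_def)
qed

lemma mpow_plus:
  assumes "\<And>i. i \<in># a + b \<Longrightarrow> g i \<in> carrier R"
  shows "mpow R g (a + b) = mpow R g a \<otimes> mpow R g b"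
  using assms
proof (induction a)
  case (add j a)
  have "mpow R g (add_mset j a + b) = g j \<otimes> mpow R g (a + b)"
    using mpow_add_mset[of j "a + b" g] add.prems by simp
  also have "mpow R g (a + b) = mpow R g a \<otimes> mpow R g b"
    by (rule add.IH) (use add.prems in auto)
  also have "g j \<otimes> \<dots> = g j \<otimes> mpow R g a \<otimes> mpow R g b"
    using add.prems by (intro m_assoc[symmetric] mpow_closed) auto
  also have "g j \<otimes> mpow R g a = mpow R g (add_mset j a)"
    by (rule mpow_add_mset[symmetric]) (use add.prems in auto)
  finally show ?case .
qed (simp add: mpow_closed)

end

definition mons :: "nat \<Rightarrow> nat \<Rightarrow> nat multiset set"
  where "mons n d = {a. set_mset a \<subseteq> {..<n} \<and> size a \<le> d}"

lemma finite_mons [simp]: "finite (mons n d)"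
  by (simp add: mons_def finite_multisets_bounded)

section \<open>Powers of an ideal\<close>

text \<open>
  The powers of ideals are to stay folded: the notation for them is an ordinary power in
  \<open>ideals_set R\<close>, which the simplifier would otherwise expand.
\<close>

declare nat_pow_0 [simp del] nat_pow_Suc [simp del]

lemma ideal_power_0: "ideal_power R I 0 = carrier R"
  by (simp add: nat_pow_def ideals_set_def)

lemma ideal_power_Suc: "ideal_power R I (Suc i) = ideal_prod R (ideal_power R I i) I"
  by (simp add: nat_pow_def ideals_set_def)

lemma (in ideal) finsum_in_ideal:
  "(\<And>x. x \<in> A \<Longrightarrow> f x \<in> I) \<Longrightarrow> finsum R f A \<in> I"
proof (induction A rule: infinite_finite_induct)
  case (insert x F)
  moreover from insert.prems have "f \<in> F \<rightarrow> carrier R" "f x \<in> carrier R"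
    using Icarr by auto
  ultimately show ?case by (simp add: a_closed)
qed (simp_all add: finsum_infinite)

lemma (in ideal) minus_closed_ideal: "a \<in> I \<Longrightarrow> b \<in> I \<Longrightarrow> a \<ominus> b \<in> I"
  by (simp add: minus_eq a_closed a_inv_closed)

context cring begin

context
  fixes I assumes I: "ideal I R"
begin

lemma ideal_power_ideal: "ideal (ideal_power R I i) R"
proof (induction i)
  case 0
  show ?case unfolding ideal_power_0 by (rule oneideal)
next
  case (Suc i)
  show ?case unfolding ideal_power_Suc by (rule ideal_prod_is_ideal[OF Suc I])
qed

lemma ideal_power_closed: "a \<in> ideal_power R I i \<Longrightarrow> a \<in> carrier R"
  by (rule ideal.Icarr[OF ideal_power_ideal])

lemma ideal_power_zero: "\<zero> \<in> ideal_power R I i"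
  by (rule additive_subgroup.zero_closed[OF ideal.axioms(1)[OF ideal_power_ideal]])

lemma ideal_power_mult:
  assumes "a \<in> ideal_power R I i" "b \<in> ideal_power R I j"
  shows "a \<otimes> b \<in> ideal_power R I (i + j)"
  using assms(2)
proof (induction j arbitrary: b)
  case 0
  thus ?case using ideal.I_r_closed[OF ideal_power_ideal assms(1)] by (simp add: ideal_power_0)
next
  case (Suc j)
  from Suc.prems show ?case unfolding add_Suc_right ideal_power_Suc
  proof (induction b rule: ideal_prod.induct)
    case (prod x y)
    have "a \<otimes> (x \<otimes> y) = (a \<otimes> x) \<otimes> y"
      using assms(1) prod ideal.Icarr[OF I] by (simp add: m_assoc ideal_power_closed)
    thus ?case using Suc.IH[OF prod(1)] prod(2) by (simp add: ideal_prod.prod)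
  next
    case (sum x y)
    have "x \<in> carrier R" "y \<in> carrier R"
      using sum(1,2) ideal_power_closed[of _ "Suc j"] by (simp_all add: ideal_power_Suc)
    hence "a \<otimes> (x \<oplus> y) = a \<otimes> x \<oplus> a \<otimes> y"
      using ideal_power_closed[OF assms(1)] by (simp add: r_distr)
    thus ?case using sum by (simp add: ideal_prod.sum)
  qed
qed

lemma ideal_power_mono:
  assumes "i \<le> j" "a \<in> ideal_power R I j" shows "a \<in> ideal_power R I i"
proof -
  have step: "b \<in> ideal_power R I k" if "b \<in> ideal_power R I (Suc k)" for b k
    using that ideal_prod_inter[OF ideal_power_ideal I] by (auto simp: ideal_power_Suc)
  show ?thesis using assms by (induction rule: inc_induct) (auto intro: step)
qed

lemma ideal_power_1: "ideal_power R I (Suc 0) = I"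
proof
  show "ideal_power R I (Suc 0) \<subseteq> I"
    using ideal_prod_inter[OF ideal_power_ideal I] by (auto simp: ideal_power_Suc)
  show "I \<subseteq> ideal_power R I (Suc 0)"
    using ideal_prod.prod[of \<one> "carrier R" _ I R] ideal.Icarr[OF I]
    by (force simp: ideal_power_Suc ideal_power_0)
qed

end

lemma finsum_swap:
  assumes "finite A" "finite B" "\<And>i j. i \<in> A \<Longrightarrow> j \<in> B \<Longrightarrow> f i j \<in> carrier R"
  shows "(\<Oplus>i\<in>A. \<Oplus>j\<in>B. f i j) = (\<Oplus>j\<in>B. \<Oplus>i\<in>A. f i j)"
  using assms(1,3)
proof (induction A rule: finite_induct)
  case (insert x A)
  have "(\<Oplus>i\<in>insert x A. \<Oplus>j\<in>B. f i j) = (\<Oplus>j\<in>B. f x j) \<oplus> (\<Oplus>j\<in>B. \<Oplus>i\<in>A. f i j)"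
    using insert by (subst finsum_insert) (auto intro!: finsum_closed)
  also have "\<dots> = (\<Oplus>j\<in>B. f x j \<oplus> (\<Oplus>i\<in>A. f i j))"
    by (rule finsum_addf[symmetric]) (use insert in \<open>auto intro!: finsum_closed\<close>)
  also have "\<dots> = (\<Oplus>j\<in>B. \<Oplus>i\<in>insert x A. f i j)"
    by (rule finsum_cong') (use insert in \<open>auto intro!: finsum_closed a_closed\<close>)
  finally show ?case .
qed simp

end

section \<open>The Rees ring and the associated graded ring\<close>

text \<open>
  The finite sequences \<open>(c\<^sub>i)\<close> with \<open>c\<^sub>i \<in> I\<^sup>i\<close> are the polynomials \<open>\<Sum>\<^sub>i c\<^sub>i z\<^sup>i\<close> of the Rees algebra
  \<open>R[I z]\<close>, a subring of the polynomial ring \<open>R[z]\<close>. The graded ring is a quotient of the Rees algebra and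
  inherits the ring axioms from it.
\<close>

definition rees_set :: "('a, 'b) ring_scheme \<Rightarrow> 'a set \<Rightarrow> (nat \<Rightarrow> 'a) set"
  where "rees_set R I = {c. (\<forall>i. c i \<in> ideal_power R I i) \<and> finite {i. c i \<noteq> \<zero>\<^bsub>R\<^esub>}}"

abbreviation rees_ring :: "('a, 'b) ring_scheme \<Rightarrow> 'a set \<Rightarrow> ('a, nat \<Rightarrow> 'a) up_ring"
  where "rees_ring R I \<equiv> UP R \<lparr>carrier := rees_set R I\<rparr>"

definition gr_of :: "('a, 'b) ring_scheme \<Rightarrow> 'a set \<Rightarrow> (nat \<Rightarrow> 'a) \<Rightarrow> nat \<Rightarrow> 'a set"
  where "gr_of R I c = (\<lambda>i. ideal_power R I (Suc i) +>\<^bsub>R\<^esub> c i)"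

lemma (in ideal) rcos_eq_iff:
  "a \<in> carrier R \<Longrightarrow> b \<in> carrier R \<Longrightarrow> I +> a = I +> b \<longleftrightarrow> a \<ominus> b \<in> I"
  using quotient_eq_iff_same_a_r_cos[OF ideal_axioms] by blast

lemma (in ideal) rcos_self: "a \<in> carrier R \<Longrightarrow> a \<in> I +> a"
  by (rule a_rcos_self)

context cring begin

context
  fixes I assumes I: "ideal I R"
begin

lemma rees_setD:
  assumes "c \<in> rees_set R I"
  shows "c i \<in> ideal_power R I i" "c i \<in> carrier R" "c \<in> up R"
proof -
  show c: "c i \<in> ideal_power R I i" for i using assms by (auto simp: rees_set_def)
  show c': "c i \<in> carrier R" for i by (rule ideal_power_closed[OF I c])
  have fin: "finite {i. c i \<noteq> \<zero>}" using assms by (auto simp: rees_set_def)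
  have "bound \<zero> (Max (insert 0 {i. c i \<noteq> \<zero>})) c"
  proof
    fix i assume "Max (insert 0 {i. c i \<noteq> \<zero>}) < i"
    thus "c i = \<zero>" using fin Max_ge[of "insert 0 {i. c i \<noteq> \<zero>}" i] by fastforce
  qed
  thus "c \<in> up R" using c' by (auto simp: up_def)
qed

lemma rees_setI: "c \<in> up R \<Longrightarrow> (\<And>i. c i \<in> ideal_power R I i) \<Longrightarrow> c \<in> rees_set R I"
proof -
  assume c: "c \<in> up R" "\<And>i. c i \<in> ideal_power R I i"
  then obtain n where "bound \<zero> n c" by (auto simp: up_def)
  hence "{i. c i \<noteq> \<zero>} \<subseteq> {..n}" by (auto dest: bound.bound simp: not_le[symmetric])
  hence "finite {i. c i \<noteq> \<zero>}" by (rule finite_subset) simp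
  thus ?thesis using c by (auto simp: rees_set_def)
qed

lemma rees_sel:
  "c \<in> rees_set R I \<Longrightarrow> d \<in> rees_set R I \<Longrightarrow>
    c \<otimes>\<^bsub>UP R\<^esub> d = (\<lambda>i. \<Oplus>j\<in>{..i}. c j \<otimes> d (i - j))"
  "c \<in> rees_set R I \<Longrightarrow> d \<in> rees_set R I \<Longrightarrow> c \<oplus>\<^bsub>UP R\<^esub> d = (\<lambda>i. c i \<oplus> d i)"
  "\<one>\<^bsub>UP R\<^esub> = (\<lambda>i. if i = 0 then \<one> else \<zero>)"
  "\<zero>\<^bsub>UP R\<^esub> = (\<lambda>i. \<zero>)"
  by (simp_all add: UP_def rees_setD)

lemma rees_mult_coeff_closed:
  assumes "c \<in> rees_set R I" "d \<in> rees_set R I"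
  shows "(\<Oplus>j\<in>{..i}. c j \<otimes> d (i - j)) \<in> ideal_power R I i"
proof (rule ideal.finsum_in_ideal[OF ideal_power_ideal[OF I]])
  fix j assume "j \<in> {..i}"
  thus "c j \<otimes> d (i - j) \<in> ideal_power R I i"
    using ideal_power_mult[OF I rees_setD(1)[OF assms(1)] rees_setD(1)[OF assms(2)], of j "i - j"] by simp
qed

lemma cring_UP: "cring (UP R)"
proof -
  interpret U: UP_cring R "UP R" by unfold_locales simp
  show ?thesis by (rule U.UP_cring)
qed

lemma rees_subring: "subring (rees_set R I) (UP R)"
proof -
  note P = cring_UP
  show ?thesis
  proof (rule ring.subringI[OF cring.axioms(1)[OF P]])
    show sub: "rees_set R I \<subseteq> carrier (UP R)" using rees_setD(3) by (auto simp: UP_def)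
    show "\<one>\<^bsub>UP R\<^esub> \<in> rees_set R I"
      by (rule rees_setI) (use up_one_closed in \<open>simp_all add: rees_sel ideal_power_0 ideal_power_zero[OF I]\<close>)
    fix c assume c: "c \<in> rees_set R I"
    have "(\<lambda>i. \<ominus> c i) \<oplus>\<^bsub>UP R\<^esub> c = \<zero>\<^bsub>UP R\<^esub>"
      using rees_setD[OF c] up_a_inv_closed[of c] by (simp add: UP_def l_neg)
    hence "\<ominus>\<^bsub>UP R\<^esub> c = (\<lambda>i. \<ominus> c i)"
      using up_a_inv_closed[OF rees_setD(3)[OF c]] rees_setD(3)[OF c]
      by (intro abelian_group.minus_equality[OF ring.is_abelian_group[OF cring.axioms(1)[OF P]]]) (simp_all add: UP_def)
    moreover have "(\<lambda>i. \<ominus> c i) \<in> rees_set R I"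
      by (intro rees_setI up_a_inv_closed rees_setD(3)[OF c]
            additive_subgroup.a_inv_closed[OF ideal.axioms(1)[OF ideal_power_ideal[OF I]]] rees_setD(1)[OF c])
    ultimately show "\<ominus>\<^bsub>UP R\<^esub> c \<in> rees_set R I" by simp
    fix d assume d: "d \<in> rees_set R I"
    show "c \<otimes>\<^bsub>UP R\<^esub> d \<in> rees_set R I" unfolding rees_sel(1)[OF c d]
      by (intro rees_setI up_mult_closed rees_setD(3)[OF c] rees_setD(3)[OF d] rees_mult_coeff_closed c d)
    show "c \<oplus>\<^bsub>UP R\<^esub> d \<in> rees_set R I" unfolding rees_sel(2)[OF c d]
      by (intro rees_setI up_add_closed rees_setD(3)[OF c] rees_setD(3)[OF d]
            additive_subgroup.a_closed[OF ideal.axioms(1)[OF ideal_power_ideal[OF I]]]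
            rees_setD(1)[OF c] rees_setD(1)[OF d])
  qed
qed

lemma rees_ring: "ring (rees_ring R I)"
  by (rule ring.subring_is_ring[OF cring.axioms(1)[OF cring_UP] rees_subring])

lemma gr_carrier: "carrier (gr_ring R I) = gr_of R I ` rees_set R I"
proof
  show "gr_of R I ` rees_set R I \<subseteq> carrier (gr_ring R I)"
  proof (rule image_subsetI)
    fix c assume c: "c \<in> rees_set R I"
    have "{i. gr_of R I c i \<noteq> ideal_power R I (Suc i)} \<subseteq> {i. c i \<noteq> \<zero>}"
      unfolding gr_of_def using a_rcos_zero[OF ideal_power_ideal[OF I] ideal_power_zero[OF I]] by force
    hence "finite {i. gr_of R I c i \<noteq> ideal_power R I (Suc i)}"
      by (rule finite_subset) (use c in \<open>simp add: rees_set_def\<close>)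
    thus "gr_of R I c \<in> carrier (gr_ring R I)"
      using rees_setD(1)[OF c] by (auto simp: gr_ring_def gr_of_def)
  qed
  show "carrier (gr_ring R I) \<subseteq> gr_of R I ` rees_set R I"
  proof
    fix x assume x: "x \<in> carrier (gr_ring R I)"
    hence "\<forall>i. \<exists>a\<in>ideal_power R I i. x i = ideal_power R I (Suc i) +> a"
      by (auto simp: gr_ring_def)
    then obtain c where c: "\<And>i. c i \<in> ideal_power R I i" "\<And>i. x i = ideal_power R I (Suc i) +> c i"
      by metis
    define d where "d i = (if x i = ideal_power R I (Suc i) then \<zero> else c i)" for i
    have "{i. d i \<noteq> \<zero>} \<subseteq> {i. x i \<noteq> ideal_power R I (Suc i)}" by (auto simp: d_def)
    hence "finite {i. d i \<noteq> \<zero>}" by (rule finite_subset) (use x in \<open>simp add: gr_ring_def\<close>)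
    hence "d \<in> rees_set R I" using c(1) ideal_power_zero[OF I] by (auto simp: rees_set_def d_def)
    moreover have "x = gr_of R I d"
      using c(2) a_rcos_zero[OF ideal_power_ideal[OF I] ideal_power_zero[OF I]]
      by (auto simp: gr_of_def d_def fun_eq_iff)
    ultimately show "x \<in> gr_of R I ` rees_set R I" by blast
  qed
qed

lemma gr_zero: "\<zero>\<^bsub>gr_ring R I\<^esub> = gr_of R I (\<lambda>i. \<zero>)"
  using a_rcos_zero[OF ideal_power_ideal[OF I] ideal_power_zero[OF I]]
  by (simp add: gr_ring_def gr_of_def)

text \<open>
  A product of cosets \<open>I\<^sup>j\<^sup>+\<^sup>1 + a\<close> and \<open>I\<^sup>l\<^sup>+\<^sup>1 + b\<close> is well defined modulo \<open>I\<^sup>j\<^sup>+\<^sup>l\<^sup>+\<^sup>1\<close> because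
  \<open>a \<in> I\<^sup>j\<close> and \<open>b \<in> I\<^sup>l\<close>; hence the components of a product in the graded ring are the cosets of
  the coefficients of the product in the Rees algebra.
\<close>

lemma gr_of_hom: "gr_of R I \<in> ring_hom (rees_ring R I) (gr_ring R I)"
proof (rule ring_hom_memI, goal_cases)
  case (1 c) thus ?case by (simp add: gr_carrier)
next
  case (2 c d)
  hence cd: "c \<in> rees_set R I" "d \<in> rees_set R I" by simp_all
  show ?case
  proof
    fix i
    let ?J = "ideal_power R I (Suc i)"
    interpret J: ideal ?J R by (rule ideal_power_ideal[OF I])
    interpret h: ring_hom_cring R "R Quot ?J" "\<lambda>a. ?J +> a"
      by (rule J.rcos_ring_hom_cring[OF is_cring])
    have rm: "rcoset_mult R ?J (gr_of R I c j) (gr_of R I d (i - j)) = ?J +> (c j \<otimes> d (i - j))"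
      if j: "j \<in> {..i}" for j
    proof -
      have "?J +> (a \<otimes> b) = ?J +> (c j \<otimes> d (i - j))"
        if ab: "a \<in> gr_of R I c j" "b \<in> gr_of R I d (i - j)" for a b
      proof -
        obtain x where x: "x \<in> ideal_power R I (Suc j)" "a = x \<oplus> c j"
          using ab(1) by (auto simp: gr_of_def a_r_coset_def')
        obtain y where y: "y \<in> ideal_power R I (Suc (i - j))" "b = y \<oplus> d (i - j)"
          using ab(2) by (auto simp: gr_of_def a_r_coset_def')
        note carr = ideal_power_closed[OF I x(1)] ideal_power_closed[OF I y(1)]
          rees_setD(2)[OF cd(1), of j] rees_setD(2)[OF cd(2), of "i - j"]
        have "a \<otimes> b \<ominus> c j \<otimes> d (i - j) = x \<otimes> (y \<oplus> d (i - j)) \<oplus> c j \<otimes> y"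
          unfolding x(2) y(2) using carr by algebra
        moreover have "x \<otimes> y \<in> ?J"
          using ideal_power_mult[OF I x(1) y(1)] j by (auto intro: ideal_power_mono[OF I, of "Suc i" "Suc j + Suc (i - j)"])
        moreover have "x \<otimes> d (i - j) \<in> ?J"
          using ideal_power_mult[OF I x(1) rees_setD(1)[OF cd(2), of "i - j"]] j by simp
        moreover have "c j \<otimes> y \<in> ?J"
          using ideal_power_mult[OF I rees_setD(1)[OF cd(1), of j] y(1)] j by simp
        ultimately have "a \<otimes> b \<ominus> c j \<otimes> d (i - j) \<in> ?J"
          using carr by (simp add: r_distr J.a_closed)
        thus ?thesis unfolding x(2) y(2) using carr by (intro J.rcos_eq_iff[THEN iffD2]) simp_all
      qed
      moreover have "c j \<in> gr_of R I c j" "d (i - j) \<in> gr_of R I d (i - j)"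
        using ideal.rcos_self[OF ideal_power_ideal[OF I]] rees_setD(2)[OF cd(1)] rees_setD(2)[OF cd(2)]
        by (simp_all add: gr_of_def)
      ultimately show ?thesis unfolding rcoset_mult_def by blast
    qed
    have cl: "(\<lambda>j. c j \<otimes> d (i - j)) \<in> {..i} \<rightarrow> carrier R"
      using rees_setD(2)[OF cd(1)] rees_setD(2)[OF cd(2)] by auto
    have "(gr_of R I c \<otimes>\<^bsub>gr_ring R I\<^esub> gr_of R I d) i
        = (\<Oplus>\<^bsub>R Quot ?J\<^esub>j\<in>{..i}. rcoset_mult R ?J (gr_of R I c j) (gr_of R I d (i - j)))"
      by (simp add: gr_ring_def)
    also have "\<dots> = (\<Oplus>\<^bsub>R Quot ?J\<^esub>j\<in>{..i}. ?J +> (c j \<otimes> d (i - j)))"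
      by (rule h.S.finsum_cong') (use rm cl in auto)
    also have "\<dots> = ?J +> (\<Oplus>j\<in>{..i}. c j \<otimes> d (i - j))"
      using h.hom_finsum[OF cl] by (simp add: comp_def)
    finally show "gr_of R I (c \<otimes>\<^bsub>rees_ring R I\<^esub> d) i = (gr_of R I c \<otimes>\<^bsub>gr_ring R I\<^esub> gr_of R I d) i"
      using rees_sel(1)[OF cd] by (simp add: gr_of_def)
  qed
next
  case (3 c d)
  hence cd: "c \<in> rees_set R I" "d \<in> rees_set R I" by simp_all
  show ?case
    using rees_sel(2)[OF cd] rees_setD(2)[OF cd(1)] rees_setD(2)[OF cd(2)]
    by (auto simp: gr_of_def gr_ring_def fun_eq_iff ideal.a_rcos_sum[OF ideal_power_ideal[OF I]])
next
  case 4
  show ?case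
    using a_rcos_zero[OF ideal_power_ideal[OF I] ideal_power_zero[OF I]]
    by (auto simp: rees_sel gr_of_def gr_ring_def fun_eq_iff)
qed

lemma gr_ring_is_ring: "ring (gr_ring R I)"
proof -
  have "ring (gr_ring R I \<lparr>carrier := gr_of R I ` carrier (rees_ring R I), zero := gr_of R I \<zero>\<^bsub>rees_ring R I\<^esub>\<rparr>)"
    by (rule ring.ring_hom_imp_img_ring[OF rees_ring gr_of_hom])
  moreover have "gr_ring R I \<lparr>carrier := gr_of R I ` carrier (rees_ring R I), zero := gr_of R I \<zero>\<^bsub>rees_ring R I\<^esub>\<rparr>
      = gr_ring R I"
    using gr_carrier gr_zero rees_sel(4) by simp
  ultimately show ?thesis by simp
qed

lemma gr_of_eq_iff:
  assumes "c \<in> rees_set R I" "d \<in> rees_set R I"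
  shows "gr_of R I c = gr_of R I d \<longleftrightarrow> (\<forall>i. c i \<ominus> d i \<in> ideal_power R I (Suc i))"
  using ideal.rcos_eq_iff[OF ideal_power_ideal[OF I]] rees_setD(2)[OF assms(1)] rees_setD(2)[OF assms(2)]
  by (auto simp: gr_of_def fun_eq_iff)

lemma rees_finsum:
  assumes "finite A" "\<And>x. x \<in> A \<Longrightarrow> p x \<in> rees_set R I"
  shows "finsum (rees_ring R I) p A = (\<lambda>i. \<Oplus>x\<in>A. p x i)"
  using assms
proof (induction A rule: finite_induct)
  case empty
  interpret X: ring "rees_ring R I" by (rule rees_ring)
  show ?case using X.finsum_empty by (simp add: rees_sel)
next
  case (insert x A)
  interpret X: ring "rees_ring R I" by (rule rees_ring)
  have "finsum (rees_ring R I) p A \<in> rees_set R I"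
    using X.finsum_closed[of p A] insert.prems by auto
  moreover have "finsum (rees_ring R I) p (insert x A) = p x \<oplus>\<^bsub>rees_ring R I\<^esub> finsum (rees_ring R I) p A"
    using insert by (intro X.finsum_insert) auto
  ultimately have "finsum (rees_ring R I) p (insert x A) = (\<lambda>i. p x i \<oplus> finsum (rees_ring R I) p A i)"
    using insert.prems rees_sel(2)[of "p x" "finsum (rees_ring R I) p A"] by simp
  moreover have "(\<Oplus>x\<in>insert x A. p x i) = p x i \<oplus> (\<Oplus>x\<in>A. p x i)" for i
    using insert rees_setD(2) by (intro finsum_insert) auto
  ultimately show ?case using insert by simp
qed

end

end

section \<open>Polynomial rings\<close>

context ring begin

lemma indexed_monom_mem:
  assumes "k \<in> carrier R" "set_mset a \<subseteq> {..<n::nat}"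
  shows "(\<lambda>b. if b = a then k else \<zero>) \<in> indexed_pset {..<n} (carrier R)"
  using assms(2)
proof (induction a)
  case empty
  have eq: "(\<lambda>b. if b = {#} then k else \<zero>) = indexed_const k" by (auto simp: indexed_const_def)
  show ?case unfolding eq by (rule indexed_pset.indexed_const[OF assms(1)])
next
  case (add i a)
  have "(\<lambda>b. if b = add_mset i a then k else \<zero>) = indexed_pmult (\<lambda>b. if b = a then k else \<zero>) i"
    by (auto simp: indexed_pmult_def fun_eq_iff dest: multi_member_split)
  thus ?case using add by (auto intro: indexed_pset.indexed_pmult)
qed

text \<open>
  The closure conditions that define the polynomials give exactly the families of coefficients with
  finite support: such a family is a finite sum of monomials.
\<close>

lemma mpoly_carrier:
  "carrier (mpoly_ring R n) =
    {p. (\<forall>a. p a \<in> carrier R) \<and> finite {a. p a \<noteq> \<zero>} \<and> (\<forall>a. p a \<noteq> \<zero> \<longrightarrow> set_mset a \<subseteq> {..<n})}"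
  (is "?L = ?R")
proof
  show "?L \<subseteq> ?R"
  proof
    fix p assume "p \<in> ?L"
    hence "p \<in> indexed_pset {..<n} (carrier R)" by (simp add: mpoly_ring_def)
    thus "p \<in> ?R"
    proof (induction rule: indexed_pset.induct)
      case (indexed_const k)
      have "{a. indexed_const k a \<noteq> \<zero>} \<subseteq> {{#}}" by (auto simp: indexed_const_def)
      thus ?case using indexed_const by (auto simp: indexed_const_def dest: finite_subset)
    next
      case (indexed_padd p q)
      have "{a. indexed_padd p q a \<noteq> \<zero>} \<subseteq> {a. p a \<noteq> \<zero>} \<union> {a. q a \<noteq> \<zero>}"
        using indexed_padd by (auto simp: indexed_padd_def)
      hence fin: "finite {a. indexed_padd p q a \<noteq> \<zero>}" by (rule finite_subset) (use indexed_padd in auto)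
      have "set_mset a \<subseteq> {..<n}" if "indexed_padd p q a \<noteq> \<zero>" for a
      proof -
        have "p a \<noteq> \<zero> \<or> q a \<noteq> \<zero>" using that indexed_padd by (auto simp: indexed_padd_def)
        thus ?thesis using indexed_padd by blast
      qed
      thus ?case using indexed_padd fin by (auto simp: indexed_padd_def)
    next
      case (indexed_pmult p i)
      have "{a. indexed_pmult p i a \<noteq> \<zero>} \<subseteq> add_mset i ` {a. p a \<noteq> \<zero>}"
      proof
        fix a assume "a \<in> {a. indexed_pmult p i a \<noteq> \<zero>}"
        hence "a = add_mset i (a - {#i#})" "p (a - {#i#}) \<noteq> \<zero>"
          by (auto simp: indexed_pmult_def split: if_splits)
        thus "a \<in> add_mset i ` {a. p a \<noteq> \<zero>}" by blast
      qed
      hence fin: "finite {a. indexed_pmult p i a \<noteq> \<zero>}" by (rule finite_subset) (use indexed_pmult in auto)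
      have "set_mset a \<subseteq> {..<n}" if "indexed_pmult p i a \<noteq> \<zero>" for a
      proof -
        from that have a: "a = add_mset i (a - {#i#})" "p (a - {#i#}) \<noteq> \<zero>"
          by (auto simp: indexed_pmult_def split: if_splits)
        hence "set_mset (a - {#i#}) \<subseteq> {..<n}" using indexed_pmult by blast
        thus ?thesis using indexed_pmult(2) by (subst a(1)) auto
      qed
      thus ?case using indexed_pmult fin by (auto simp: indexed_pmult_def)
    qed
  qed
  show "?R \<subseteq> ?L"
  proof
    fix p assume p: "p \<in> ?R"
    have "p \<in> indexed_pset {..<n} (carrier R)"
      if "finite A" "\<And>a. p a \<in> carrier R" "{a. p a \<noteq> \<zero>} \<subseteq> A"
        "\<And>a. p a \<noteq> \<zero> \<Longrightarrow> set_mset a \<subseteq> {..<n}" for A p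
      using that
    proof (induction A arbitrary: p rule: finite_induct)
      case empty
      hence "p = indexed_const \<zero>" by (auto simp: indexed_const_def)
      thus ?case using indexed_pset.indexed_const[OF zero_closed] by simp
    next
      case (insert x A)
      show ?case
      proof (cases "p x = \<zero>")
        case True
        with insert.prems have "{a. p a \<noteq> \<zero>} \<subseteq> A" by auto
        thus ?thesis using insert by blast
      next
        case False
        have "p(x := \<zero>) \<in> indexed_pset {..<n} (carrier R)"
          by (rule insert.IH) (use insert.prems in \<open>auto split: if_splits\<close>)
        moreover have "(\<lambda>b. if b = x then p x else \<zero>) \<in> indexed_pset {..<n} (carrier R)"
          using insert.prems(1,3) False by (intro indexed_monom_mem) auto
        moreover have "p = indexed_padd (\<lambda>b. if b = x then p x else \<zero>) (p(x := \<zero>))"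
          using insert.prems(1) by (auto simp: indexed_padd_def fun_eq_iff)
        ultimately show ?thesis using indexed_pset.indexed_padd by metis
      qed
    qed
    from this[of "{a. p a \<noteq> \<zero>}" p] p show "p \<in> ?L" by (simp add: mpoly_ring_def)
  qed
qed

end

section \<open>Extensions with formal coordinates\<close>

text \<open>
  The model is \<open>T = R[[t\<^sub>1, \<dots>, t\<^sub>m]]\<close>, where \<open>co h a\<close> is the coefficient of \<open>t\<^sup>a\<close> in \<open>h\<close>. An element
  need not be determined by its coefficients, and not every family of coefficients has to occur; in their
  place stands the expansion to first order, which can be iterated. This leaves room for rings of convergent
  power series, and nothing has to be said about infinite sums.
\<close>

locale coordinate_extension = R: cring R + T: cring T
  for R :: "('a, 'p) ring_scheme" and T :: "('b, 'q) ring_scheme" (structure) +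
  fixes m :: nat and \<iota> :: "'a \<Rightarrow> 'b" and t :: "nat \<Rightarrow> 'b" and co :: "'b \<Rightarrow> nat multiset \<Rightarrow> 'a"
  assumes iota_hom: "\<iota> \<in> ring_hom R T"
    and t_closed: "j < m \<Longrightarrow> t j \<in> carrier T"
    and co_closed: "h \<in> carrier T \<Longrightarrow> co h a \<in> carrier R"
    and co_supp: "h \<in> carrier T \<Longrightarrow> \<not> set_mset a \<subseteq> {..<m} \<Longrightarrow> co h a = \<zero>\<^bsub>R\<^esub>"
    and co_add: "h \<in> carrier T \<Longrightarrow> k \<in> carrier T \<Longrightarrow> co (h \<oplus> k) a = co h a \<oplus>\<^bsub>R\<^esub> co k a"
    and co_mult: "h \<in> carrier T \<Longrightarrow> k \<in> carrier T \<Longrightarrow>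
      co (h \<otimes> k) a = (\<Oplus>\<^bsub>R\<^esub>b\<in>{b. b \<subseteq># a}. co h b \<otimes>\<^bsub>R\<^esub> co k (a - b))"
    and co_iota: "r \<in> carrier R \<Longrightarrow> co (\<iota> r) a = (if a = {#} then r else \<zero>\<^bsub>R\<^esub>)"
    and co_t: "j < m \<Longrightarrow> co (t j) a = (if a = {#j#} then \<one>\<^bsub>R\<^esub> else \<zero>\<^bsub>R\<^esub>)"
    and expansion: "h \<in> carrier T \<Longrightarrow> \<exists>u. (\<forall>j<m. u j \<in> carrier T) \<and>
      h = \<iota> (co h {#}) \<oplus> (\<Oplus>j\<in>{..<m}. t j \<otimes> u j)"
begin

sublocale iota: ring_hom_cring R T \<iota>
  by unfold_locales (rule iota_hom)

lemma tpow_closed: "set_mset a \<subseteq> {..<m} \<Longrightarrow> mpow T t a \<in> carrier T"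
  using t_closed by (intro T.mpow_closed) auto

lemma tpow_add_mset:
  "set_mset (add_mset j a) \<subseteq> {..<m} \<Longrightarrow> mpow T t (add_mset j a) = t j \<otimes> mpow T t a"
  using t_closed by (intro T.mpow_add_mset) auto

lemma co_zero: "co \<zero> a = \<zero>\<^bsub>R\<^esub>"
  using co_iota[OF R.zero_closed, of a] by simp

lemma co_one: "co \<one> a = (if a = {#} then \<one>\<^bsub>R\<^esub> else \<zero>\<^bsub>R\<^esub>)"
  using co_iota[OF R.one_closed, of a] by simp

lemma co_uminus: "h \<in> carrier T \<Longrightarrow> co (\<ominus> h) a = \<ominus>\<^bsub>R\<^esub> co h a"
  using co_add[of "\<ominus> h" h a]
  by (intro R.minus_equality[symmetric]) (simp_all add: co_closed co_zero T.l_neg)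

lemma co_minus: "h \<in> carrier T \<Longrightarrow> k \<in> carrier T \<Longrightarrow> co (h \<ominus> k) a = co h a \<ominus>\<^bsub>R\<^esub> co k a"
  by (simp add: T.minus_eq R.minus_eq co_add co_uminus)

lemma co_finsum:
  "finite A \<Longrightarrow> (\<And>x. x \<in> A \<Longrightarrow> f x \<in> carrier T) \<Longrightarrow>
    co (finsum T f A) a = (\<Oplus>\<^bsub>R\<^esub>x\<in>A. co (f x) a)"
proof (induction A rule: finite_induct)
  case (insert x A)
  have "finsum T f (insert x A) = f x \<oplus> finsum T f A"
    using insert by (intro T.finsum_insert) auto
  moreover have "(\<Oplus>\<^bsub>R\<^esub>x\<in>insert x A. co (f x) a) = co (f x) a \<oplus>\<^bsub>R\<^esub> (\<Oplus>\<^bsub>R\<^esub>x\<in>A. co (f x) a)"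
    using insert by (intro R.finsum_insert) (auto intro: co_closed)
  moreover have "finsum T f A \<in> carrier T" using insert by (intro T.finsum_closed) auto
  ultimately show ?case using insert by (simp add: co_add)
qed (simp add: co_zero)

lemma co_iota_mult:
  assumes r: "r \<in> carrier R" and h: "h \<in> carrier T"
  shows "co (\<iota> r \<otimes> h) a = r \<otimes>\<^bsub>R\<^esub> co h a"
proof -
  have "co (\<iota> r \<otimes> h) a = (\<Oplus>\<^bsub>R\<^esub>b\<in>{b. b \<subseteq># a}. co (\<iota> r) b \<otimes>\<^bsub>R\<^esub> co h (a - b))"
    using r h by (intro co_mult) simp_all
  also have "\<dots> = (\<Oplus>\<^bsub>R\<^esub>b\<in>{b. b \<subseteq># a}. if {#} = b then r \<otimes>\<^bsub>R\<^esub> co h (a - b) else \<zero>\<^bsub>R\<^esub>)"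
    using r h by (intro R.finsum_cong') (auto simp: co_iota co_closed)
  also have "\<dots> = r \<otimes>\<^bsub>R\<^esub> co h (a - {#})"
    using r h by (intro R.finsum_singleton) (auto simp: co_closed)
  finally show ?thesis by simp
qed

lemma co_t_mult:
  assumes j: "j < m" and h: "h \<in> carrier T"
  shows "co (t j \<otimes> h) a = (if j \<in># a then co h (a - {#j#}) else \<zero>\<^bsub>R\<^esub>)"
proof -
  have "co (t j \<otimes> h) a = (\<Oplus>\<^bsub>R\<^esub>b\<in>{b. b \<subseteq># a}. co (t j) b \<otimes>\<^bsub>R\<^esub> co h (a - b))"
    using t_closed[OF j] h by (intro co_mult) simp_all
  also have "\<dots> = (\<Oplus>\<^bsub>R\<^esub>b\<in>{b. b \<subseteq># a}. if {#j#} = b then co h (a - b) else \<zero>\<^bsub>R\<^esub>)"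
    using j h by (intro R.finsum_cong') (auto simp: co_t co_closed)
  also have "\<dots> = (if j \<in># a then co h (a - {#j#}) else \<zero>\<^bsub>R\<^esub>)"
  proof (cases "j \<in># a")
    case True
    hence "(\<Oplus>\<^bsub>R\<^esub>b\<in>{b. b \<subseteq># a}. if {#j#} = b then co h (a - b) else \<zero>\<^bsub>R\<^esub>) = co h (a - {#j#})"
      using h by (intro R.finsum_singleton) (auto simp: co_closed)
    thus ?thesis using True by simp
  next
    case False
    have "(\<Oplus>\<^bsub>R\<^esub>b\<in>{b. b \<subseteq># a}. if {#j#} = b then co h (a - b) else \<zero>\<^bsub>R\<^esub>)
        = (\<Oplus>\<^bsub>R\<^esub>b\<in>{b. b \<subseteq># a}. \<zero>\<^bsub>R\<^esub>)"
      using False by (intro R.finsum_cong') auto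
    thus ?thesis using False by simp
  qed
  finally show ?thesis .
qed

lemma co_term:
  assumes "c \<in> carrier R" "set_mset b \<subseteq> {..<m}"
  shows "co (\<iota> c \<otimes> mpow T t b) a = (if a = b then c else \<zero>\<^bsub>R\<^esub>)"
  using assms(2)
proof (induction b arbitrary: a)
  case empty
  show ?case using assms(1) by (simp add: co_iota)
next
  case (add j b)
  have j: "j < m" and b: "set_mset b \<subseteq> {..<m}" using add.prems by auto
  have "\<iota> c \<otimes> mpow T t (add_mset j b) = t j \<otimes> (\<iota> c \<otimes> mpow T t b)"
    using tpow_add_mset[OF add.prems] tpow_closed[OF b] t_closed[OF j] assms(1)
    by (simp add: T.m_lcomm)
  moreover have "\<iota> c \<otimes> mpow T t b \<in> carrier T" using tpow_closed[OF b] assms(1) by simp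
  ultimately have "co (\<iota> c \<otimes> mpow T t (add_mset j b)) a
      = (if j \<in># a then (if a - {#j#} = b then c else \<zero>\<^bsub>R\<^esub>) else \<zero>\<^bsub>R\<^esub>)"
    using add.IH[OF b] j by (simp add: co_t_mult)
  also have "\<dots> = (if a = add_mset j b then c else \<zero>\<^bsub>R\<^esub>)" by auto
  finally show ?case .
qed

text \<open>
  The Taylor polynomial of degree \<open>d\<close> in the coordinates \<open>t\<close>.
\<close>

definition trunc :: "nat \<Rightarrow> 'b \<Rightarrow> 'b"
  where "trunc d h = (\<Oplus>a\<in>mons m d. \<iota> (co h a) \<otimes> mpow T t a)"

lemma term_closed: "c \<in> carrier R \<Longrightarrow> a \<in> mons m d \<Longrightarrow> \<iota> c \<otimes> mpow T t a \<in> carrier T"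
  by (intro T.m_closed iota.hom_closed tpow_closed) (auto simp: mons_def)

lemma trunc_closed: "h \<in> carrier T \<Longrightarrow> trunc d h \<in> carrier T"
  unfolding trunc_def by (intro T.finsum_closed) (auto intro: term_closed co_closed)

lemma trunc_add:
  assumes "h \<in> carrier T" "k \<in> carrier T"
  shows "trunc d (h \<oplus> k) = trunc d h \<oplus> trunc d k"
proof -
  have "trunc d (h \<oplus> k) = (\<Oplus>a\<in>mons m d. \<iota> (co h a) \<otimes> mpow T t a \<oplus> \<iota> (co k a) \<otimes> mpow T t a)"
    unfolding trunc_def
  proof (rule T.finsum_cong')
    fix a assume "a \<in> mons m d"
    hence "mpow T t a \<in> carrier T" by (intro tpow_closed) (simp add: mons_def)
    thus "\<iota> (co (h \<oplus> k) a) \<otimes> mpow T t a = \<iota> (co h a) \<otimes> mpow T t a \<oplus> \<iota> (co k a) \<otimes> mpow T t a"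
      using assms by (simp add: co_add co_closed T.l_distr)
  qed (use assms in \<open>auto intro!: T.a_closed term_closed co_closed\<close>)
  also have "\<dots> = trunc d h \<oplus> trunc d k"
    unfolding trunc_def using assms by (intro T.finsum_addf) (auto intro!: term_closed co_closed)
  finally show ?thesis .
qed

lemma trunc_t_mult:
  assumes j: "j < m" and h: "h \<in> carrier T"
  shows "trunc (Suc d) (t j \<otimes> h) = t j \<otimes> trunc d h"
proof -
  have sub: "add_mset j ` mons m d \<subseteq> mons m (Suc d)" using j by (auto simp: mons_def)
  have "trunc (Suc d) (t j \<otimes> h)
      = (\<Oplus>a\<in>add_mset j ` mons m d. \<iota> (co (t j \<otimes> h) a) \<otimes> mpow T t a)"
    unfolding trunc_def
  proof (rule T.add.finprod_mono_neutral_cong_right[OF finite_mons sub])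
    fix a assume a: "a \<in> mons m (Suc d) - add_mset j ` mons m d"
    have "j \<notin># a"
    proof
      assume "j \<in># a"
      then obtain b where b: "a = add_mset j b" by (meson multi_member_split)
      with a have "b \<in> mons m d" by (auto simp: mons_def)
      with a b show False by blast
    qed
    moreover have "mpow T t a \<in> carrier T" using a by (intro tpow_closed) (simp add: mons_def)
    ultimately show "\<iota> (co (t j \<otimes> h) a) \<otimes> mpow T t a = \<zero>"
      using j h by (simp add: co_t_mult)
  qed (use t_closed[OF j] h in \<open>auto intro!: term_closed co_closed\<close>)
  also have "\<dots> = (\<Oplus>a\<in>mons m d. \<iota> (co (t j \<otimes> h) (add_mset j a)) \<otimes> mpow T t (add_mset j a))"
    by (rule T.finsum_reindex)
       (use sub t_closed[OF j] h in \<open>auto intro!: term_closed co_closed simp: inj_on_def\<close>)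
  also have "\<dots> = (\<Oplus>a\<in>mons m d. t j \<otimes> (\<iota> (co h a) \<otimes> mpow T t a))"
  proof (rule T.finsum_cong')
    fix a assume a: "a \<in> mons m d"
    hence "mpow T t (add_mset j a) = t j \<otimes> mpow T t a" "mpow T t a \<in> carrier T"
      using j by (auto intro!: tpow_add_mset tpow_closed simp: mons_def)
    thus "\<iota> (co (t j \<otimes> h) (add_mset j a)) \<otimes> mpow T t (add_mset j a)
        = t j \<otimes> (\<iota> (co h a) \<otimes> mpow T t a)"
      using j h t_closed[OF j] by (simp add: co_t_mult co_closed T.m_lcomm)
  qed (use t_closed[OF j] h in \<open>auto intro!: T.m_closed[OF t_closed[OF j]] term_closed co_closed\<close>)
  also have "\<dots> = t j \<otimes> trunc d h"
    unfolding trunc_def using t_closed[OF j] h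
    by (intro T.finsum_rdistr[symmetric]) (auto intro!: term_closed co_closed)
  finally show ?thesis .
qed

lemma trunc_iota_mult:
  assumes r: "r \<in> carrier R" and h: "h \<in> carrier T"
  shows "trunc d (\<iota> r \<otimes> h) = \<iota> r \<otimes> trunc d h"
proof -
  have "trunc d (\<iota> r \<otimes> h) = (\<Oplus>a\<in>mons m d. \<iota> r \<otimes> (\<iota> (co h a) \<otimes> mpow T t a))"
    unfolding trunc_def
  proof (rule T.finsum_cong')
    fix a assume "a \<in> mons m d"
    hence "mpow T t a \<in> carrier T" by (intro tpow_closed) (simp add: mons_def)
    thus "\<iota> (co (\<iota> r \<otimes> h) a) \<otimes> mpow T t a = \<iota> r \<otimes> (\<iota> (co h a) \<otimes> mpow T t a)"
      using r h by (simp add: co_iota_mult co_closed T.m_assoc)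
  qed (use r h in \<open>auto intro!: T.m_closed[OF iota.hom_closed[OF r]] term_closed co_closed\<close>)
  also have "\<dots> = \<iota> r \<otimes> trunc d h"
    unfolding trunc_def using r h
    by (intro T.finsum_rdistr[symmetric]) (auto intro!: term_closed co_closed)
  finally show ?thesis .
qed

lemma trunc_Suc:
  assumes h: "h \<in> carrier T"
  shows "trunc (Suc d) h = trunc d h \<oplus>
    (\<Oplus>a\<in>{a. set_mset a \<subseteq> {..<m} \<and> size a = Suc d}. \<iota> (co h a) \<otimes> mpow T t a)"
proof -
  have fin: "finite {a. set_mset a \<subseteq> {..<m} \<and> size a = Suc d}"
    by (rule finite_subset[OF _ finite_mons[of m "Suc d"]]) (auto simp: mons_def)
  have eq: "mons m (Suc d) = mons m d \<union> {a. set_mset a \<subseteq> {..<m} \<and> size a = Suc d}"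
    by (auto simp: mons_def)
  show ?thesis unfolding trunc_def eq
  proof (rule T.finsum_Un_disjoint[OF finite_mons fin])
    show "(\<lambda>a. \<iota> (co h a) \<otimes> mpow T t a) \<in> {a. set_mset a \<subseteq> {..<m} \<and> size a = Suc d} \<rightarrow> carrier T"
      using h by (auto intro!: T.m_closed tpow_closed co_closed)
  qed (use h in \<open>auto intro!: term_closed co_closed simp: mons_def\<close>)
qed

context
  fixes I assumes I: "ideal I R"
begin

text \<open>
  The ideal of \<open>T\<close> generated by \<open>I\<close> and the coordinates, described by the constant coefficients.
\<close>

definition "K = {h \<in> carrier T. co h {#} \<in> I}"

lemma K_ideal: "ideal K T"
proof (rule idealI[OF T.ring_axioms])
  interpret I: ideal I R by (rule I)
  have co0: "co (h \<otimes> k) {#} = co h {#} \<otimes>\<^bsub>R\<^esub> co k {#}" if "h \<in> carrier T" "k \<in> carrier T" for h k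
    using that by (simp add: co_mult co_closed)
  show "subgroup K (add_monoid T)"
    by (rule subgroup.intro)
       (auto simp: K_def co_add co_zero I.a_closed a_inv_def[symmetric] co_uminus I.a_inv_closed)
  fix a x assume "a \<in> K" "x \<in> carrier T"
  thus "x \<otimes> a \<in> K" "a \<otimes> x \<in> K"
    by (auto simp: K_def co0 co_closed I.I_l_closed I.I_r_closed)
qed

text \<open>
  Passing to a power of \<open>K\<close> either consumes a coordinate or moves a coefficient into the next power of \<open>I\<close>.
  The difference of naturals is meant: for \<open>|a| \<ge> d\<close> there is no condition on the coefficient.
\<close>

lemma co_power:
  assumes "h \<in> ideal_power T K d"
  shows "co h a \<in> ideal_power R I (d - size a)"
  using assms
proof (induction d arbitrary: h a)
  case 0
  thus ?case using co_closed by (simp add: ideal_power_0)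
next
  case (Suc d)
  from Suc.prems show ?case unfolding ideal_power_Suc[of T]
  proof (induction h rule: ideal_prod.induct)
    case (prod x k)
    have x: "x \<in> carrier T" and k: "k \<in> carrier T" "co k {#} \<in> I"
      using prod T.ideal_power_closed[OF K_ideal] by (auto simp: K_def)
    show ?case unfolding co_mult[OF x k(1)]
    proof (rule ideal.finsum_in_ideal[OF R.ideal_power_ideal[OF I]])
      fix b assume "b \<in> {b. b \<subseteq># a}"
      hence b: "b \<subseteq># a" by simp
      have "co k c \<in> ideal_power R I (1 - size c)" for c
        using k R.ideal_power_1[OF I] co_closed[OF k(1)]
        by (cases "c = {#}") (auto simp: ideal_power_0 nonempty_has_size Suc_leI)
      hence "co x b \<otimes>\<^bsub>R\<^esub> co k (a - b) \<in> ideal_power R I ((d - size b) + (1 - size (a - b)))"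
        using Suc.IH[OF prod(1)] by (intro R.ideal_power_mult[OF I])
      moreover have "Suc d - size a \<le> (d - size b) + (1 - size (a - b))"
        using size_mset_mono[OF b] size_Diff_submset[OF b] by simp
      ultimately show "co x b \<otimes>\<^bsub>R\<^esub> co k (a - b) \<in> ideal_power R I (Suc d - size a)"
        by (rule R.ideal_power_mono[OF I, rotated])
    qed
  next
    case (sum x y)
    have "x \<in> carrier T" "y \<in> carrier T"
      using sum(1,2) T.ideal_power_closed[OF K_ideal, of _ "Suc d"] by (simp_all add: ideal_power_Suc)
    thus ?case using sum additive_subgroup.a_closed[OF ideal.axioms(1)[OF R.ideal_power_ideal[OF I]]]
      by (simp add: co_add)
  qed
qed

lemma t_in_K: "j < m \<Longrightarrow> t j \<in> K"
  using additive_subgroup.zero_closed[OF ideal.axioms(1)[OF I]] by (simp add: K_def t_closed co_t)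

lemma iota_power:
  assumes "c \<in> ideal_power R I d" shows "\<iota> c \<in> ideal_power T K d"
  using assms
proof (induction d arbitrary: c)
  case 0
  thus ?case by (simp add: ideal_power_0)
next
  case (Suc d)
  from Suc.prems show ?case unfolding ideal_power_Suc
  proof (induction c rule: ideal_prod.induct)
    case (prod x y)
    have "x \<in> carrier R" "y \<in> carrier R"
      using prod R.ideal_power_closed[OF I] ideal.Icarr[OF I] by auto
    moreover have "\<iota> y \<in> K" using prod(2) calculation by (simp add: K_def co_iota)
    ultimately show ?case using Suc.IH[OF prod(1)] by (simp add: ideal_prod.prod)
  next
    case (sum x y)
    have "x \<in> carrier R" "y \<in> carrier R"
      using sum(1,2) R.ideal_power_closed[OF I, of _ "Suc d"] by (simp_all add: ideal_power_Suc)
    thus ?case using sum by (simp add: ideal_prod.sum)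
  qed
qed

lemma tpow_power: "set_mset a \<subseteq> {..<m} \<Longrightarrow> mpow T t a \<in> ideal_power T K (size a)"
proof (induction a)
  case (add j a)
  have "t j \<otimes> mpow T t a \<in> ideal_power T K (Suc 0 + size a)"
    using add t_in_K[of j] T.ideal_power_1[OF K_ideal] by (intro T.ideal_power_mult[OF K_ideal]) auto
  thus ?case using tpow_add_mset[OF add.prems] by simp
qed (simp add: ideal_power_0)

lemma term_power:
  assumes "c \<in> ideal_power R I (d - size a)" "set_mset a \<subseteq> {..<m}"
  shows "\<iota> c \<otimes> mpow T t a \<in> ideal_power T K d"
  using T.ideal_power_mult[OF K_ideal iota_power[OF assms(1)] tpow_power[OF assms(2)]]
  by (rule T.ideal_power_mono[OF K_ideal, rotated]) simp

definition "approx d h \<longleftrightarrow> h \<in> carrier T \<and> h \<ominus> trunc d h \<in> ideal_power T K (Suc d)"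

lemma approx_add:
  assumes "approx d h" "approx d k" shows "approx d (h \<oplus> k)"
proof -
  from assms have hk: "h \<in> carrier T" "k \<in> carrier T" by (auto simp: approx_def)
  have "h \<oplus> k \<ominus> trunc d (h \<oplus> k)
      = (h \<ominus> trunc d h) \<oplus> (k \<ominus> trunc d k)"
    unfolding trunc_add[OF hk] using hk trunc_closed[OF hk(1), of d] trunc_closed[OF hk(2), of d]
    by (simp add: T.minus_eq T.minus_add T.a_ac)
  thus ?thesis
    using assms hk additive_subgroup.a_closed[OF ideal.axioms(1)[OF T.ideal_power_ideal[OF K_ideal]]]
    by (auto simp: approx_def)
qed

lemma approx_zero: "approx d \<zero>"
proof -
  have "trunc d \<zero> = (\<Oplus>a\<in>mons m d. \<zero>)"
    unfolding trunc_def
  proof (rule T.finsum_cong')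
    fix a assume "a \<in> mons m d"
    hence "mpow T t a \<in> carrier T" by (intro tpow_closed) (simp add: mons_def)
    thus "\<iota> (co \<zero> a) \<otimes> mpow T t a = \<zero>" by (simp add: co_zero)
  qed auto
  thus ?thesis using T.ideal_power_zero[OF K_ideal] by (simp add: approx_def T.minus_eq)
qed

lemma approx_finsum:
  "(\<And>x. x \<in> A \<Longrightarrow> approx d (f x)) \<Longrightarrow> approx d (finsum T f A)"
proof (induction A rule: infinite_finite_induct)
  case (insert x A)
  have "finsum T f (insert x A) = f x \<oplus> finsum T f A"
    using insert by (intro T.finsum_insert) (auto simp: approx_def)
  thus ?case using insert approx_add by simp
qed (simp_all add: approx_zero T.finsum_infinite)

lemma approx_t_mult:
  assumes j: "j < m" and h: "approx d h" shows "approx (Suc d) (t j \<otimes> h)"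
proof -
  from h have hT: "h \<in> carrier T" and K: "h \<ominus> trunc d h \<in> ideal_power T K (Suc d)"
    by (auto simp: approx_def)
  have "t j \<otimes> (h \<ominus> trunc d h) \<in> ideal_power T K (Suc 0 + Suc d)"
    using T.ideal_power_1[OF K_ideal] t_in_K[OF j] K by (intro T.ideal_power_mult[OF K_ideal]) auto
  moreover have "t j \<otimes> (h \<ominus> trunc d h) = t j \<otimes> h \<ominus> trunc (Suc d) (t j \<otimes> h)"
    using j hT t_closed[OF j] trunc_closed[OF hT] by (simp add: trunc_t_mult T.minus_eq T.r_distr T.r_minus)
  ultimately show ?thesis using hT t_closed[OF j] by (simp add: approx_def)
qed

lemma approx_iota_mult:
  assumes r: "r \<in> I" and hK: "h \<in> ideal_power T K d" and h: "approx d h"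
  shows "approx (Suc d) (\<iota> r \<otimes> h)"
proof -
  from h have hT: "h \<in> carrier T" and K: "h \<ominus> trunc d h \<in> ideal_power T K (Suc d)"
    by (auto simp: approx_def)
  have rR: "r \<in> carrier R" using r ideal.Icarr[OF I] by blast
  let ?S = "{a. set_mset a \<subseteq> {..<m} \<and> size a = Suc d}"
  let ?s = "\<Oplus>a\<in>?S. \<iota> (co (\<iota> r \<otimes> h) a) \<otimes> mpow T t a"
  have s: "?s \<in> ideal_power T K (Suc (Suc d))"
  proof (rule ideal.finsum_in_ideal[OF T.ideal_power_ideal[OF K_ideal]])
    fix a assume a: "a \<in> ?S"
    have "r \<otimes>\<^bsub>R\<^esub> co h a \<in> I"
      by (rule ideal.I_r_closed[OF I r co_closed[OF hT]])
    hence "co (\<iota> r \<otimes> h) a \<in> ideal_power R I (Suc (Suc d) - size a)"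
      using a R.ideal_power_1[OF I] rR hT by (simp add: co_iota_mult)
    thus "\<iota> (co (\<iota> r \<otimes> h) a) \<otimes> mpow T t a \<in> ideal_power T K (Suc (Suc d))"
      using a by (intro term_power) auto
  qed
  have sT: "?s \<in> carrier T" by (rule T.ideal_power_closed[OF K_ideal s])
  have "\<iota> r \<in> ideal_power T K (Suc 0)"
    using r R.ideal_power_1[OF I] by (intro iota_power) simp
  hence 1: "\<iota> r \<otimes> (h \<ominus> trunc d h) \<in> ideal_power T K (Suc (Suc d))"
    using T.ideal_power_mult[OF K_ideal _ K, of "\<iota> r" "Suc 0"] by simp
  have "\<iota> r \<otimes> h \<ominus> trunc (Suc d) (\<iota> r \<otimes> h) = \<iota> r \<otimes> (h \<ominus> trunc d h) \<ominus> ?s"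
    unfolding trunc_Suc[OF T.m_closed[OF iota.hom_closed[OF rR] hT]]
    unfolding trunc_iota_mult[OF rR hT]
    using rR hT trunc_closed[OF hT] sT
    by (simp add: T.minus_eq T.minus_add T.r_distr T.r_minus T.a_assoc)
  also have "\<dots> \<in> ideal_power T K (Suc (Suc d))"
    by (rule ideal.minus_closed_ideal[OF T.ideal_power_ideal[OF K_ideal] 1 s])
  finally show ?thesis using rR hT by (simp add: approx_def)
qed

text \<open>
  Every element of \<open>K\<^sup>d\<close> is approximated by its Taylor polynomial. In the induction step an element of
  \<open>K\<close> is written as \<open>r + \<Sum>\<^sub>j t\<^sub>j u\<^sub>j\<close> with \<open>r \<in> I\<close>. Multiplication by \<open>t\<^sub>j\<close> shifts Taylor polynomials
  exactly, and multiplication by \<open>r\<close> commutes with forming them up to terms of degree \<open>d + 1\<close>, whose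
  coefficients lie in \<open>I\<close>.
\<close>

lemma power_approx:
  assumes "h \<in> ideal_power T K d" shows "approx d h"
  using assms
proof (induction d arbitrary: h)
  case 0
  hence h: "h \<in> carrier T" by (simp add: ideal_power_0)
  obtain u where u: "\<And>j. j < m \<Longrightarrow> u j \<in> carrier T"
    "h = \<iota> (co h {#}) \<oplus> (\<Oplus>j\<in>{..<m}. t j \<otimes> u j)"
    using expansion[OF h] by blast
  have s: "(\<Oplus>j\<in>{..<m}. t j \<otimes> u j) \<in> K"
    using u(1) t_in_K by (intro ideal.finsum_in_ideal[OF K_ideal] ideal.I_r_closed[OF K_ideal]) auto
  have "mons m 0 = {{#}}" by (auto simp: mons_def)
  hence tr: "trunc 0 h = \<iota> (co h {#})"
    using h by (simp add: trunc_def co_closed)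
  have "h \<ominus> \<iota> (co h {#}) = (\<Oplus>j\<in>{..<m}. t j \<otimes> u j)"
    using h co_closed[OF h] ideal.Icarr[OF K_ideal s]
    by (subst u(2)) (simp add: T.minus_eq T.a_ac T.r_neg1 T.r_neg2 T.r_neg)
  thus ?case using h s tr T.ideal_power_1[OF K_ideal] by (simp add: approx_def)
next
  case (Suc d)
  from Suc.prems show ?case unfolding ideal_power_Suc[of T]
  proof (induction h rule: ideal_prod.induct)
    case (prod x k)
    have x: "x \<in> carrier T" and k: "k \<in> carrier T" "co k {#} \<in> I"
      using prod T.ideal_power_closed[OF K_ideal] by (auto simp: K_def)
    obtain u where u: "\<And>j. j < m \<Longrightarrow> u j \<in> carrier T"
      "k = \<iota> (co k {#}) \<oplus> (\<Oplus>j\<in>{..<m}. t j \<otimes> u j)"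
      using expansion[OF k(1)] by blast
    have tu: "(\<lambda>j. t j \<otimes> u j) \<in> {..<m} \<rightarrow> carrier T" using u(1) t_closed by auto
    have "x \<otimes> k = x \<otimes> \<iota> (co k {#}) \<oplus> x \<otimes> (\<Oplus>j\<in>{..<m}. t j \<otimes> u j)"
      using x T.finsum_closed[OF tu] co_closed[OF k(1)] by (subst u(2)) (simp add: T.r_distr)
    also have "x \<otimes> (\<Oplus>j\<in>{..<m}. t j \<otimes> u j) = (\<Oplus>j\<in>{..<m}. x \<otimes> (t j \<otimes> u j))"
      using x tu by (intro T.finsum_rdistr) auto
    also have "\<dots> = (\<Oplus>j\<in>{..<m}. t j \<otimes> (x \<otimes> u j))"
      using x u(1) t_closed by (intro T.finsum_cong') (auto simp: T.m_lcomm)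
    also have "x \<otimes> \<iota> (co k {#}) = \<iota> (co k {#}) \<otimes> x"
      using x co_closed[OF k(1)] by (simp add: T.m_comm)
    finally have eq: "x \<otimes> k = \<iota> (co k {#}) \<otimes> x \<oplus> (\<Oplus>j\<in>{..<m}. t j \<otimes> (x \<otimes> u j))" .
    show ?case unfolding eq
    proof (intro approx_add approx_iota_mult approx_finsum approx_t_mult k(2) prod(1) Suc.IH)
      fix j assume j: "j \<in> {..<m}"
      show "j < m" using j by simp
      show "x \<otimes> u j \<in> ideal_power T K d"
        using j u(1) by (intro ideal.I_r_closed[OF T.ideal_power_ideal[OF K_ideal] prod(1)]) simp
    qed
  next
    case (sum x y)
    thus ?case by (intro approx_add)
  qed
qed

text \<open>
  This is the injectivity of \<open>gr\<^sub>K(T) \<rightarrow> gr\<^sub>I(R)[t\<^sub>1, \<dots>, t\<^sub>m]\<close> in degree \<open>d\<close>: the coefficient of \<open>t\<^sup>a\<close>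
  contributes in degree \<open>i = d - |a|\<close> of \<open>gr\<^sub>I(R)\<close>. If all these coefficients vanish, then the
  Taylor polynomial lies in \<open>K\<^sup>d\<^sup>+\<^sup>1\<close>, and so does \<open>h\<close>.
\<close>

lemma power_Suc_iff:
  assumes h: "h \<in> ideal_power T K d"
  shows "h \<in> ideal_power T K (Suc d) \<longleftrightarrow> (\<forall>a i. i + size a = d \<longrightarrow> co h a \<in> ideal_power R I (Suc i))"
proof
  assume "h \<in> ideal_power T K (Suc d)"
  from co_power[OF this] show "\<forall>a i. i + size a = d \<longrightarrow> co h a \<in> ideal_power R I (Suc i)"
    by (auto simp: Suc_diff_le dest: spec) (metis add_Suc add_diff_cancel_right')
next
  assume co: "\<forall>a i. i + size a = d \<longrightarrow> co h a \<in> ideal_power R I (Suc i)"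
  have hT: "h \<in> carrier T" by (rule T.ideal_power_closed[OF K_ideal h])
  have tr: "trunc d h \<in> ideal_power T K (Suc d)"
    unfolding trunc_def
  proof (rule ideal.finsum_in_ideal[OF T.ideal_power_ideal[OF K_ideal]], rule term_power)
    fix a assume a: "a \<in> mons m d"
    hence "Suc d - size a = Suc (d - size a)" "(d - size a) + size a = d" by (auto simp: mons_def)
    thus "co h a \<in> ideal_power R I (Suc d - size a)" using co by metis
  qed (simp add: mons_def)
  have "h \<ominus> trunc d h \<in> ideal_power T K (Suc d)" using power_approx[OF h] by (simp add: approx_def)
  hence "(h \<ominus> trunc d h) \<oplus> trunc d h \<in> ideal_power T K (Suc d)"
    using tr additive_subgroup.a_closed[OF ideal.axioms(1)[OF T.ideal_power_ideal[OF K_ideal]]] by blast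
  thus "h \<in> ideal_power T K (Suc d)"
    using hT trunc_closed[OF hT] by (simp add: T.minus_eq T.a_assoc T.l_neg)
qed

end

end

section \<open>Graded rings of extensions with formal coordinates\<close>

lemma (in ideal) finsum_diff_in_ideal:
  assumes "finite A" "\<And>x. x \<in> A \<Longrightarrow> f x \<in> carrier R" "\<And>x. x \<in> A \<Longrightarrow> g x \<in> carrier R"
    "\<And>x. x \<in> A \<Longrightarrow> f x \<ominus> g x \<in> I"
  shows "finsum R f A \<ominus> finsum R g A \<in> I"
  using assms
proof (induction A rule: finite_induct)
  case (insert x A)
  have cl: "finsum R f A \<in> carrier R" "finsum R g A \<in> carrier R"
    using insert.prems by (auto intro!: finsum_closed)
  have "finsum R f (insert x A) = f x \<oplus> finsum R f A" "finsum R g (insert x A) = g x \<oplus> finsum R g A"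
    using insert by (auto intro!: finsum_insert)
  hence "finsum R f (insert x A) \<ominus> finsum R g (insert x A)
      = (f x \<ominus> g x) \<oplus> (finsum R f A \<ominus> finsum R g A)"
    using cl insert.prems by (simp add: minus_eq minus_add a_ac)
  thus ?case using insert by (simp add: a_closed)
qed (simp add: minus_eq)

context coordinate_extension begin

context
  fixes I assumes I: "ideal I R"
begin

abbreviation (input) "KI \<equiv> K I"
abbreviation (input) "gr \<equiv> gr_ring R I"
text \<open>
  The coefficients of \<open>t\<^sup>a\<close> in a sequence \<open>(h\<^sub>d)\<close> with \<open>h\<^sub>d \<in> K\<^sup>d\<close>, shifted so that the one in \<open>I\<^sup>i\<close> has
  index \<open>i\<close>.
\<close>

abbreviation (input) "strand h a \<equiv> (\<lambda>i. co (h (i + size a)) a)"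

text \<open>
  The map from the Rees algebra of \<open>K\<close> to \<open>gr\<^sub>I(R)[t\<^sub>1, \<dots>, t\<^sub>m]\<close> that induces the isomorphism with
  \<open>gr\<^sub>K(T)\<close>.
\<close>

definition "gr_coeffs h = (\<lambda>a. gr_of R I (strand h a))"

lemma rees_T_closed: "h \<in> rees_set T KI \<Longrightarrow> h d \<in> carrier T"
  by (rule T.rees_setD(2)[OF K_ideal[OF I]])

lemma strand_rees:
  assumes h: "h \<in> rees_set T KI" shows "strand h a \<in> rees_set R I"
proof -
  have "co (h (i + size a)) a \<in> ideal_power R I i" for i
    using co_power[OF I T.rees_setD(1)[OF K_ideal[OF I] h], of "i + size a" a] by simp
  moreover have "finite {i. strand h a i \<noteq> \<zero>\<^bsub>R\<^esub>}"
  proof (rule finite_subset)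
    show "{i. strand h a i \<noteq> \<zero>\<^bsub>R\<^esub>} \<subseteq> (\<lambda>i. i + size a) -` {d. h d \<noteq> \<zero>}"
      by (auto simp: co_zero)
    show "finite ((\<lambda>i. i + size a) -` {d. h d \<noteq> \<zero>})"
      using h by (intro finite_vimageI) (auto simp: rees_set_def inj_on_def)
  qed
  ultimately show ?thesis by (auto simp: rees_set_def)
qed

lemma gr_coeffs_zero: "(\<And>i. strand h a i = \<zero>\<^bsub>R\<^esub>) \<Longrightarrow> gr_coeffs h a = \<zero>\<^bsub>gr\<^esub>"
  by (simp add: gr_coeffs_def R.gr_zero[OF I])

lemma gr_coeffs_closed:
  assumes h: "h \<in> rees_set T KI" shows "gr_coeffs h \<in> carrier (mpoly_ring gr m)"
  unfolding ring.mpoly_carrier[OF R.gr_ring_is_ring[OF I]]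
proof safe
  fix a
  show "gr_coeffs h a \<in> carrier gr"
    using strand_rees[OF h] by (simp add: gr_coeffs_def R.gr_carrier[OF I])
  show "x < m" if "gr_coeffs h a \<noteq> \<zero>\<^bsub>gr\<^esub>" "x \<in># a" for x
    using that gr_coeffs_zero[of h a] co_supp[OF rees_T_closed[OF h], of a] by blast
next
  define D where "D = Max (insert 0 {d. h d \<noteq> \<zero>})"
  have D: "h d = \<zero>" if "d > D" for d
    using that h Max_ge[of "insert 0 {d. h d \<noteq> \<zero>}" d] by (fastforce simp: D_def rees_set_def)
  have "{a. gr_coeffs h a \<noteq> \<zero>\<^bsub>gr\<^esub>} \<subseteq> mons m D"
  proof
    fix a assume a: "a \<in> {a. gr_coeffs h a \<noteq> \<zero>\<^bsub>gr\<^esub>}"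
    hence "set_mset a \<subseteq> {..<m}" using gr_coeffs_zero[of h a] co_supp[OF rees_T_closed[OF h], of a] by blast
    moreover have "size a \<le> D"
    proof (rule ccontr)
      assume "\<not> size a \<le> D"
      hence "strand h a i = \<zero>\<^bsub>R\<^esub>" for i using D[of "i + size a"] by (simp add: co_zero)
      with a gr_coeffs_zero[of h a] show False by blast
    qed
    ultimately show "a \<in> mons m D" by (simp add: mons_def)
  qed
  thus "finite {a. gr_coeffs h a \<noteq> \<zero>\<^bsub>gr\<^esub>}" by (rule finite_subset) simp
qed

text \<open>
  Both sides are sums of the same products of coefficients. The coefficient of \<open>t\<^sup>a\<close> in degree \<open>i + |a|\<close>
  of the product in \<open>T\<close> also contains terms that do not occur in the product of polynomials. They pair a
  coefficient whose degree is too small for its exponent with one whose degree is too large, and lie in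
  \<open>I\<^sup>i\<^sup>+\<^sup>1\<close>.
\<close>

lemma gr_coeffs_mult:
  assumes h: "h \<in> rees_set T KI" and k: "k \<in> rees_set T KI"
  shows "gr_coeffs (h \<otimes>\<^bsub>rees_ring T KI\<^esub> k) = gr_coeffs h \<otimes>\<^bsub>mpoly_ring gr m\<^esub> gr_coeffs k"
proof
  fix a
  interpret X: ring "rees_ring R I" by (rule R.rees_ring[OF I])
  interpret G: ring gr by (rule R.gr_ring_is_ring[OF I])
  have gr_hom: "ring_hom_ring (rees_ring R I) gr (gr_of R I)"
    by (intro ring_hom_ringI2 X.ring_axioms G.ring_axioms R.gr_of_hom[OF I])
  define P where "P b = strand h b \<otimes>\<^bsub>rees_ring R I\<^esub> strand k (a - b)" for b
  have P: "P b \<in> rees_set R I" for b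
    unfolding P_def using X.m_closed[of "strand h b" "strand k (a - b)"] strand_rees[OF h] strand_rees[OF k] by simp
  have P_coeff: "P b i = (\<Oplus>\<^bsub>R\<^esub>l\<in>{..i}. co (h (l + size b)) b \<otimes>\<^bsub>R\<^esub> co (k (i - l + size (a - b))) (a - b))" for b i
    unfolding P_def using R.rees_sel(1)[OF I strand_rees[OF h, of b] strand_rees[OF k, of "a - b"]] by simp
  have hk: "h \<otimes>\<^bsub>rees_ring T KI\<^esub> k \<in> rees_set T KI"
    using ring.ring_simprules(5)[OF T.rees_ring[OF K_ideal[OF I]], of h k] h k by simp
  have co_closed': "co (h x) b \<in> carrier R" "co (k x) b \<in> carrier R" for x b
    using rees_T_closed[OF h] rees_T_closed[OF k] by (auto intro: co_closed)
  have "(gr_coeffs h \<otimes>\<^bsub>mpoly_ring gr m\<^esub> gr_coeffs k) a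
      = (\<Oplus>\<^bsub>gr\<^esub>b\<in>{b. b \<subseteq># a}. gr_of R I (strand h b) \<otimes>\<^bsub>gr\<^esub> gr_of R I (strand k (a - b)))"
    by (simp add: mpoly_ring_def gr_coeffs_def)
  also have "\<dots> = (\<Oplus>\<^bsub>gr\<^esub>b\<in>{b. b \<subseteq># a}. gr_of R I (P b))"
  proof (rule G.finsum_cong')
    fix b
    show "gr_of R I (strand h b) \<otimes>\<^bsub>gr\<^esub> gr_of R I (strand k (a - b)) = gr_of R I (P b)"
      unfolding P_def using strand_rees[OF h] strand_rees[OF k]
      by (intro ring_hom_mult[OF R.gr_of_hom[OF I], symmetric]) simp_all
  qed (use P in \<open>auto simp: R.gr_carrier[OF I]\<close>)
  also have "\<dots> = gr_of R I (finsum (rees_ring R I) P {b. b \<subseteq># a})"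
    using ring_hom_ring.hom_finsum[OF gr_hom, of P "{b. b \<subseteq># a}"] P by (simp add: comp_def)
  also have "\<dots> = gr_of R I (\<lambda>i. \<Oplus>\<^bsub>R\<^esub>b\<in>{b. b \<subseteq># a}. P b i)"
    using P by (simp add: R.rees_finsum[OF I])
  also have "\<dots> = gr_of R I (strand (h \<otimes>\<^bsub>rees_ring T KI\<^esub> k) a)"
  proof
    fix i
    let ?J = "ideal_power R I (Suc i)"
    interpret J: ideal ?J R by (rule R.ideal_power_ideal[OF I])
    define N where "N = i + size a"
    define f where "f b j = co (h j) b \<otimes>\<^bsub>R\<^esub> co (k (N - j)) (a - b)" for b j
    have f: "f b j \<in> carrier R" for b j unfolding f_def using co_closed' by simp
    have "strand (h \<otimes>\<^bsub>rees_ring T KI\<^esub> k) a i = co (\<Oplus>j\<in>{..N}. h j \<otimes> k (N - j)) a"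
      using T.rees_sel(1)[OF K_ideal[OF I] h k] by (simp add: N_def)
    also have "\<dots> = (\<Oplus>\<^bsub>R\<^esub>j\<in>{..N}. co (h j \<otimes> k (N - j)) a)"
      using rees_T_closed[OF h] rees_T_closed[OF k] by (intro co_finsum) auto
    also have "\<dots> = (\<Oplus>\<^bsub>R\<^esub>j\<in>{..N}. \<Oplus>\<^bsub>R\<^esub>b\<in>{b. b \<subseteq># a}. f b j)"
      using rees_T_closed[OF h] rees_T_closed[OF k] f
      by (intro R.finsum_cong') (auto simp: co_mult f_def intro!: R.finsum_closed)
    also have "\<dots> = (\<Oplus>\<^bsub>R\<^esub>b\<in>{b. b \<subseteq># a}. \<Oplus>\<^bsub>R\<^esub>j\<in>{..N}. f b j)"
      using f by (intro R.finsum_swap) auto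
    finally have comp_hk: "strand (h \<otimes>\<^bsub>rees_ring T KI\<^esub> k) a i
        = (\<Oplus>\<^bsub>R\<^esub>b\<in>{b. b \<subseteq># a}. \<Oplus>\<^bsub>R\<^esub>j\<in>{..N}. f b j)" .
    have "P b i \<ominus>\<^bsub>R\<^esub> (\<Oplus>\<^bsub>R\<^esub>j\<in>{..N}. f b j) \<in> ?J" if b: "b \<in> {b. b \<subseteq># a}" for b
    proof -
      have sz: "size (a - b) = size a - size b" "size b \<le> size a"
        using b size_mset_mono by (auto simp: size_Diff_submset)
      \<comment> \<open>The indices \<open>j\<close> in \<open>?M\<close> are those for which both factors have the degree that belongs to them.\<close>
      let ?M = "(\<lambda>l. l + size b) ` {..i}"
      have M: "?M \<subseteq> {..N}" using sz by (auto simp: N_def)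
      have "P b i = (\<Oplus>\<^bsub>R\<^esub>l\<in>{..i}. f b (l + size b))"
        unfolding P_coeff
      proof (rule R.finsum_cong')
        fix l assume "l \<in> {..i}"
        hence "i - l + size (a - b) = N - (l + size b)" using sz by (simp add: N_def)
        thus "co (h (l + size b)) b \<otimes>\<^bsub>R\<^esub> co (k (i - l + size (a - b))) (a - b) = f b (l + size b)"
          by (simp add: f_def)
      qed (use f in auto)
      also have "\<dots> = finsum R (f b) ?M"
        by (rule R.finsum_reindex[symmetric]) (use f in \<open>auto simp: inj_on_def\<close>)
      finally have Pb: "P b i = finsum R (f b) ?M" .
      have "finsum R (f b) {..N} = finsum R (f b) (?M \<union> ({..N} - ?M))"
        using M by (simp add: Un_absorb1)
      also have "\<dots> = finsum R (f b) ?M \<oplus>\<^bsub>R\<^esub> finsum R (f b) ({..N} - ?M)"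
        by (rule R.finsum_Un_disjoint) (use f in auto)
      finally have split: "finsum R (f b) {..N} = P b i \<oplus>\<^bsub>R\<^esub> finsum R (f b) ({..N} - ?M)"
        by (simp add: Pb)
      have rest: "finsum R (f b) ({..N} - ?M) \<in> ?J"
      proof (rule J.finsum_in_ideal)
        fix j assume j: "j \<in> {..N} - ?M"
        have ch: "co (h j) b \<in> ideal_power R I (j - size b)"
          by (rule co_power[OF I T.rees_setD(1)[OF K_ideal[OF I] h]])
        have ck: "co (k (N - j)) (a - b) \<in> ideal_power R I (N - j - size (a - b))"
          by (rule co_power[OF I T.rees_setD(1)[OF K_ideal[OF I] k]])
        have "j < size b \<or> i + size b < j"
        proof (rule ccontr)
          assume "\<not> (j < size b \<or> i + size b < j)"
          hence "j = (j - size b) + size b" "j - size b \<in> {..i}" by auto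
          with j show False by blast
        qed
        hence "Suc i \<le> (j - size b) + (N - j - size (a - b))"
          using sz j by (auto simp: N_def)
        thus "f b j \<in> ?J"
          unfolding f_def by (rule R.ideal_power_mono[OF I _ R.ideal_power_mult[OF I ch ck]])
      qed
      have Pc: "P b i \<in> carrier R" by (rule R.rees_setD(2)[OF I P])
      have "P b i \<ominus>\<^bsub>R\<^esub> finsum R (f b) {..N} = \<ominus>\<^bsub>R\<^esub> finsum R (f b) ({..N} - ?M)"
        unfolding split using Pc J.Icarr[OF rest] by (simp add: R.minus_eq R.minus_add R.r_neg2 R.a_assoc[symmetric] R.r_neg)
      thus ?thesis using rest by (simp add: J.a_inv_closed)
    qed
    hence "(\<Oplus>\<^bsub>R\<^esub>b\<in>{b. b \<subseteq># a}. P b i) \<ominus>\<^bsub>R\<^esub> strand (h \<otimes>\<^bsub>rees_ring T KI\<^esub> k) a i \<in> ?J"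
      unfolding comp_hk using f R.rees_setD(2)[OF I P]
      by (intro J.finsum_diff_in_ideal) (auto intro!: R.finsum_closed)
    thus "gr_of R I (\<lambda>i. \<Oplus>\<^bsub>R\<^esub>b\<in>{b. b \<subseteq># a}. P b i) i = gr_of R I (strand (h \<otimes>\<^bsub>rees_ring T KI\<^esub> k) a) i"
      unfolding gr_of_def using R.rees_setD(2)[OF I P] R.rees_setD(2)[OF I strand_rees[OF hk]]
      by (subst J.rcos_eq_iff) (auto intro!: R.finsum_closed)
  qed
  finally show "gr_coeffs (h \<otimes>\<^bsub>rees_ring T KI\<^esub> k) a = (gr_coeffs h \<otimes>\<^bsub>mpoly_ring gr m\<^esub> gr_coeffs k) a"
    by (simp add: gr_coeffs_def)
qed

lemma gr_coeffs_const:
  assumes r: "r \<in> carrier T"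
  shows "gr_coeffs (\<lambda>i. if i = 0 then r else \<zero>)
    = (\<lambda>a. if a = {#} then gr_of R I (\<lambda>i. if i = 0 then co r {#} else \<zero>\<^bsub>R\<^esub>) else \<zero>\<^bsub>gr\<^esub>)"
proof
  fix a
  show "gr_coeffs (\<lambda>i. if i = 0 then r else \<zero>) a
    = (if a = {#} then gr_of R I (\<lambda>i. if i = 0 then co r {#} else \<zero>\<^bsub>R\<^esub>) else \<zero>\<^bsub>gr\<^esub>)"
  proof (cases "a = {#}")
    case True
    have "(\<lambda>i. co (if i = 0 then r else \<zero>) {#}) = (\<lambda>i. if i = 0 then co r {#} else \<zero>\<^bsub>R\<^esub>)"
      by (auto simp: co_zero)
    from arg_cong[OF this, of "gr_of R I"] True show ?thesis by (simp add: gr_coeffs_def)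
  next
    case False
    thus ?thesis by (intro trans[OF gr_coeffs_zero]) (auto simp: co_zero)
  qed
qed

lemma gr_coeffs_hom: "gr_coeffs \<in> ring_hom (rees_ring T KI) (mpoly_ring gr m)"
proof (rule ring_hom_memI, goal_cases)
  case (1 h)
  thus ?case by (simp add: gr_coeffs_closed)
next
  case (2 h k)
  thus ?case by (intro gr_coeffs_mult) simp_all
next
  case (3 h k)
  hence hk: "h \<in> rees_set T KI" "k \<in> rees_set T KI" by simp_all
  have "gr_coeffs (h \<oplus>\<^bsub>rees_ring T KI\<^esub> k) a = gr_coeffs h a \<oplus>\<^bsub>gr\<^esub> gr_coeffs k a" for a
  proof -
    have "strand (h \<oplus>\<^bsub>rees_ring T KI\<^esub> k) a = strand h a \<oplus>\<^bsub>rees_ring R I\<^esub> strand k a"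
      using T.rees_sel(2)[OF K_ideal[OF I] hk] R.rees_sel(2)[OF I strand_rees[OF hk(1)] strand_rees[OF hk(2)]]
        rees_T_closed[OF hk(1)] rees_T_closed[OF hk(2)] by (simp add: co_add)
    thus ?thesis unfolding gr_coeffs_def
      using ring_hom_add[OF R.gr_of_hom[OF I]] strand_rees[OF hk(1)] strand_rees[OF hk(2)] by simp
  qed
  thus ?case
    by (simp add: mpoly_ring_def ring.indexed_padd_def[OF R.gr_ring_is_ring[OF I]] fun_eq_iff)
next
  case 4
  have "\<one>\<^bsub>rees_ring T KI\<^esub> = (\<lambda>i. if i = 0 then \<one> else \<zero>)"
    by (simp add: T.rees_sel(3)[OF K_ideal[OF I]])
  moreover have "gr_of R I (\<lambda>i. if i = 0 then \<one>\<^bsub>R\<^esub> else \<zero>\<^bsub>R\<^esub>) = \<one>\<^bsub>gr\<^esub>"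
    using ring_hom_one[OF R.gr_of_hom[OF I]] by (simp add: R.rees_sel(3)[OF I])
  ultimately show ?case
    using gr_coeffs_const[OF T.one_closed]
    by (simp add: mpoly_ring_def ring.indexed_const_def[OF R.gr_ring_is_ring[OF I]] co_one cong: if_cong)
qed

text \<open>
  The preimage is the sum of the terms \<open>c t\<^sup>a\<close>, where \<open>c\<close> represents a homogeneous component of the
  coefficient of \<open>t\<^sup>a\<close>, collected by total degree.
\<close>

lemma gr_coeffs_surj:
  assumes p: "p \<in> carrier (mpoly_ring gr m)"
  obtains h where "h \<in> rees_set T KI" "gr_coeffs h = p"
proof -
  from p have p1: "\<And>a. p a \<in> gr_of R I ` rees_set R I" and p2: "finite {a. p a \<noteq> \<zero>\<^bsub>gr\<^esub>}"
    and p3: "\<And>a. p a \<noteq> \<zero>\<^bsub>gr\<^esub> \<Longrightarrow> set_mset a \<subseteq> {..<m}"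
    unfolding ring.mpoly_carrier[OF R.gr_ring_is_ring[OF I]] R.gr_carrier[OF I] by auto
  \<comment> \<open>Zero coefficients get the representative zero, which keeps the preimage finite.\<close>
  have "\<exists>c\<in>rees_set R I. p a = gr_of R I c \<and> (p a = \<zero>\<^bsub>gr\<^esub> \<longrightarrow> c = (\<lambda>i. \<zero>\<^bsub>R\<^esub>))" for a
  proof (cases "p a = \<zero>\<^bsub>gr\<^esub>")
    case True
    have "(\<lambda>i. \<zero>\<^bsub>R\<^esub>) \<in> rees_set R I" using R.ideal_power_zero[OF I] by (simp add: rees_set_def)
    thus ?thesis using True R.gr_zero[OF I] by (intro bexI[of _ "\<lambda>i. \<zero>\<^bsub>R\<^esub>"]) auto
  next
    case False
    with p1[of a] show ?thesis by auto
  qed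
  then obtain c where c: "\<And>a. c a \<in> rees_set R I" "\<And>a. p a = gr_of R I (c a)"
    "\<And>a. p a = \<zero>\<^bsub>gr\<^esub> \<Longrightarrow> c a = (\<lambda>i. \<zero>\<^bsub>R\<^esub>)" by metis
  have cR: "c a i \<in> carrier R" for a i by (rule R.rees_setD(2)[OF I c(1)])
  define h where "h d = (\<Oplus>a\<in>mons m d. \<iota> (c a (d - size a)) \<otimes> mpow T t a)" for d
  have hK: "h d \<in> ideal_power T KI d" for d
    unfolding h_def
  proof (rule ideal.finsum_in_ideal[OF T.ideal_power_ideal[OF K_ideal[OF I]]], rule term_power[OF I])
    show "c a (d - size a) \<in> ideal_power R I (d - size a)" for a by (rule R.rees_setD(1)[OF I c(1)])
  qed (simp add: mons_def)
  have "{d. h d \<noteq> \<zero>} \<subseteq> (\<Union>a\<in>{a. p a \<noteq> \<zero>\<^bsub>gr\<^esub>}. (\<lambda>i. i + size a) ` {i. c a i \<noteq> \<zero>\<^bsub>R\<^esub>})"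
  proof (rule subsetI, rule ccontr)
    fix d assume d: "d \<in> {d. h d \<noteq> \<zero>}"
      and nd: "d \<notin> (\<Union>a\<in>{a. p a \<noteq> \<zero>\<^bsub>gr\<^esub>}. (\<lambda>i. i + size a) ` {i. c a i \<noteq> \<zero>\<^bsub>R\<^esub>})"
    have "\<iota> (c a (d - size a)) \<otimes> mpow T t a = \<zero>" if a: "a \<in> mons m d" for a
    proof -
      have "c a (d - size a) = \<zero>\<^bsub>R\<^esub>"
      proof (rule ccontr)
        assume nz: "c a (d - size a) \<noteq> \<zero>\<^bsub>R\<^esub>"
        hence "p a \<noteq> \<zero>\<^bsub>gr\<^esub>" using c(3)[of a] by auto
        moreover have "d = (d - size a) + size a" using a by (simp add: mons_def)
        ultimately show False using nz nd by blast
      qed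
      moreover have "mpow T t a \<in> carrier T" using a by (intro tpow_closed) (simp add: mons_def)
      ultimately show ?thesis by simp
    qed
    hence "h d = (\<Oplus>a\<in>mons m d. \<zero>)" unfolding h_def by (intro T.finsum_cong') auto
    with d show False by simp
  qed
  hence "finite {d. h d \<noteq> \<zero>}"
    by (rule finite_subset) (use p2 c(1) in \<open>auto simp: rees_set_def\<close>)
  hence h: "h \<in> rees_set T KI" using hK by (simp add: rees_set_def)
  have "strand h a i = c a i" for a i
  proof (cases "set_mset a \<subseteq> {..<m}")
    case True
    let ?d = "i + size a"
    have "strand h a i = (\<Oplus>\<^bsub>R\<^esub>b\<in>mons m ?d. co (\<iota> (c b (?d - size b)) \<otimes> mpow T t b) a)"
      unfolding h_def by (rule co_finsum) (auto intro: term_closed cR)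
    also have "\<dots> = (\<Oplus>\<^bsub>R\<^esub>b\<in>mons m ?d. if a = b then c b (?d - size b) else \<zero>\<^bsub>R\<^esub>)"
      by (rule R.finsum_cong') (auto simp: co_term cR mons_def)
    also have "\<dots> = c a (?d - size a)"
      using True cR by (intro R.finsum_singleton finite_mons) (auto simp: mons_def)
    finally show ?thesis by simp
  next
    case False
    hence "p a = \<zero>\<^bsub>gr\<^esub>" using p3 by blast
    thus ?thesis using False c(3)[of a] co_supp[OF rees_T_closed[OF h]] by simp
  qed
  hence "gr_coeffs h = p" using c(2) by (auto simp: gr_coeffs_def fun_eq_iff)
  thus thesis using h that by blast
qed

lemma gr_coeffs_eq_iff:
  assumes h: "h \<in> rees_set T KI" and k: "k \<in> rees_set T KI"
  shows "gr_coeffs h = gr_coeffs k \<longleftrightarrow> (\<forall>d. h d \<ominus> k d \<in> ideal_power T KI (Suc d))"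
proof -
  have hk: "h d \<ominus> k d \<in> ideal_power T KI d" for d
    by (rule ideal.minus_closed_ideal[OF T.ideal_power_ideal[OF K_ideal[OF I]]
          T.rees_setD(1)[OF K_ideal[OF I] h] T.rees_setD(1)[OF K_ideal[OF I] k]])
  have "gr_coeffs h = gr_coeffs k \<longleftrightarrow>
      (\<forall>a i. co (h (i + size a)) a \<ominus>\<^bsub>R\<^esub> co (k (i + size a)) a \<in> ideal_power R I (Suc i))"
    unfolding gr_coeffs_def fun_eq_iff[of "\<lambda>a. gr_of R I (strand h a)"]
    by (simp add: R.gr_of_eq_iff[OF I strand_rees[OF h] strand_rees[OF k]])
  also have "\<dots> \<longleftrightarrow> (\<forall>d a i. i + size a = d \<longrightarrow> co (h d \<ominus> k d) a \<in> ideal_power R I (Suc i))"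
    using rees_T_closed[OF h] rees_T_closed[OF k] by (auto simp: co_minus)
  also have "\<dots> \<longleftrightarrow> (\<forall>d. h d \<ominus> k d \<in> ideal_power T KI (Suc d))"
    by (simp add: power_Suc_iff[OF I hk])
  finally show ?thesis .
qed

end

end

lemma ring_iso_of_equal_fibres:
  assumes f: "f \<in> ring_hom Q B" and g: "g \<in> ring_hom Q C" and Q: "ring Q"
    and f_surj: "f ` carrier Q = carrier B" and g_surj: "g ` carrier Q = carrier C"
    and fibres: "\<And>x y. x \<in> carrier Q \<Longrightarrow> y \<in> carrier Q \<Longrightarrow> f x = f y \<longleftrightarrow> g x = g y"
  obtains \<Phi> where "\<Phi> \<in> ring_iso B C" "\<And>x. x \<in> carrier Q \<Longrightarrow> \<Phi> (f x) = g x"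
proof -
  interpret Q: ring Q by (rule Q)
  define \<Phi> where "\<Phi> b = g (inv_into (carrier Q) f b)" for b
  have eq: "\<Phi> (f x) = g x" if x: "x \<in> carrier Q" for x
  proof -
    have "f x \<in> f ` carrier Q" using x by blast
    hence "inv_into (carrier Q) f (f x) \<in> carrier Q" "f (inv_into (carrier Q) f (f x)) = f x"
      by (auto intro: inv_into_into f_inv_into_f)
    thus ?thesis using fibres x by (simp add: \<Phi>_def)
  qed
  have "\<Phi> \<in> ring_iso B C"
  proof (rule ring_iso_memI)
    have surj: "\<exists>x\<in>carrier Q. b = f x" if "b \<in> carrier B" for b using that f_surj by blast
    show "\<Phi> b \<in> carrier C" if "b \<in> carrier B" for b
      using surj[OF that] eq g_surj by auto
    show "\<Phi> (b \<otimes>\<^bsub>B\<^esub> b') = \<Phi> b \<otimes>\<^bsub>C\<^esub> \<Phi> b'" if "b \<in> carrier B" "b' \<in> carrier B" for b b'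
      using surj[OF that(1)] surj[OF that(2)] eq ring_hom_mult[OF f] ring_hom_mult[OF g]
      by (metis Q.m_closed)
    show "\<Phi> (b \<oplus>\<^bsub>B\<^esub> b') = \<Phi> b \<oplus>\<^bsub>C\<^esub> \<Phi> b'" if "b \<in> carrier B" "b' \<in> carrier B" for b b'
      using surj[OF that(1)] surj[OF that(2)] eq ring_hom_add[OF f] ring_hom_add[OF g]
      by (metis Q.a_closed)
    show "\<Phi> \<one>\<^bsub>B\<^esub> = \<one>\<^bsub>C\<^esub>"
      using eq[OF Q.one_closed] ring_hom_one[OF f] ring_hom_one[OF g] by simp
    show "bij_betw \<Phi> (carrier B) (carrier C)"
      unfolding bij_betw_def inj_on_def
    proof (intro conjI ballI impI)
      show "b = b'" if "b \<in> carrier B" "b' \<in> carrier B" "\<Phi> b = \<Phi> b'" for b b'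
        using surj[OF that(1)] surj[OF that(2)] that(3) eq fibres by auto
      show "\<Phi> ` carrier B = carrier C"
        using f_surj[symmetric] g_surj[symmetric] eq by (auto simp: image_image)
    qed
  qed
  thus thesis using eq that by blast
qed

section \<open>Formal power series\<close>

definition ps_mult :: "(nat multiset \<Rightarrow> 'k::field) \<Rightarrow> (nat multiset \<Rightarrow> 'k) \<Rightarrow> nat multiset \<Rightarrow> 'k"
  where "ps_mult f g = (\<lambda>a. \<Sum>b | b \<subseteq># a. f b * g (a - b))"

definition ps_var :: "nat \<Rightarrow> nat multiset \<Rightarrow> 'k::field"
  where "ps_var i = (\<lambda>a. if a = {#i#} then 1 else 0)"

lemma submultiset_diff_diff: "b \<subseteq># a \<Longrightarrow> a - (a - b) = b"
  by (metis add_diff_cancel_right' subset_mset.add_diff_inverse)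

lemma ps_mult_comm: "ps_mult f g = ps_mult g f"
proof
  fix a show "ps_mult f g a = ps_mult g f a"
    unfolding ps_mult_def
    by (rule sum.reindex_bij_witness[of _ "\<lambda>b. a - b" "\<lambda>b. a - b"])
       (auto simp: mult.commute submultiset_diff_diff)
qed

lemma submultiset_diff_mono: "c \<subseteq># b \<Longrightarrow> b \<subseteq># a \<Longrightarrow> b - c \<subseteq># a - c"
  by (simp add: subseteq_mset_def diff_le_mono)

lemma submultiset_diff_cancel: "c \<subseteq># b \<Longrightarrow> b \<subseteq># a \<Longrightarrow> a - c - (b - c) = a - b"
  by (simp add: subseteq_mset_def multiset_eq_iff)

lemma submultiset_plusI: "c \<subseteq># a \<Longrightarrow> d \<subseteq># a - c \<Longrightarrow> c + d \<subseteq># a"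
  by (simp add: subset_mset.le_diff_conv2 add.commute)

lemma ps_mult_assoc: "ps_mult (ps_mult f g) h = ps_mult f (ps_mult g h)"
proof
  fix a
  have "ps_mult (ps_mult f g) h a =
      (\<Sum>(b, c)\<in>(SIGMA b:{b. b \<subseteq># a}. {c. c \<subseteq># b}). f c * g (b - c) * h (a - b))"
    by (simp add: ps_mult_def sum_distrib_right sum.Sigma)
  also have "\<dots> = (\<Sum>(c, d)\<in>(SIGMA c:{c. c \<subseteq># a}. {d. d \<subseteq># a - c}). f c * (g d * h (a - c - d)))"
    by (rule sum.reindex_bij_witness[of _ "\<lambda>(c, d). (c + d, c)" "\<lambda>(b, c). (c, b - c)"])
       (auto simp: mult.assoc submultiset_diff_cancel
          intro: submultiset_diff_mono submultiset_plusI elim: subset_mset.order_trans)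
  also have "\<dots> = ps_mult f (ps_mult g h) a"
    by (simp add: ps_mult_def sum_distrib_left sum.Sigma)
  finally show "ps_mult (ps_mult f g) h a = ps_mult f (ps_mult g h) a" .
qed

lemma ps_mult_const: "ps_mult (ps_const c) f = (\<lambda>a. c * f a)"
proof
  fix a
  have "ps_mult (ps_const c) f a = (\<Sum>b\<in>{{#}}. ps_const c b * f (a - b))"
    unfolding ps_mult_def by (rule sum.mono_neutral_right) (auto simp: ps_const_def)
  thus "ps_mult (ps_const c) f a = c * f a" by (simp add: ps_const_def)
qed

lemma ps_mult_var: "ps_mult (ps_var i) f = (\<lambda>a. if i \<in># a then f (a - {#i#}) else 0)"
proof
  fix a
  have "ps_mult (ps_var i) f a = (\<Sum>b\<in>(if i \<in># a then {{#i#}} else {}). ps_var i b * f (a - b))"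
    unfolding ps_mult_def
    by (rule sum.mono_neutral_right) (auto simp: ps_var_def split: if_splits)
  thus "ps_mult (ps_var i) f a = (if i \<in># a then f (a - {#i#}) else 0)" by (simp add: ps_var_def)
qed

lemma ps_mult_add_left: "ps_mult (\<lambda>a. f a + g a) h = (\<lambda>a. ps_mult f h a + ps_mult g h a)"
  by (auto simp: ps_mult_def sum.distrib distrib_right)

lemma formal_ps_ring_sel:
  "carrier (formal_ps_ring n) = {f. \<forall>a. \<not> set_mset a \<subseteq> {..<n} \<longrightarrow> f a = 0}"
  "f \<otimes>\<^bsub>formal_ps_ring n\<^esub> g = ps_mult f g"
  "\<one>\<^bsub>formal_ps_ring n\<^esub> = ps_const 1"
  "\<zero>\<^bsub>formal_ps_ring n\<^esub> = (\<lambda>a. 0)"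
  "f \<oplus>\<^bsub>formal_ps_ring n\<^esub> g = (\<lambda>a. f a + g a)"
  by (simp_all add: formal_ps_ring_def ps_mult_def ps_const_def)

text \<open>
  The ring laws hold for arbitrary coefficient functions, without a bound on the indeterminates. The rings
  of convergent power series are subrings of this one.
\<close>

definition ps_all :: "(nat multiset \<Rightarrow> 'k::field) ring"
  where "ps_all = formal_ps_ring 0 \<lparr>carrier := UNIV\<rparr>"

lemma ps_all_sel:
  "carrier ps_all = UNIV"
  "f \<otimes>\<^bsub>ps_all\<^esub> g = ps_mult f g"
  "\<one>\<^bsub>ps_all\<^esub> = ps_const 1"
  "\<zero>\<^bsub>ps_all\<^esub> = (\<lambda>a. 0)"
  "f \<oplus>\<^bsub>ps_all\<^esub> g = (\<lambda>a. f a + g a)"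
  by (simp_all add: ps_all_def formal_ps_ring_def ps_mult_def ps_const_def)

lemma ps_all_cring: "cring (ps_all :: (nat multiset \<Rightarrow> 'k::field) ring)"
proof (rule cringI)
  show "abelian_group (ps_all :: (nat multiset \<Rightarrow> 'k) ring)"
  proof (rule abelian_groupI)
    fix x :: "nat multiset \<Rightarrow> 'k"
    show "\<exists>y\<in>carrier ps_all. y \<oplus>\<^bsub>ps_all\<^esub> x = \<zero>\<^bsub>ps_all\<^esub>"
      by (rule bexI[of _ "\<lambda>a. - x a"]) (simp_all add: ps_all_sel)
  qed (simp_all add: ps_all_sel add_ac)
  show "comm_monoid (ps_all :: (nat multiset \<Rightarrow> 'k) ring)"
    by (rule comm_monoidI)
       (simp_all add: ps_all_sel ps_mult_assoc ps_mult_const, rule ps_mult_comm)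
qed (simp add: ps_all_sel ps_mult_add_left)

section \<open>Weights of monomials\<close>

definition var_prime :: "nat \<Rightarrow> nat"
  where "var_prime = enumerate {p. Factorial_Ring.prime p}"

text \<open>
  Unique factorization makes the weight an injective homomorphism from the monomials to the positive
  integers. Comparing weights is therefore a total order of the monomials, compatible with multiplication,
  in which every monomial has finitely many predecessors.
\<close>

definition wt :: "nat multiset \<Rightarrow> nat"
  where "wt a = prod_mset (image_mset var_prime a)"

lemma prime_var_prime: "Factorial_Ring.prime (var_prime i)"
  using enumerate_in_set[OF primes_infinite] by (simp add: var_prime_def)

lemma inj_var_prime: "inj var_prime"
  unfolding var_prime_def
  using strict_mono_enumerate[OF primes_infinite] strict_mono_imp_inj_on by blast

lemma wt_empty [simp]: "wt {#} = 1" and wt_plus: "wt (a + b) = wt a * wt b"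
  and wt_add_mset: "wt (add_mset i a) = var_prime i * wt a"
  by (simp_all add: wt_def)

lemma wt_pos [simp]: "wt a > 0"
  by (induction a) (simp_all add: wt_add_mset prime_gt_0_nat[OF prime_var_prime])

lemma inj_wt: "inj wt"
proof (rule injI)
  fix a b assume "wt a = wt b"
  moreover have "prime_factorization (wt c) = image_mset var_prime c" for c
    unfolding wt_def by (rule prime_factorization_prod_mset_primes) (auto simp: prime_var_prime)
  ultimately have "image_mset var_prime a = image_mset var_prime b" by metis
  hence "image_mset (inv_into UNIV var_prime) (image_mset var_prime a) =
      image_mset (inv_into UNIV var_prime) (image_mset var_prime b)" by simp
  thus "a = b" using inj_var_prime by (simp add: multiset.map_comp comp_def inv_into_f_f)
qed

lemma wt_eq_iff [simp]: "wt a = wt b \<longleftrightarrow> a = b"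
  using inj_wt by (auto dest: injD)

lemma size_le_wt: "size a < wt a"
proof (induction a)
  case (add i a)
  have "2 * wt a \<le> wt (add_mset i a)"
    using prime_ge_2_nat[OF prime_var_prime[of i]] by (simp add: wt_add_mset)
  thus ?case using add by simp
qed simp

lemma finite_wt_le [simp]: "finite {a. wt a \<le> M}" and finite_wt_less [simp]: "finite {a. wt a < M}"
  using finite_vimageI[OF _ inj_wt, of "{..M}"] finite_vimageI[OF _ inj_wt, of "{..<M}"]
  by (simp_all add: vimage_def)

section \<open>Norms and convergence\<close>

locale abs_value =
  fixes v :: "'k::field \<Rightarrow> real"
  assumes v_nonneg [simp]: "0 \<le> v x"
    and v_eq_0 [simp]: "v x = 0 \<longleftrightarrow> x = 0"
    and v_mult: "v (x * y) = v x * v y"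
    and v_add: "v (x + y) \<le> v x + v y"
begin

lemma v_1 [simp]: "v 1 = 1"
proof -
  have "v 1 * v 1 = v 1 * 1" using v_mult[of 1 1] by simp
  thus ?thesis using v_eq_0[of 1] by (metis mult_left_cancel zero_neq_one)
qed

lemma v_0 [simp]: "v 0 = 0"
  by simp

lemma v_minus [simp]: "v (- x) = v x"
proof -
  have "v (-1) * v (-1) = 1" using v_mult[of "-1" "-1"] by simp
  hence "v (-1) = 1" using v_nonneg[of "-1"]
    by (metis abs_of_nonneg abs_square_eq_1 power2_eq_square)
  thus ?thesis using v_mult[of "-1" x] by simp
qed

lemma v_sum: "v (sum f A) \<le> (\<Sum>i\<in>A. v (f i))"
proof (induction A rule: infinite_finite_induct)
  case (insert x F)
  thus ?case using v_add[of "f x" "sum f F"] by simp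
qed auto

text \<open>
  \<open>C\<close> bounds the norm \<open>\<Sum>\<^sub>a |f\<^sub>a| / wt(a)\<^sup>t\<close>, that is, the norm at the polyradius
  \<open>(p\<^sub>1\<^bsup>-t\<^esup>, p\<^sub>2\<^bsup>-t\<^esup>, \<dots>)\<close>. Bounding finite partial sums avoids the question whether the norm is finite.
\<close>

definition dnorm_le :: "nat \<Rightarrow> (nat multiset \<Rightarrow> 'k) \<Rightarrow> real \<Rightarrow> bool"
  where "dnorm_le t f C \<longleftrightarrow> (\<forall>F. finite F \<longrightarrow> (\<Sum>a\<in>F. v (f a) / real (wt a) ^ t) \<le> C)"

lemma dnorm_leD: "dnorm_le t f C \<Longrightarrow> finite F \<Longrightarrow> (\<Sum>a\<in>F. v (f a) / real (wt a) ^ t) \<le> C"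
  by (simp add: dnorm_le_def)

lemma dnorm_le_nonneg: "dnorm_le t f C \<Longrightarrow> 0 \<le> C"
  using dnorm_leD[of t f C "{}"] by simp

lemma dnorm_le_mono: "dnorm_le t f C \<Longrightarrow> C \<le> D \<Longrightarrow> dnorm_le t f D"
  by (force simp: dnorm_le_def)

lemma dnorm_le_dom:
  assumes "dnorm_le t g C" "\<And>a. v (f a) \<le> v (g a)"
  shows "dnorm_le t f C"
  unfolding dnorm_le_def
proof safe
  fix F :: "nat multiset set" assume "finite F"
  have "(\<Sum>a\<in>F. v (f a) / real (wt a) ^ t) \<le> (\<Sum>a\<in>F. v (g a) / real (wt a) ^ t)"
    by (intro sum_mono divide_right_mono assms) simp_all
  thus "(\<Sum>a\<in>F. v (f a) / real (wt a) ^ t) \<le> C" using dnorm_leD[OF assms(1) \<open>finite F\<close>] by simp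
qed

lemma dnorm_le_add:
  assumes "dnorm_le t f C" "dnorm_le t g D"
  shows "dnorm_le t (\<lambda>a. f a + g a) (C + D)"
  unfolding dnorm_le_def
proof safe
  fix F :: "nat multiset set" assume F: "finite F"
  have "(\<Sum>a\<in>F. v (f a + g a) / real (wt a) ^ t)
      \<le> (\<Sum>a\<in>F. v (f a) / real (wt a) ^ t + v (g a) / real (wt a) ^ t)"
    by (intro sum_mono) (simp add: add_divide_distrib[symmetric] divide_right_mono v_add)
  thus "(\<Sum>a\<in>F. v (f a + g a) / real (wt a) ^ t) \<le> C + D"
    using dnorm_leD[OF assms(1) F] dnorm_leD[OF assms(2) F] by (simp add: sum.distrib)
qed

lemma dnorm_le_mult:
  assumes f: "dnorm_le t f C" and g: "dnorm_le t g D"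
  shows "dnorm_le t (ps_mult f g) (C * D)"
  unfolding dnorm_le_def
proof safe
  fix F :: "nat multiset set" assume F: "finite F"
  define G where "G = (\<Union>a\<in>F. {b. b \<subseteq># a})"
  have finG: "finite G" using F by (simp add: G_def)
  define nf where "nf a = v (f a) / real (wt a) ^ t" for a
  define ng where "ng a = v (g a) / real (wt a) ^ t" for a
  have "v (ps_mult f g a) / real (wt a) ^ t \<le> (\<Sum>b | b \<subseteq># a. nf b * ng (a - b))" for a
  proof -
    have "v (ps_mult f g a) / real (wt a) ^ t \<le> (\<Sum>b | b \<subseteq># a. v (f b * g (a - b))) / real (wt a) ^ t"
      unfolding ps_mult_def by (intro divide_right_mono v_sum) simp
    also have "\<dots> = (\<Sum>b | b \<subseteq># a. nf b * ng (a - b))"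
      unfolding sum_divide_distrib
    proof (rule sum.cong)
      fix b assume "b \<in> {b. b \<subseteq># a}"
      hence "wt a = wt b * wt (a - b)" by (simp flip: wt_plus)
      thus "v (f b * g (a - b)) / real (wt a) ^ t = nf b * ng (a - b)"
        by (simp add: nf_def ng_def v_mult power_mult_distrib)
    qed simp
    finally show ?thesis .
  qed
  hence "(\<Sum>a\<in>F. v (ps_mult f g a) / real (wt a) ^ t) \<le> (\<Sum>a\<in>F. \<Sum>b | b \<subseteq># a. nf b * ng (a - b))"
    by (rule sum_mono)
  also have "\<dots> = (\<Sum>(a, b)\<in>(SIGMA a:F. {b. b \<subseteq># a}). nf b * ng (a - b))"
    using F by (simp add: sum.Sigma)
  also have "\<dots> = (\<Sum>(b, c)\<in>(\<lambda>(a, b). (b, a - b)) ` (SIGMA a:F. {b. b \<subseteq># a}). nf b * ng c)"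
    by (subst sum.reindex) (auto simp: inj_on_def case_prod_unfold, metis subset_mset.add_diff_inverse)
  also have "\<dots> \<le> (\<Sum>(b, c)\<in>G \<times> G. nf b * ng c)"
    by (rule sum_mono2) (use finG in \<open>auto simp: G_def nf_def ng_def\<close>)
  also have "\<dots> = (\<Sum>b\<in>G. nf b) * (\<Sum>c\<in>G. ng c)"
    by (simp add: sum_product sum.cartesian_product)
  also have "\<dots> \<le> C * D"
    using dnorm_leD[OF f finG] dnorm_leD[OF g finG] dnorm_le_nonneg[OF f]
    by (intro mult_mono sum_nonneg) (auto simp: nf_def ng_def)
  finally show "(\<Sum>a\<in>F. v (ps_mult f g a) / real (wt a) ^ t) \<le> C * D" .
qed

lemma dnorm_le_finite_support:
  assumes "finite A" "\<And>a. a \<notin> A \<Longrightarrow> f a = 0"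
  shows "dnorm_le t f (\<Sum>a\<in>A. v (f a) / real (wt a) ^ t)"
  unfolding dnorm_le_def
proof safe
  fix F :: "nat multiset set" assume "finite F"
  hence "(\<Sum>a\<in>F. v (f a) / real (wt a) ^ t) = (\<Sum>a\<in>F \<inter> A. v (f a) / real (wt a) ^ t)"
    by (intro sum.mono_neutral_right) (auto simp: assms(2))
  also have "\<dots> \<le> (\<Sum>a\<in>A. v (f a) / real (wt a) ^ t)"
    by (rule sum_mono2) (auto simp: assms)
  finally show "(\<Sum>a\<in>F. v (f a) / real (wt a) ^ t) \<le> \<dots>" .
qed

lemma dnorm_le_one: "dnorm_le t (ps_const 1) 1"
  using dnorm_le_finite_support[of "{{#}}" "ps_const 1" t] by (simp add: ps_const_def)

lemma dnorm_le_shift: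
  assumes h: "dnorm_le t h C"
  shows "dnorm_le t (\<lambda>a. h (a + c)) (C * real (wt c) ^ t)"
  unfolding dnorm_le_def
proof safe
  fix F :: "nat multiset set" assume F: "finite F"
  have "(\<Sum>b\<in>F. v (h (b + c)) / real (wt b) ^ t)
      = (\<Sum>b\<in>F. v (h (b + c)) / real (wt (b + c)) ^ t * real (wt c) ^ t)"
    by (intro sum.cong) (simp_all add: wt_plus power_mult_distrib)
  also have "\<dots> = (\<Sum>a\<in>(\<lambda>b. b + c) ` F. v (h a) / real (wt a) ^ t) * real (wt c) ^ t"
    by (subst sum.reindex) (auto simp: sum_distrib_right)
  also have "\<dots> \<le> C * real (wt c) ^ t"
    by (intro mult_right_mono dnorm_leD[OF h]) (use F in auto)
  finally show "(\<Sum>b\<in>F. v (h (b + c)) / real (wt b) ^ t) \<le> C * real (wt c) ^ t" .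
qed

lemma dnorm_le_raise:
  assumes f: "dnorm_le t f C" and w: "\<And>a. f a \<noteq> 0 \<Longrightarrow> w < wt a"
  shows "dnorm_le (t + u) f (C / real (Suc w) ^ u)"
  unfolding dnorm_le_def
proof safe
  fix F :: "nat multiset set" assume F: "finite F"
  have "v (f a) / real (wt a) ^ (t + u) \<le> v (f a) / real (wt a) ^ t / real (Suc w) ^ u" for a
  proof (cases "f a = 0")
    case False
    hence "real (Suc w) ^ u \<le> real (wt a) ^ u"
      using w[of a] by (intro power_mono) simp_all
    hence "v (f a) / real (wt a) ^ t / real (wt a) ^ u \<le> v (f a) / real (wt a) ^ t / real (Suc w) ^ u"
      by (intro divide_left_mono) simp_all
    thus ?thesis by (simp add: power_add)
  qed simp
  hence "(\<Sum>a\<in>F. v (f a) / real (wt a) ^ (t + u))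
      \<le> (\<Sum>a\<in>F. v (f a) / real (wt a) ^ t) / real (Suc w) ^ u"
    unfolding sum_divide_distrib by (rule sum_mono)
  also have "\<dots> \<le> C / real (Suc w) ^ u"
    by (intro divide_right_mono dnorm_leD[OF f F]) simp
  finally show "(\<Sum>a\<in>F. v (f a) / real (wt a) ^ (t + u)) \<le> \<dots>" .
qed

lemma dnorm_le_larger: "dnorm_le t f C \<Longrightarrow> t \<le> t' \<Longrightarrow> dnorm_le t' f C"
  using dnorm_le_raise[of t f C 0 "t' - t"] by simp

text \<open>
  Shrinking the polyradius makes a series arbitrarily small in comparison with a monomial \<open>a\<close> that precedes
  all its terms. For \<open>a = 1\<close> this concerns series without constant term, for a leading monomial \<open>a\<close> the
  tail of a series.
\<close>

lemma dnorm_eventually_small: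
  assumes f: "dnorm_le t f C" and w: "\<And>b. f b \<noteq> 0 \<Longrightarrow> wt a < wt b" and e: "e > 0"
  shows "\<forall>\<^sub>F t in sequentially. dnorm_le t f (e / real (wt a) ^ t)"
proof -
  \<comment> \<open>All weights in the support are at least \<open>wt a + 1\<close>.\<close>
  define q where "q = real (wt a) / real (Suc (wt a))"
  have q: "0 < q" "q < 1" by (simp_all add: q_def field_simps)
  have "(\<lambda>u. (C * real (wt a) ^ t) * q ^ u) \<longlonglongrightarrow> (C * real (wt a) ^ t) * 0"
    using q by (intro tendsto_intros LIMSEQ_power_zero) simp
  hence "\<forall>\<^sub>F u in sequentially. (C * real (wt a) ^ t) * q ^ u < e"
    using e by (intro order_tendstoD) simp_all
  then obtain U where U: "\<And>u. u \<ge> U \<Longrightarrow> (C * real (wt a) ^ t) * q ^ u < e"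
    by (auto simp: eventually_sequentially)
  have "dnorm_le s f (e / real (wt a) ^ s)" if s: "s \<ge> t + U" for s
  proof -
    define u where "u = s - t"
    have su: "s = t + u" "u \<ge> U" using s by (auto simp: u_def)
    have "C / real (Suc (wt a)) ^ u * real (wt a) ^ (t + u) = (C * real (wt a) ^ t) * q ^ u"
      by (simp add: q_def power_add power_divide)
    hence "C / real (Suc (wt a)) ^ u \<le> e / real (wt a) ^ (t + u)"
      using U[OF su(2)] by (simp add: pos_le_divide_eq del: of_nat_Suc)
    thus ?thesis
      using dnorm_le_mono[OF dnorm_le_raise[OF f w]] unfolding su(1) by blast
  qed
  thus ?thesis unfolding eventually_sequentially by blast
qed

definition dconv :: "(nat multiset \<Rightarrow> 'k) \<Rightarrow> bool"
  where "dconv f \<longleftrightarrow> (\<exists>t C. dnorm_le t f C)"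

lemma wt_pow:
  assumes "set_mset a \<subseteq> {..<n}"
  shows "real (wt a) ^ t = (\<Prod>i<n. real (var_prime i) ^ (t * count a i))"
proof -
  have "wt a = (\<Prod>i\<in>set_mset a. var_prime i ^ count a i)"
    unfolding wt_def by (rule image_prod_mset_multiplicity)
  also have "\<dots> = (\<Prod>i<n. var_prime i ^ count a i)"
    using assms by (intro prod.mono_neutral_left) (auto simp: not_in_iff)
  finally show ?thesis by (simp add: prod_power_distrib power_mult[symmetric] mult.commute)
qed

text \<open>
  The polyradii \<open>(p\<^sub>1\<^bsup>-t\<^esup>, \<dots>, p\<^sub>n\<^bsup>-t\<^esup>)\<close> tend to \<open>0\<close>, so every polyradius dominates one of them.
\<close>

lemma convergent_ps_iff:
  assumes supp: "\<And>a. \<not> set_mset a \<subseteq> {..<n} \<Longrightarrow> f a = 0"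
  shows "convergent_ps v n f \<longleftrightarrow> dconv f"
proof
  assume "dconv f"
  then obtain t C where t: "dnorm_le t f C" by (auto simp: dconv_def)
  define r where "r i = 1 / real (var_prime i) ^ t" for i
  have wt_prod: "(\<Prod>i<n. r i ^ count a i) = 1 / real (wt a) ^ t" if "set_mset a \<subseteq> {..<n}" for a
    using wt_pow[OF that, of t] by (simp add: r_def power_divide prod_dividef power_mult[symmetric] mult.commute)
  show "convergent_ps v n f" unfolding convergent_ps_def
  proof (intro exI conjI allI impI)
    show "0 < r i" for i using prime_gt_0_nat[OF prime_var_prime[of i]] by (simp add: r_def)
    show "(\<lambda>a. v (f a) * (\<Prod>i<n. r i ^ count a i)) summable_on {a. set_mset a \<subseteq> {..<n}}"
    proof (rule nonneg_bdd_above_summable_on)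
      show "bdd_above (sum (\<lambda>a. v (f a) * (\<Prod>i<n. r i ^ count a i)) `
          {F. F \<subseteq> {a. set_mset a \<subseteq> {..<n}} \<and> finite F})"
      proof (rule bdd_aboveI2)
        fix F assume F: "F \<in> {F. F \<subseteq> {a. set_mset a \<subseteq> {..<n}} \<and> finite F}"
        have "(\<Sum>a\<in>F. v (f a) * (\<Prod>i<n. r i ^ count a i)) = (\<Sum>a\<in>F. v (f a) / real (wt a) ^ t)"
          using F by (intro sum.cong) (auto simp: wt_prod)
        thus "(\<Sum>a\<in>F. v (f a) * (\<Prod>i<n. r i ^ count a i)) \<le> C"
          using F dnorm_leD[OF t] by simp
      qed
    qed (simp add: r_def prod_nonneg)
  qed
next
  assume "convergent_ps v n f"
  then obtain r where r: "\<And>i. i < n \<Longrightarrow> 0 < r i"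
    and sm: "(\<lambda>a. v (f a) * (\<Prod>i<n. r i ^ count a i)) summable_on {a. set_mset a \<subseteq> {..<n}}"
      (is "?g summable_on ?A") by (auto simp: convergent_ps_def)
  have "\<forall>\<^sub>F t in sequentially. 1 / real (var_prime i) ^ t < r i" if "i < n" for i
  proof -
    have "(\<lambda>t. (1 / real (var_prime i)) ^ t) \<longlonglongrightarrow> 0"
      using prime_ge_2_nat[OF prime_var_prime[of i]] by (intro LIMSEQ_power_zero) simp
    thus ?thesis using r[OF that] by (auto dest!: order_tendstoD(2) simp: power_divide)
  qed
  hence "\<forall>\<^sub>F t in sequentially. \<forall>i\<in>{..<n}. 1 / real (var_prime i) ^ t < r i"
    by (intro eventually_ball_finite) auto
  then obtain t where t: "\<And>i. i < n \<Longrightarrow> 1 / real (var_prime i) ^ t < r i"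
    by (auto simp: eventually_sequentially)
  have "dnorm_le t f (infsum ?g ?A)" unfolding dnorm_le_def
  proof safe
    fix F :: "nat multiset set" assume F: "finite F"
    have "(\<Sum>a\<in>F. v (f a) / real (wt a) ^ t) = (\<Sum>a\<in>F \<inter> ?A. v (f a) / real (wt a) ^ t)"
      using F supp by (intro sum.mono_neutral_right) auto
    also have "\<dots> \<le> (\<Sum>a\<in>F \<inter> ?A. ?g a)"
    proof (rule sum_mono)
      fix a assume "a \<in> F \<inter> ?A"
      hence "1 / real (wt a) ^ t = (\<Prod>i<n. (1 / real (var_prime i) ^ t) ^ count a i)"
        using wt_pow[of a n t]
        by (simp add: power_divide prod_dividef power_mult[symmetric] mult.commute)
      also have "\<dots> \<le> (\<Prod>i<n. r i ^ count a i)"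
        using t by (intro prod_mono conjI power_mono) (auto intro: less_imp_le)
      finally show "v (f a) / real (wt a) ^ t \<le> ?g a"
        using mult_left_mono[of "1 / real (wt a) ^ t" _ "v (f a)"] by simp
    qed
    also have "\<dots> \<le> infsum ?g ?A"
      using F sm r by (intro finite_sum_le_infsum) (auto intro!: mult_nonneg_nonneg prod_nonneg zero_le_power simp: less_imp_le)
    finally show "(\<Sum>a\<in>F. v (f a) / real (wt a) ^ t) \<le> infsum ?g ?A" .
  qed
  thus "dconv f" by (auto simp: dconv_def)
qed

section \<open>The ring of convergent power series\<close>

abbreviation PS :: "nat \<Rightarrow> (nat multiset \<Rightarrow> 'k) ring"
  where "PS n \<equiv> convergent_ps_ring v n"

lemma PS_carrier:
  "carrier (PS n) = {f. (\<forall>a. \<not> set_mset a \<subseteq> {..<n} \<longrightarrow> f a = 0) \<and> dconv f}"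
  unfolding convergent_ps_ring_def by (auto simp: formal_ps_ring_sel convergent_ps_iff)

lemma PS_sel [simp]:
  "f \<otimes>\<^bsub>PS n\<^esub> g = ps_mult f g"
  "\<one>\<^bsub>PS n\<^esub> = ps_const 1"
  "\<zero>\<^bsub>PS n\<^esub> = (\<lambda>a. 0)"
  "f \<oplus>\<^bsub>PS n\<^esub> g = (\<lambda>a. f a + g a)"
  by (simp_all add: convergent_ps_ring_def formal_ps_ring_sel)

lemma dconvI: "dnorm_le t f C \<Longrightarrow> dconv f"
  by (auto simp: dconv_def)

lemma dconv_common:
  assumes "dconv f" "dconv g"
  obtains t C D where "dnorm_le t f C" "dnorm_le t g D"
proof -
  from assms obtain t C t' D where "dnorm_le t f C" "dnorm_le t' g D" by (auto simp: dconv_def)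
  hence "dnorm_le (max t t') f C" "dnorm_le (max t t') g D" by (auto intro: dnorm_le_larger)
  thus thesis by (rule that)
qed

lemma dconv_add: "dconv f \<Longrightarrow> dconv g \<Longrightarrow> dconv (\<lambda>a. f a + g a)"
  by (erule (1) dconv_common) (rule dconvI, erule (1) dnorm_le_add)

lemma dconv_mult: "dconv f \<Longrightarrow> dconv g \<Longrightarrow> dconv (ps_mult f g)"
  by (erule (1) dconv_common) (rule dconvI, erule (1) dnorm_le_mult)

lemma dconv_dom: "dconv g \<Longrightarrow> (\<And>a. v (f a) \<le> v (g a)) \<Longrightarrow> dconv f"
  by (meson dnorm_le_dom dconv_def)

lemma dconv_shift: "dconv h \<Longrightarrow> dconv (\<lambda>a. h (a + c))"
  unfolding dconv_def using dnorm_le_shift by blast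

lemma dconv_finite_support: "finite A \<Longrightarrow> (\<And>a. a \<notin> A \<Longrightarrow> f a = 0) \<Longrightarrow> dconv f"
  using dnorm_le_finite_support dconvI by blast

lemma PS_memI: "(\<And>a. f a \<noteq> 0 \<Longrightarrow> set_mset a \<subseteq> {..<n}) \<Longrightarrow> dconv f \<Longrightarrow> f \<in> carrier (PS n)"
  by (auto simp: PS_carrier)

lemma PS_supp: "f \<in> carrier (PS n) \<Longrightarrow> f a \<noteq> 0 \<Longrightarrow> set_mset a \<subseteq> {..<n}"
  by (auto simp: PS_carrier)

lemma PS_dconv: "f \<in> carrier (PS n) \<Longrightarrow> dconv f"
  by (auto simp: PS_carrier)

lemma PS_mono:
  assumes "n \<le> m" "f \<in> carrier (PS n)"
  shows "f \<in> carrier (PS m)"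
proof (rule PS_memI)
  show "set_mset a \<subseteq> {..<m}" if "f a \<noteq> 0" for a
    using PS_supp[OF assms(2) that] assms(1) by auto
qed (rule PS_dconv[OF assms(2)])

lemma ps_const_closed [simp]: "ps_const c \<in> carrier (PS n)"
proof (rule PS_memI)
  show "dconv (ps_const c)"
    by (rule dconv_finite_support[of "{{#}}"]) (simp_all add: ps_const_def)
qed (simp add: ps_const_def split: if_splits)

lemma ps_var_closed: "i < n \<Longrightarrow> ps_var i \<in> carrier (PS n)"
proof (rule PS_memI)
  show "dconv (ps_var i)"
    by (rule dconv_finite_support[of "{{#i#}}"]) (simp_all add: ps_var_def)
qed (simp add: ps_var_def split: if_splits)

lemma PS_uminus_closed:
  assumes "f \<in> carrier (PS n)" shows "(\<lambda>a. - f a) \<in> carrier (PS n)"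
proof (rule PS_memI)
  show "dconv (\<lambda>a. - f a)" by (rule dconv_dom[OF PS_dconv[OF assms]]) simp
qed (use PS_supp[OF assms] in simp)

lemma PS_add_closed:
  assumes "f \<in> carrier (PS n)" "g \<in> carrier (PS n)"
  shows "(\<lambda>a. f a + g a) \<in> carrier (PS n)"
proof (rule PS_memI)
  fix a assume "f a + g a \<noteq> 0"
  hence "f a \<noteq> 0 \<or> g a \<noteq> 0" by auto
  thus "set_mset a \<subseteq> {..<n}" using PS_supp[OF assms(1)] PS_supp[OF assms(2)] by blast
qed (intro dconv_add PS_dconv[OF assms(1)] PS_dconv[OF assms(2)])

lemma PS_mult_closed:
  assumes "f \<in> carrier (PS n)" "g \<in> carrier (PS n)"
  shows "ps_mult f g \<in> carrier (PS n)"
proof (rule PS_memI)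
  fix a assume "ps_mult f g a \<noteq> 0"
  then obtain b where b: "b \<subseteq># a" "f b * g (a - b) \<noteq> 0"
    unfolding ps_mult_def by (elim sum.not_neutral_contains_not_neutral) simp
  hence "set_mset b \<subseteq> {..<n}" "set_mset (a - b) \<subseteq> {..<n}"
    using PS_supp[OF assms(1), of b] PS_supp[OF assms(2), of "a - b"] by simp_all
  moreover have "set_mset a = set_mset b \<union> set_mset (a - b)"
    using b(1) by (metis set_mset_union subset_mset.add_diff_inverse)
  ultimately show "set_mset a \<subseteq> {..<n}" by simp
qed (intro dconv_mult PS_dconv[OF assms(1)] PS_dconv[OF assms(2)])

lemma PS_cring: "cring (PS n)"
proof -
  interpret A: cring "ps_all :: (nat multiset \<Rightarrow> 'k) ring" by (rule ps_all_cring)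
  have minus: "\<ominus>\<^bsub>ps_all\<^esub> f = (\<lambda>a. - f a)" for f :: "nat multiset \<Rightarrow> 'k"
    by (rule A.minus_equality) (simp_all add: ps_all_sel)
  have "subring (carrier (PS n)) ps_all"
    by (rule A.subringI)
       (auto simp: ps_all_sel minus intro: PS_uminus_closed PS_mult_closed PS_add_closed)
  hence "cring (ps_all \<lparr>carrier := carrier (PS n)\<rparr>)"
    using A.subcring_iff[of "carrier (PS n)"] A.subcringI' by (simp add: ps_all_sel)
  moreover have "ps_all \<lparr>carrier := carrier (PS n)\<rparr> = PS n"
    by (simp add: ps_all_def convergent_ps_ring_def formal_ps_ring_def)
  ultimately show ?thesis by simp
qed

lemma PS_a_inv:
  assumes "f \<in> carrier (PS n)" shows "\<ominus>\<^bsub>PS n\<^esub> f = (\<lambda>a. - f a)"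
proof -
  interpret cring "PS n" by (rule PS_cring)
  show ?thesis by (rule minus_equality) (simp_all add: assms PS_uminus_closed)
qed

lemma PS_minus: "f \<in> carrier (PS n) \<Longrightarrow> g \<in> carrier (PS n) \<Longrightarrow> f \<ominus>\<^bsub>PS n\<^esub> g = (\<lambda>a. f a - g a)"
  by (simp add: a_minus_def PS_a_inv)

lemma PS_finsum:
  assumes "f \<in> A \<rightarrow> carrier (PS n)"
  shows "(\<Oplus>\<^bsub>PS n\<^esub>i\<in>A. f i) = (\<lambda>a. \<Sum>i\<in>A. f i a)"
proof -
  interpret cring "PS n" by (rule PS_cring)
  show ?thesis using assms
    by (induction A rule: infinite_finite_induct) (auto simp: finsum_infinite)
qed

end

section \<open>Division, and closedness of ideals\<close>

definition ps_monom :: "nat multiset \<Rightarrow> nat multiset \<Rightarrow> 'k::field"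
  where "ps_monom b = (\<lambda>a. if a = b then 1 else 0)"

lemma ps_mult_monom: "ps_mult (ps_monom c) f = (\<lambda>a. if c \<subseteq># a then f (a - c) else 0)"
proof
  fix a
  have "ps_mult (ps_monom c) f a = (\<Sum>b\<in>(if c \<subseteq># a then {c} else {}). ps_monom c b * f (a - b))"
    unfolding ps_mult_def
    by (rule sum.mono_neutral_right) (auto simp: ps_monom_def split: if_splits)
  thus "ps_mult (ps_monom c) f a = (if c \<subseteq># a then f (a - c) else 0)" by (simp add: ps_monom_def)
qed

lemma nat_sequence_incseq_subsequence:
  fixes s :: "nat \<Rightarrow> nat"
  obtains f where "strict_mono f" "incseq (\<lambda>j. s (f j))"
proof -
  obtain f where f: "strict_mono f" "monoseq (\<lambda>j. s (f j))" using seq_monosub by blast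
  show thesis
  proof (cases "incseq (\<lambda>j. s (f j))")
    case False
    with f have dec: "decseq (\<lambda>j. s (f j))" by (auto simp: monoseq_iff)
    obtain N where N: "\<And>j. s (f N) \<le> s (f j)"
      using ex_has_least_nat[of "\<lambda>_. True" 0 "\<lambda>j. s (f j)"] by auto
    have "s (f (N + j)) = s (f N)" for j
      using N[of "N + j"] decseqD[OF dec, of N "N + j"] by simp
    thus thesis
      using that[of "\<lambda>j. f (N + j)"] f(1) by (simp add: strict_mono_def incseq_def)
  qed (use f that in blast)
qed

lemma multiset_sequence_incseq_subsequence:
  fixes s :: "nat \<Rightarrow> nat multiset"
  shows "\<exists>f. strict_mono f \<and> (\<forall>i<k. incseq (\<lambda>j. count (s (f j)) i))"
proof (induction k)
  case 0
  show ?case by (rule exI[of _ id]) (simp add: strict_mono_def)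
next
  case (Suc k)
  then obtain f where f: "strict_mono f" "\<And>i. i < k \<Longrightarrow> incseq (\<lambda>j. count (s (f j)) i)" by blast
  obtain g where g: "strict_mono g" "incseq (\<lambda>j. count (s (f (g j))) k)"
    using nat_sequence_incseq_subsequence[of "\<lambda>j. count (s (f j)) k"] by blast
  have "incseq (\<lambda>j. count (s (f (g j))) i)" if "i < k" for i
    using f(2)[OF that] strict_mono_mono[OF g(1)] by (auto simp: incseq_def mono_def)
  thus ?case
    using f(1) g by (intro exI[of _ "f \<circ> g"]) (auto simp: strict_mono_def less_Suc_eq)
qed

text \<open>
  Dickson's lemma. The minimal elements suffice; infinitely many of them would contain a sequence along which
  every exponent increases weakly.
\<close>

lemma dickson:
  assumes E: "\<And>a. a \<in> E \<Longrightarrow> set_mset a \<subseteq> {..<n::nat}"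
  obtains A where "finite A" "A \<subseteq> E" "\<And>a. a \<in> E \<Longrightarrow> \<exists>b\<in>A. b \<subseteq># a"
proof
  define A where "A = {a \<in> E. \<forall>b\<in>E. b \<subseteq># a \<longrightarrow> b = a}"
  show "A \<subseteq> E" by (auto simp: A_def)
  show "\<exists>b\<in>A. b \<subseteq># a" if "a \<in> E" for a
    using that
  proof (induction "size a" arbitrary: a rule: less_induct)
    case less
    show ?case
    proof (cases "a \<in> A")
      case False
      with less.prems obtain b where "b \<in> E" "b \<subset># a" by (auto simp: A_def subset_mset_def)
      with less.hyps[of b] show ?thesis
        by (meson mset_subset_size subset_mset.less_imp_le subset_mset.order_trans)
    qed auto
  qed
  show "finite A"
  proof (rule ccontr)
    assume "infinite A"
    then obtain s :: "nat \<Rightarrow> nat multiset" where s: "inj s" "range s \<subseteq> A"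
      using infinite_countable_subset by blast
    obtain f where f: "strict_mono f" "\<And>i. i < n \<Longrightarrow> incseq (\<lambda>j. count (s (f j)) i)"
      using multiset_sequence_incseq_subsequence by blast
    have "count (s (f 0)) i \<le> count (s (f 1)) i" for i
    proof (cases "i < n")
      case False
      have "s (f 0) \<in> E" using s(2) by (auto simp: A_def)
      with E False have "i \<notin># s (f 0)" by auto
      thus ?thesis by (simp add: not_in_iff)
    qed (use f(2) in \<open>auto simp: incseq_def\<close>)
    hence "s (f 0) \<subseteq># s (f 1)" by (simp add: subseteq_mset_def)
    moreover have "s (f 0) \<in> A" "s (f 1) \<in> A" using s(2) by auto
    ultimately have "s (f 0) = s (f 1)" by (auto simp: A_def)
    hence "f 0 = f 1" using s(1) by (simp add: inj_eq)
    thus False using strict_monoD[OF f(1), of 0 1] by simp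
  qed
qed

text \<open>
  Recursion along \<open>w\<close>; the equation for \<open>a\<close> involves only values at arguments of smaller weight.
\<close>

lemma triangular_system_solvable:
  fixes w :: "'a \<Rightarrow> nat" and f :: "'a \<Rightarrow> 'b::comm_ring"
  shows "\<exists>h. \<forall>a. h a = f a - (\<Sum>b | w b < w a. h b * K b a)"
proof -
  define F where "F = (\<lambda>h a. f a - (\<Sum>b | w b < w a. h b * K b a))"
  define h where "h = wfrec (inv_image less_than w) F"
  have "h a = f a - (\<Sum>b | w b < w a. h b * K b a)" for a
  proof -
    have "h a = F (cut h (inv_image less_than w) a) a"
      using wfrec[OF wf_inv_image[OF wf_less_than], of w F a] by (simp add: h_def)
    also have "\<dots> = f a - (\<Sum>b | w b < w a. h b * K b a)"
      unfolding F_def by (intro arg_cong2[of _ _ _ _ minus] sum.cong) (auto simp: cut_apply)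
    finally show ?thesis .
  qed
  thus ?thesis by blast
qed

context abs_value begin

lemma ps_monom_closed: "set_mset b \<subseteq> {..<n} \<Longrightarrow> ps_monom b \<in> carrier (PS n)"
proof (rule PS_memI)
  show "dconv (ps_monom b)"
    by (rule dconv_finite_support[of "{b}"]) (simp_all add: ps_monom_def)
qed (simp add: ps_monom_def split: if_splits)

lemma dnorm_le_monom: "dnorm_le t (ps_monom b) (1 / real (wt b) ^ t)"
  using dnorm_le_finite_support[of "{b}" "ps_monom b" t] by (simp add: ps_monom_def)

context
  fixes J :: "(nat multiset \<Rightarrow> 'k) set" and n :: nat
  assumes J: "ideal J (PS n)"
begin

lemma ideal_pointwise:
  shows ideal_pointwise_closed: "f \<in> J \<Longrightarrow> f \<in> carrier (PS n)"
    and ideal_pointwise_zero: "(\<lambda>a. 0) \<in> J"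
    and ideal_pointwise_add: "f \<in> J \<Longrightarrow> g \<in> J \<Longrightarrow> (\<lambda>a. f a + g a) \<in> J"
    and ideal_pointwise_mult: "q \<in> carrier (PS n) \<Longrightarrow> f \<in> J \<Longrightarrow> ps_mult q f \<in> J"
  using ideal.Icarr[OF J] additive_subgroup.zero_closed[OF ideal.axioms(1)[OF J]]
    additive_subgroup.a_closed[OF ideal.axioms(1)[OF J]] ideal.I_l_closed[OF J] by simp_all

lemma ideal_pointwise_scale: "f \<in> J \<Longrightarrow> (\<lambda>a. c * f a) \<in> J"
  using ideal_pointwise_mult[of "ps_const c" f] by (simp add: ps_mult_const)

lemma ideal_pointwise_diff: "f \<in> J \<Longrightarrow> g \<in> J \<Longrightarrow> (\<lambda>a. f a - g a) \<in> J"
  using ideal_pointwise_add[of f "\<lambda>a. -1 * g a"] ideal_pointwise_scale[of g "-1"] by simp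

lemma ideal_pointwise_sum: "(\<And>i. i \<in> A \<Longrightarrow> F i \<in> J) \<Longrightarrow> (\<lambda>a. \<Sum>i\<in>A. F i a) \<in> J"
  by (induction A rule: infinite_finite_induct) (auto simp: ideal_pointwise_zero ideal_pointwise_add)

text \<open>
  Let \<open>E\<close> be the set of leading monomials of elements of \<open>J\<close>, the leading monomial being the one of least
  weight. Division by finitely many elements of \<open>J\<close> whose leading monomials generate \<open>E\<close> writes \<open>f\<close> as an
  element of \<open>J\<close> plus a remainder without terms in \<open>E\<close>. If \<open>f\<close> is congruent to elements of \<open>J\<close> to every
  order, then so is the remainder, and its leading monomial would be one of an element of \<open>J\<close>. So the
  remainder is \<open>0\<close>.
  
  For the division, every \<open>b \<in> E\<close> is a multiple of the leading monomial of a divisor, and \<open>x\<^sup>b\<close> plus an error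
  \<open>K b\<close> is a multiple of this divisor. Writing \<open>f\<close> in terms of the monomials outside \<open>E\<close> and these multiples
  is a triangular linear system. At a small polyradius each error has at most half the norm of its monomial,
  and therefore the norm of the solution is at most twice the norm of \<open>f\<close>.
\<close>

lemma ideal_closed:
  assumes f: "f \<in> carrier (PS n)"
    and approx: "\<And>N. \<exists>j\<in>J. \<forall>a. size a < N \<longrightarrow> f a = j a"
  shows "f \<in> J"
proof -
  define E where "E = {a. \<exists>g\<in>J. g a \<noteq> 0 \<and> (\<forall>b. wt b < wt a \<longrightarrow> g b = 0)}"
  have E_supp: "set_mset a \<subseteq> {..<n}" if "a \<in> E" for a
    using that PS_supp[OF ideal_pointwise_closed] by (auto simp: E_def)
  obtain A where A: "finite A" "A \<subseteq> E" "\<And>a. a \<in> E \<Longrightarrow> \<exists>b\<in>A. b \<subseteq># a"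
    using dickson[OF E_supp] by blast
  have "\<exists>g\<in>J. g a = 1 \<and> (\<forall>b. wt b < wt a \<longrightarrow> g b = 0)" if "a \<in> E" for a
  proof -
    from that obtain g where g: "g \<in> J" "g a \<noteq> 0" "\<And>b. wt b < wt a \<Longrightarrow> g b = 0" by (auto simp: E_def)
    show ?thesis
      by (rule bexI[OF _ ideal_pointwise_scale[OF g(1), of "inverse (g a)"]]) (use g in simp)
  qed
  then obtain G where G: "\<And>a. a \<in> E \<Longrightarrow> G a \<in> J" "\<And>a. a \<in> E \<Longrightarrow> G a a = 1"
    "\<And>a b. a \<in> E \<Longrightarrow> wt b < wt a \<Longrightarrow> G a b = 0" by metis
  obtain pi where pi: "\<And>a. a \<in> E \<Longrightarrow> pi a \<in> A" "\<And>a. a \<in> E \<Longrightarrow> pi a \<subseteq># a" using A(3) by metis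
  define r where "r a = (\<lambda>b. G a b - ps_monom a b)" for a
  have r_closed: "r a \<in> carrier (PS n)" if "a \<in> E" for a
    unfolding r_def diff_conv_add_uminus
    by (intro PS_add_closed PS_uminus_closed ideal_pointwise_closed ps_monom_closed G E_supp that)
  have r_wt: "wt a < wt b" if "a \<in> E" "r a b \<noteq> 0" for a b
    using that G(2)[of a] G(3)[of a b] by (cases "wt a" "wt b" rule: linorder_cases) (auto simp: r_def ps_monom_def split: if_splits)
  have "\<forall>\<^sub>F t in sequentially. dnorm_le t (r a) (1 / 2 / real (wt a) ^ t)" if "a \<in> A" for a
  proof -
    have aE: "a \<in> E" using that A by blast
    obtain t C where "dnorm_le t (r a) C" using PS_dconv[OF r_closed[OF aE]] by (auto simp: dconv_def)
    thus ?thesis by (rule dnorm_eventually_small) (use r_wt[OF aE] in auto)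
  qed
  hence ev: "\<forall>\<^sub>F t in sequentially. \<forall>a\<in>A. dnorm_le t (r a) (1 / 2 / real (wt a) ^ t)"
    using A(1) by (intro eventually_ball_finite) auto
  obtain t0 C where t0: "dnorm_le t0 f C" using PS_dconv[OF f] by (auto simp: dconv_def)
  from eventually_conj[OF ev eventually_ge_at_top[of t0]] obtain t where
    t: "\<And>a. a \<in> A \<Longrightarrow> dnorm_le t (r a) (1 / 2 / real (wt a) ^ t)" "dnorm_le t f C"
    using dnorm_le_larger[OF t0] by (auto simp: eventually_sequentially)
  define K where "K b = (if b \<in> E then ps_mult (ps_monom (b - pi b)) (r (pi b)) else (\<lambda>a. 0))" for b
  have K_bound: "dnorm_le t (K b) (1 / 2 / real (wt b) ^ t)" for b
  proof (cases "b \<in> E")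
    case True
    have "wt b = wt (b - pi b) * wt (pi b)"
      using pi(2)[OF True] by (simp flip: wt_plus)
    moreover have "dnorm_le t (K b) (1 / real (wt (b - pi b)) ^ t * (1 / 2 / real (wt (pi b)) ^ t))"
      using True by (simp add: K_def) (rule dnorm_le_mult[OF dnorm_le_monom, OF t(1), simplified], rule pi, rule True)
    ultimately show ?thesis by (simp add: power_mult_distrib mult_ac)
  qed (simp add: K_def dnorm_le_def)
  have K_wt: "wt b < wt a" if "K b a \<noteq> 0" for a b
  proof -
    from that have b: "b \<in> E" "b - pi b \<subseteq># a" "r (pi b) (a - (b - pi b)) \<noteq> 0"
      by (auto simp: K_def ps_mult_monom split: if_splits)
    have "wt b = wt (b - pi b) * wt (pi b)" "wt a = wt (b - pi b) * wt (a - (b - pi b))"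
      using pi(2)[OF b(1)] b(2) by (simp_all flip: wt_plus)
    moreover have "wt (pi b) < wt (a - (b - pi b))" using r_wt b pi(1) A(2) by blast
    ultimately show ?thesis by simp
  qed
  obtain h where h: "\<And>a. h a = f a - (\<Sum>b | wt b < wt a. h b * K b a)"
    using triangular_system_solvable[where f = f and w = wt and K = K] by blast
  have h_bound: "dnorm_le t h (2 * C)"
    unfolding dnorm_le_def
  proof safe
    fix F :: "nat multiset set" assume F: "finite F"
    define M where "M = Max (insert 0 (wt ` F))"
    define B where "B = {a. wt a \<le> M}"
    define H where "H = (\<Sum>a\<in>B. v (h a) / real (wt a) ^ t)"
    have B: "finite B" "F \<subseteq> B" using F by (auto simp: B_def M_def)
    \<comment> \<open>This gives \<open>H \<le> C + H / 2\<close>; a finite \<open>B\<close> is needed to subtract \<open>H / 2\<close>.\<close>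
    have "H \<le> (\<Sum>a\<in>B. v (f a) / real (wt a) ^ t + (\<Sum>b\<in>B. v (h b) * (v (K b a) / real (wt a) ^ t)))"
      unfolding H_def
    proof (rule sum_mono)
      fix a assume a: "a \<in> B"
      have "(\<Sum>b | wt b < wt a. h b * K b a) = (\<Sum>b\<in>B. h b * K b a)"
        using a K_wt by (intro sum.mono_neutral_left) (auto simp: B(1), auto simp: B_def)
      hence "h a = f a + - (\<Sum>b\<in>B. h b * K b a)" using h[of a] by simp
      hence "v (h a) \<le> v (f a) + (\<Sum>b\<in>B. v (h b) * v (K b a))"
        using v_add[of "f a" "- (\<Sum>b\<in>B. h b * K b a)"] v_sum[of "\<lambda>b. h b * K b a" B] by (simp add: v_mult)
      hence "v (h a) / real (wt a) ^ t \<le> (v (f a) + (\<Sum>b\<in>B. v (h b) * v (K b a))) / real (wt a) ^ t"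
        by (rule divide_right_mono) simp
      thus "v (h a) / real (wt a) ^ t
          \<le> v (f a) / real (wt a) ^ t + (\<Sum>b\<in>B. v (h b) * (v (K b a) / real (wt a) ^ t))"
        by (simp add: add_divide_distrib sum_divide_distrib)
    qed
    also have "\<dots> = (\<Sum>a\<in>B. v (f a) / real (wt a) ^ t)
        + (\<Sum>b\<in>B. v (h b) * (\<Sum>a\<in>B. v (K b a) / real (wt a) ^ t))"
      unfolding sum.distrib sum_distrib_left by (subst sum.swap) (rule refl)
    also have "\<dots> \<le> C + (\<Sum>b\<in>B. v (h b) * (1 / 2 / real (wt b) ^ t))"
      by (intro add_mono sum_mono mult_left_mono dnorm_leD[OF t(2)] dnorm_leD[OF K_bound] B) simp
    also have "\<dots> = C + H / 2"
      by (simp add: H_def sum_divide_distrib mult.commute)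
    finally have "H \<le> 2 * C" by simp
    moreover have "(\<Sum>a\<in>F. v (h a) / real (wt a) ^ t) \<le> H"
      unfolding H_def by (rule sum_mono2) (use B in auto)
    ultimately show "(\<Sum>a\<in>F. v (h a) / real (wt a) ^ t) \<le> 2 * C" by simp
  qed
  \<comment> \<open>The quotient of \<open>f\<close> by the divisor with leading monomial \<open>c\<close>.\<close>
  define q where "q c = (\<lambda>b. if b + c \<in> E \<and> pi (b + c) = c then h (b + c) else 0)" for c
  have q_closed: "q c \<in> carrier (PS n)" for c
  proof (rule PS_memI)
    fix b assume "q c b \<noteq> 0"
    thus "set_mset b \<subseteq> {..<n}" using E_supp[of "b + c"] by (auto simp: q_def split: if_splits)
  next
    have "dnorm_le t (q c) (2 * C * real (wt c) ^ t)"
      by (rule dnorm_le_dom[OF dnorm_le_shift[OF h_bound]]) (simp add: q_def)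
    thus "dconv (q c)" by (rule dconvI)
  qed
  define s where "s = (\<lambda>a. \<Sum>c\<in>A. ps_mult (q c) (G c) a)"
  have sJ: "s \<in> J"
    unfolding s_def using A(2) by (intro ideal_pointwise_sum ideal_pointwise_mult q_closed G) auto
  have remainder: "f a - s a = (if a \<in> E then 0 else h a)" for a
  proof -
    have "G c = (\<lambda>b. r c b + ps_monom c b)" for c by (simp add: r_def)
    hence "ps_mult (q c) (G c) = (\<lambda>a. ps_mult (r c) (q c) a + ps_mult (ps_monom c) (q c) a)" for c
      by (metis ps_mult_add_left ps_mult_comm)
    hence "s a = (\<Sum>c\<in>A. ps_mult (q c) (r c) a) + (\<Sum>c\<in>A. ps_mult (ps_monom c) (q c) a)"
      by (simp add: s_def sum.distrib ps_mult_comm[of "q _"])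
    also have "(\<Sum>c\<in>A. ps_mult (ps_monom c) (q c) a)
        = (\<Sum>c\<in>A. if c = pi a then (if a \<in> E then h a else 0) else 0)"
      using pi(2)[of a] by (intro sum.cong) (auto simp: ps_mult_monom q_def)
    also have "\<dots> = (if a \<in> E then h a else 0)"
      using A(1) pi(1)[of a] by (simp add: sum.delta)
    also have "(\<Sum>c\<in>A. ps_mult (q c) (r c) a)
        = (\<Sum>(c, b)\<in>A \<times> {b. b \<subseteq># a}. q c b * r c (a - b))"
      by (simp add: ps_mult_def sum.cartesian_product)
    also have "\<dots> = (\<Sum>(c, b) | c \<in> A \<and> b \<subseteq># a \<and> q c b * r c (a - b) \<noteq> 0. q c b * r c (a - b))"
      using A(1) by (intro sum.mono_neutral_right) auto
    also have "\<dots> = (\<Sum>b | wt b < wt a \<and> h b * K b a \<noteq> 0. h b * K b a)"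
    proof (rule sum.reindex_bij_witness[of _ "\<lambda>b. (pi b, b - pi b)" "\<lambda>(c, b). b + c"])
      fix x assume "x \<in> {(c, b). c \<in> A \<and> b \<subseteq># a \<and> q c b * r c (a - b) \<noteq> 0}"
      then obtain c b where x: "x = (c, b)" "c \<in> A" "b \<subseteq># a" "q c b \<noteq> 0" "r c (a - b) \<noteq> 0" by auto
      hence bc: "b + c \<in> E" "pi (b + c) = c" "h (b + c) \<noteq> 0" "q c b = h (b + c)"
        by (auto simp: q_def split: if_splits)
      show "(pi (case x of (c, b) \<Rightarrow> b + c), (case x of (c, b) \<Rightarrow> b + c) - pi (case x of (c, b) \<Rightarrow> b + c)) = x"
        using x bc by simp
      have K: "K (b + c) a = r c (a - b)" using x bc by (simp add: K_def ps_mult_monom)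
      thus "(case x of (c, b) \<Rightarrow> b + c) \<in> {b. wt b < wt a \<and> h b * K b a \<noteq> 0}"
        using x bc K_wt[of "b + c" a] by simp
      show "h (case x of (c, b) \<Rightarrow> b + c) * K (case x of (c, b) \<Rightarrow> b + c) a
          = (case x of (c, b) \<Rightarrow> q c b * r c (a - b))"
        using x bc K by simp
    next
      fix b assume "b \<in> {b. wt b < wt a \<and> h b * K b a \<noteq> 0}"
      hence hK: "h b \<noteq> 0" "K b a \<noteq> 0" by auto
      hence b: "b \<in> E" "b - pi b \<subseteq># a" "r (pi b) (a - (b - pi b)) \<noteq> 0"
        by (auto simp: K_def ps_mult_monom split: if_splits)
      show "(pi b, b - pi b) \<in> {(c, b). c \<in> A \<and> b \<subseteq># a \<and> q c b * r c (a - b) \<noteq> 0}"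
        using pi[OF b(1)] b hK by (simp add: q_def)
      show "(case (pi b, b - pi b) of (c, b) \<Rightarrow> b + c) = b" using pi[OF b(1)] by simp
    qed
    also have "\<dots> = (\<Sum>b | wt b < wt a. h b * K b a)"
      by (rule sum.mono_neutral_left) auto
    finally show ?thesis using h[of a] by simp
  qed
  have "f a = s a" for a
  proof (rule ccontr)
    assume "f a \<noteq> s a"
    then obtain a where a: "f a \<noteq> s a" "\<And>b. wt b < wt a \<Longrightarrow> f b = s b"
      using exists_least_iff[of "\<lambda>w. \<exists>a. wt a = w \<and> f a \<noteq> s a"] by metis
    \<comment> \<open>The order of approximation is large enough to cover all monomials of weight at most \<open>wt a\<close>.\<close>
    obtain j where j: "j \<in> J" "\<And>b. size b < Suc (wt a) \<Longrightarrow> f b = j b" using approx by blast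
    have fj: "f b = j b" if "wt b \<le> wt a" for b
      using j(2)[of b] size_le_wt[of b] that by simp
    have "a \<in> E" unfolding E_def
      by (rule CollectI, rule bexI[OF _ ideal_pointwise_diff[OF j(1) sJ]]) (use a fj in auto)
    thus False using remainder[of a] a(1) by simp
  qed
  hence "f = s" by (rule ext)
  thus ?thesis using sJ by simp
qed

end

end

section \<open>Substitution\<close>

text \<open>
  The substitution \<open>x\<^sub>i \<mapsto> g\<^sub>i\<close>, where \<open>G a\<close> is the power product \<open>g\<^sup>a\<close>. If the \<open>g\<^sub>i\<close> have no constant term, then
  \<open>g\<^sup>a\<close> has order at least \<open>|a|\<close>, so that the coefficient at \<open>b\<close> only involves \<open>a\<close> with \<open>|a| \<le> |b|\<close>.
\<close>

definition ps_subst :: "nat \<Rightarrow> (nat multiset \<Rightarrow> nat multiset \<Rightarrow> 'k::field) \<Rightarrow>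
    (nat multiset \<Rightarrow> 'k) \<Rightarrow> nat multiset \<Rightarrow> 'k"
  where "ps_subst n G h = (\<lambda>b. \<Sum>a\<in>mons n (size b). h a * G a b)"

context abs_value begin

context
  fixes n m :: nat and g :: "nat \<Rightarrow> nat multiset \<Rightarrow> 'k"
  assumes g: "\<And>i. i < n \<Longrightarrow> g i \<in> carrier (PS m)" and g0: "\<And>i. i < n \<Longrightarrow> g i {#} = 0"
begin

abbreviation (input) "G \<equiv> mpow (PS m) g"

lemma subst_monom_closed: "set_mset a \<subseteq> {..<n} \<Longrightarrow> G a \<in> carrier (PS m)"
  using g by (intro cring.mpow_closed[OF PS_cring]) auto

lemma subst_monom_add_mset:
  "set_mset (add_mset i a) \<subseteq> {..<n} \<Longrightarrow> G (add_mset i a) = ps_mult (g i) (G a)"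
  using g by (subst cring.mpow_add_mset[OF PS_cring]) auto

lemma subst_monom_plus:
  "set_mset a \<subseteq> {..<n} \<Longrightarrow> set_mset b \<subseteq> {..<n} \<Longrightarrow> G (a + b) = ps_mult (G a) (G b)"
  using g by (subst cring.mpow_plus[OF PS_cring]) auto

lemma subst_monom_low:
  "set_mset a \<subseteq> {..<n} \<Longrightarrow> size b < size a \<Longrightarrow> G a b = 0"
proof (induction a arbitrary: b)
  case (add i a)
  have "g i c * G a (b - c) = 0" if c: "c \<subseteq># b" for c
  proof (cases "c = {#}")
    case False
    have "size (b - c) = size b - size c" using c by (rule size_Diff_submset)
    hence "size (b - c) < size a"
      using add.prems(2) False nonempty_has_size[of c] size_mset_mono[OF c] by simp
    thus ?thesis using add by simp
  qed (use add.prems g0 in simp)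
  thus ?case unfolding subst_monom_add_mset[OF add.prems(1)] ps_mult_def by (intro sum.neutral) simp
qed simp

lemma ps_subst_eq:
  assumes "size b \<le> d" shows "ps_subst n G h b = (\<Sum>a\<in>mons n d. h a * G a b)"
  unfolding ps_subst_def
proof (rule sum.mono_neutral_left)
  show "\<forall>a\<in>mons n d - mons n (size b). h a * G a b = 0"
    using subst_monom_low[of _ b] by (fastforce simp: mons_def not_le)
qed (use assms in \<open>auto simp: mons_def finite_multisets_bounded\<close>)

text \<open>
  If \<open>h\<close> has finite norm with exponent \<open>s\<close>, choose the exponent \<open>t\<close> so large that the norm of each \<open>g\<^sub>i\<close> is at
  most \<open>p\<^sub>i\<^bsup>-s\<^esup>\<close>. Then the norm of \<open>g\<^sup>a\<close> is at most \<open>wt(a)\<^bsup>-s\<^esup>\<close>, and the norm of the composition is at most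
  that of \<open>h\<close>.
\<close>

lemma ps_subst_closed:
  assumes h: "h \<in> carrier (PS n)"
  shows "ps_subst n G h \<in> carrier (PS m)"
proof (rule PS_memI)
  fix b assume "ps_subst n G h b \<noteq> 0"
  then obtain a where "a \<in> mons n (size b)" "h a * G a b \<noteq> 0"
    unfolding ps_subst_def by (elim sum.not_neutral_contains_not_neutral) simp
  thus "set_mset b \<subseteq> {..<m}" using PS_supp[OF subst_monom_closed, of a b] by (auto simp: mons_def)
next
  obtain s C where s: "dnorm_le s h C" using PS_dconv[OF h] by (auto simp: dconv_def)
  have "\<forall>\<^sub>F t in sequentially. dnorm_le t (g i) (1 / real (var_prime i) ^ s)" if i: "i < n" for i
  proof -
    obtain t C where t: "dnorm_le t (g i) C" using PS_dconv[OF g[OF i]] by (auto simp: dconv_def)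
    have "\<forall>\<^sub>F t in sequentially. dnorm_le t (g i) (1 / real (var_prime i) ^ s / real (wt {#}) ^ t)"
    proof (rule dnorm_eventually_small[OF t])
      fix b assume "g i b \<noteq> 0"
      hence "b \<noteq> {#}" using g0[OF i] by auto
      thus "wt {#} < wt b" using size_le_wt[of b] nonempty_has_size[of b] by simp
    qed (simp add: prime_gt_0_nat[OF prime_var_prime])
    thus ?thesis by simp
  qed
  hence "\<forall>\<^sub>F t in sequentially. \<forall>i\<in>{..<n}. dnorm_le t (g i) (1 / real (var_prime i) ^ s)"
    by (intro eventually_ball_finite) auto
  then obtain t where t: "\<And>i. i < n \<Longrightarrow> dnorm_le t (g i) (1 / real (var_prime i) ^ s)"
    by (auto simp: eventually_sequentially)
  have Gt: "dnorm_le t (G a) (1 / real (wt a) ^ s)" if "set_mset a \<subseteq> {..<n}" for a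
    using that
  proof (induction a)
    case (add i a)
    hence "dnorm_le t (ps_mult (g i) (G a)) (1 / real (var_prime i) ^ s * (1 / real (wt a) ^ s))"
      by (intro dnorm_le_mult t) auto
    thus ?case using add.prems
      by (simp only: subst_monom_add_mset) (simp add: wt_add_mset power_mult_distrib)
  qed (simp add: dnorm_le_one)
  have "dnorm_le t (ps_subst n G h) C"
    unfolding dnorm_le_def
  proof safe
    fix F :: "nat multiset set" assume F: "finite F"
    define d where "d = Max (insert 0 (size ` F))"
    have d: "size b \<le> d" if "b \<in> F" for b using F that by (simp add: d_def)
    have "v (ps_subst n G h b) / real (wt b) ^ t
        \<le> (\<Sum>a\<in>mons n d. v (h a) * (v (G a b) / real (wt b) ^ t))" if "b \<in> F" for b
    proof -
      have "v (ps_subst n G h b) \<le> (\<Sum>a\<in>mons n d. v (h a) * v (G a b))"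
        unfolding ps_subst_eq[OF d[OF that]] v_mult[symmetric] by (rule v_sum)
      hence "v (ps_subst n G h b) / real (wt b) ^ t \<le> (\<Sum>a\<in>mons n d. v (h a) * v (G a b)) / real (wt b) ^ t"
        by (rule divide_right_mono) simp
      thus ?thesis by (simp add: sum_divide_distrib)
    qed
    hence "(\<Sum>b\<in>F. v (ps_subst n G h b) / real (wt b) ^ t)
        \<le> (\<Sum>b\<in>F. \<Sum>a\<in>mons n d. v (h a) * (v (G a b) / real (wt b) ^ t))"
      by (rule sum_mono)
    also have "\<dots> = (\<Sum>a\<in>mons n d. v (h a) * (\<Sum>b\<in>F. v (G a b) / real (wt b) ^ t))"
      by (subst sum.swap) (simp add: sum_distrib_left)
    also have "\<dots> \<le> (\<Sum>a\<in>mons n d. v (h a) * (1 / real (wt a) ^ s))"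
      by (intro sum_mono mult_left_mono dnorm_leD[OF Gt] F) (auto simp: mons_def)
    also have "\<dots> \<le> C" using dnorm_leD[OF s, of "mons n d"] by simp
    finally show "(\<Sum>b\<in>F. v (ps_subst n G h b) / real (wt b) ^ t) \<le> C" .
  qed
  thus "dconv (ps_subst n G h)" by (rule dconvI)
qed

lemma ps_subst_mult:
  "ps_subst n G (ps_mult h h') = ps_mult (ps_subst n G h) (ps_subst n G h')"
proof
  fix b :: "nat multiset"
  define d where "d = size b"
  \<comment> \<open>Pairs \<open>(c, e)\<close> of total degree above \<open>d\<close> contribute nothing, which allows the summation over a square.\<close>
  have low: "G (c + e) b = 0" if "c \<in> mons n d" "e \<in> mons n d" "\<not> size c + size e \<le> d" for c e
    using that by (intro subst_monom_low) (auto simp: mons_def d_def)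
  have "ps_subst n G (ps_mult h h') b
      = (\<Sum>(a, c)\<in>(SIGMA a:mons n d. {c. c \<subseteq># a}). h c * h' (a - c) * G a b)"
    by (simp add: ps_subst_def ps_mult_def d_def sum_distrib_right sum.Sigma)
  also have "\<dots> = (\<Sum>(c, e) | c \<in> mons n d \<and> e \<in> mons n d \<and> size (c + e) \<le> d. h c * h' e * G (c + e) b)"
    by (rule sum.reindex_bij_witness[of _ "\<lambda>(c, e). (c + e, c)" "\<lambda>(a, c). (c, a - c)"])
       (auto simp: mons_def size_Diff_submset le_add_diff_inverse[OF size_mset_mono]
          dest: mset_subset_eqD in_diffD size_mset_mono)
  also have "\<dots> = (\<Sum>(c, e)\<in>mons n d \<times> mons n d. h c * h' e * G (c + e) b)"
    by (rule sum.mono_neutral_left) (auto, metis low)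
  also have "\<dots> = (\<Sum>c\<in>mons n d. \<Sum>e\<in>mons n d. h c * h' e * ps_mult (G c) (G e) b)"
    unfolding sum.cartesian_product[symmetric]
    by (intro sum.cong refl) (simp add: subst_monom_plus mons_def)
  also have "\<dots> = (\<Sum>c\<in>mons n d. \<Sum>e\<in>mons n d. \<Sum>x | x \<subseteq># b. (h c * G c x) * (h' e * G e (b - x)))"
    by (simp add: ps_mult_def sum_distrib_left mult_ac)
  also have "\<dots> = (\<Sum>c\<in>mons n d. \<Sum>x | x \<subseteq># b. \<Sum>e\<in>mons n d. (h c * G c x) * (h' e * G e (b - x)))"
    by (intro sum.cong refl sum.swap)
  also have "\<dots> = (\<Sum>x | x \<subseteq># b. \<Sum>c\<in>mons n d. \<Sum>e\<in>mons n d. (h c * G c x) * (h' e * G e (b - x)))"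
    by (rule sum.swap)
  also have "\<dots> = (\<Sum>x | x \<subseteq># b. ps_subst n G h x * ps_subst n G h' (b - x))"
  proof (intro sum.cong refl)
    fix x assume "x \<in> {x. x \<subseteq># b}"
    hence "size x \<le> d" "size (b - x) \<le> d" by (simp_all add: d_def size_mset_mono size_Diff_submset)
    thus "(\<Sum>c\<in>mons n d. \<Sum>e\<in>mons n d. (h c * G c x) * (h' e * G e (b - x)))
        = ps_subst n G h x * ps_subst n G h' (b - x)"
      by (simp add: ps_subst_eq[of _ d] sum_product)
  qed
  finally show "ps_subst n G (ps_mult h h') b = ps_mult (ps_subst n G h) (ps_subst n G h') b"
    by (simp add: ps_mult_def)
qed

lemma ps_subst_const: "ps_subst n G (ps_const c) = ps_const c"
proof
  fix b :: "nat multiset"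
  have "ps_subst n G (ps_const c) b = (\<Sum>a\<in>{{#}}. ps_const c a * G a b)"
    unfolding ps_subst_def by (rule sum.mono_neutral_right) (simp, simp_all add: mons_def ps_const_def)
  thus "ps_subst n G (ps_const c) b = ps_const c b" by (simp add: ps_const_def)
qed

lemma ps_subst_var:
  assumes i: "i < n" shows "ps_subst n G (ps_var i) = g i"
proof
  fix b
  have "G {#i#} = g i"
    using i g[OF i] cring.cring_simprules(12)[OF PS_cring] subst_monom_add_mset[of i "{#}"]
    by (simp add: ps_mult_comm[of _ "ps_const 1"] ps_mult_const)
  moreover have "ps_subst n G (ps_var i) b = (\<Sum>a\<in>{{#i#}}. ps_var i a * G a b)"
    unfolding ps_subst_eq[of b "Suc (size b)", OF le_SucI[OF order_refl]]
    by (rule sum.mono_neutral_right) (simp, use i in \<open>simp_all add: mons_def ps_var_def\<close>)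
  ultimately show "ps_subst n G (ps_var i) b = g i b" by (simp add: ps_var_def)
qed

lemma ps_subst_hom: "ps_subst n G \<in> ring_hom (PS n) (PS m)"
  by (rule ring_hom_memI)
     (simp_all add: ps_subst_closed ps_subst_mult ps_subst_const,
      simp add: ps_subst_def sum.distrib distrib_right)

end

lemma substitution_exists:
  assumes "\<And>i. i < n \<Longrightarrow> g i \<in> carrier (PS m)" "\<And>i. i < n \<Longrightarrow> g i {#} = 0"
  obtains \<psi> where "\<psi> \<in> ring_hom (PS n) (PS m)" "\<And>c. \<psi> (ps_const c) = ps_const c"
    "\<And>i. i < n \<Longrightarrow> \<psi> (ps_var i) = g i"
  using that[OF ps_subst_hom[OF assms] ps_subst_const[OF assms] ps_subst_var[OF assms]] by simp

end

section \<open>Homomorphisms out of power series rings\<close>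

lemma (in ideal) Quot_sel:
  "carrier (R Quot I) = (\<lambda>a. I +> a) ` carrier R"
  "\<zero>\<^bsub>R Quot I\<^esub> = I" "\<one>\<^bsub>R Quot I\<^esub> = I +> \<one>"
  by (auto simp: FactRing_def A_RCOSETS_def')

definition ps_restrict :: "nat \<Rightarrow> (nat multiset \<Rightarrow> 'k::field) \<Rightarrow> nat multiset \<Rightarrow> 'k"
  where "ps_restrict n h = (\<lambda>a. if set_mset a \<subseteq> {..<n} then h a else 0)"

context abs_value begin

lemma ps_restrict_closed: "h \<in> carrier (PS m) \<Longrightarrow> ps_restrict n h \<in> carrier (PS n)"
  by (rule PS_memI)
     (auto simp: ps_restrict_def split: if_splits intro!: dconv_dom[OF PS_dconv, of h m])

text \<open>
  The first order expansion in the last \<open>m\<close> variables, by splitting off one variable at a time.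
\<close>

lemma partial_hadamard:
  assumes "h \<in> carrier (PS (n + m))"
  shows "\<exists>u. (\<forall>j<m. u j \<in> carrier (PS (n + m))) \<and>
    (\<forall>a. h a = ps_restrict n h a + (\<Sum>j<m. ps_mult (ps_var (n + j)) (u j) a))"
  using assms
proof (induction m arbitrary: h)
  case 0
  thus ?case using PS_supp[OF 0] by (auto simp: ps_restrict_def)
next
  case (Suc m)
  define h' where "h' = ps_restrict (n + m) h"
  have h': "h' \<in> carrier (PS (n + m))" unfolding h'_def by (rule ps_restrict_closed[OF Suc.prems])
  from Suc.IH[OF h'] obtain u where u: "\<And>j. j < m \<Longrightarrow> u j \<in> carrier (PS (n + m))"
    "\<And>a. h' a = ps_restrict n h' a + (\<Sum>j<m. ps_mult (ps_var (n + j)) (u j) a)" by blast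
  define w where "w = (\<lambda>a. h (a + {#n + m#}))"
  have w: "w \<in> carrier (PS (n + Suc m))"
  proof (rule PS_memI)
    show "dconv w" unfolding w_def by (rule dconv_shift[OF PS_dconv[OF Suc.prems]])
    show "set_mset a \<subseteq> {..<n + Suc m}" if "w a \<noteq> 0" for a
      using PS_supp[OF Suc.prems, of "a + {#n + m#}"] that by (auto simp: w_def)
  qed
  have split: "h a = h' a + ps_mult (ps_var (n + m)) w a" for a
  proof (cases "n + m \<in># a")
    case True
    hence "h' a = 0" by (auto simp: h'_def ps_restrict_def)
    with True show ?thesis by (simp add: ps_mult_var w_def)
  next
    case False
    have "h a = 0" if "\<not> set_mset a \<subseteq> {..<n + m}"
    proof (rule ccontr)
      assume "h a \<noteq> 0"
      from PS_supp[OF Suc.prems this] False that show False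
        by (auto simp: less_Suc_eq subset_iff)
    qed
    with False show ?thesis by (auto simp: h'_def ps_restrict_def ps_mult_var)
  qed
  have "ps_restrict n h' = ps_restrict n h"
    unfolding h'_def ps_restrict_def by (rule ext) auto
  hence "h a = ps_restrict n h a
      + (\<Sum>j<Suc m. ps_mult (ps_var (n + j)) (if j = m then w else u j) a)" for a
    using split[of a] u(2)[of a] by simp
  moreover have "(if j = m then w else u j) \<in> carrier (PS (n + Suc m))" if "j < Suc m" for j
    using that u(1)[of j] w PS_mono[of "n + m" "n + Suc m" "u j"] by auto
  ultimately show ?case by (intro exI[of _ "\<lambda>j. if j = m then w else u j"]) blast
qed

lemma hadamard:
  assumes "h \<in> carrier (PS n)"
  obtains u where "\<And>i. i < n \<Longrightarrow> u i \<in> carrier (PS n)"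
    "h = (\<lambda>a. ps_const (h {#}) a + (\<Sum>i<n. ps_mult (ps_var i) (u i) a))"
proof -
  have "ps_restrict 0 h = ps_const (h {#})" by (auto simp: ps_restrict_def ps_const_def)
  thus thesis using partial_hadamard[of h 0 n] assms that by auto
qed

definition low :: "nat \<Rightarrow> (nat multiset \<Rightarrow> 'k) \<Rightarrow> bool"
  where "low N d \<longleftrightarrow> (\<forall>a. size a < N \<longrightarrow> d a = 0)"

lemma low_mult:
  assumes s: "s {#} = 0" and d: "low N d"
  shows "low (Suc N) (ps_mult s d)"
  unfolding low_def ps_mult_def
proof (intro allI impI sum.neutral ballI)
  fix a b :: "nat multiset" assume a: "size a < Suc N" "b \<in> {b. b \<subseteq># a}"
  show "s b * d (a - b) = 0"
  proof (cases "b = {#}")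
    case False
    have "size (a - b) < N"
      using a False size_Diff_submset[of b a] nonempty_has_size[of b] size_mset_mono[of b a] by simp
    thus ?thesis using d by (simp add: low_def)
  qed (use s in simp)
qed

text \<open>
  By induction on \<open>N\<close>, the values \<open>\<psi> h\<close> and \<open>\<psi>' h\<close> differ by the class of a series of order \<open>N\<close>: write
  \<open>h = c + \<Sum>\<^sub>i x\<^sub>i u\<^sub>i\<close> and use that the images of the variables have order \<open>1\<close>. As \<open>J\<close> is closed, the values
  are equal.
\<close>

lemma hom_into_quotient_unique:
  assumes J: "ideal J (PS m)"
    and \<psi>: "\<psi> \<in> ring_hom (PS n) (PS m Quot J)" and \<psi>': "\<psi>' \<in> ring_hom (PS n) (PS m Quot J)"
    and const: "\<And>c. \<psi> (ps_const c) = \<psi>' (ps_const c)"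
    and var: "\<And>i. i < n \<Longrightarrow> \<psi> (ps_var i) = \<psi>' (ps_var i)"
    and max: "\<And>i. i < n \<Longrightarrow> \<exists>s\<in>carrier (PS m). s {#} = 0 \<and> \<psi> (ps_var i) = J +>\<^bsub>PS m\<^esub> s"
    and h: "h \<in> carrier (PS n)"
  shows "\<psi> h = \<psi>' h"
proof -
  interpret S: cring "PS m" by (rule PS_cring)
  interpret R: cring "PS n" by (rule PS_cring)
  interpret J: ideal J "PS m" by (rule J)
  let ?Q = "PS m Quot J"
  interpret Q: cring ?Q by (rule J.quotient_is_cring[OF PS_cring])
  interpret F: ring_hom_cring "PS n" ?Q \<psi> by unfold_locales (rule \<psi>)
  interpret F': ring_hom_cring "PS n" ?Q \<psi>' by unfold_locales (rule \<psi>')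
  define \<pi> where "\<pi> = (\<lambda>a. J +>\<^bsub>PS m\<^esub> a)"
  interpret P: ring_hom_cring "PS m" ?Q \<pi>
    unfolding \<pi>_def by (rule J.rcos_ring_hom_cring[OF PS_cring])
  define near where "near N x y \<longleftrightarrow> (\<exists>d\<in>carrier (PS m). low N d \<and> x = y \<oplus>\<^bsub>?Q\<^esub> \<pi> d)" for N x y
  have near_refl: "near N x x" if "x \<in> carrier ?Q" for N x
    unfolding near_def using that P.hom_zero S.zero_closed
    by (intro bexI[of _ "\<zero>\<^bsub>PS m\<^esub>"]) (simp_all add: low_def del: P.hom_zero)
  have near_add: "near N (x \<oplus>\<^bsub>?Q\<^esub> x') (y \<oplus>\<^bsub>?Q\<^esub> y')"
    if xy: "near N x y" "near N x' y'" and y: "y \<in> carrier ?Q" "y' \<in> carrier ?Q" for N x x' y y'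
  proof -
    from xy obtain d d' where d: "d \<in> carrier (PS m)" "low N d" "x = y \<oplus>\<^bsub>?Q\<^esub> \<pi> d"
      "d' \<in> carrier (PS m)" "low N d'" "x' = y' \<oplus>\<^bsub>?Q\<^esub> \<pi> d'" by (auto simp: near_def)
    have "x \<oplus>\<^bsub>?Q\<^esub> x' = y \<oplus>\<^bsub>?Q\<^esub> y' \<oplus>\<^bsub>?Q\<^esub> \<pi> (d \<oplus>\<^bsub>PS m\<^esub> d')"
      using d y by (simp add: Q.a_ac del: PS_sel)
    moreover have "low N (d \<oplus>\<^bsub>PS m\<^esub> d')" using d by (simp add: low_def)
    ultimately show ?thesis unfolding near_def using S.a_closed[OF d(1,4)] by blast
  qed
  have near_mult: "near (Suc N) (\<pi> s \<otimes>\<^bsub>?Q\<^esub> x) (\<pi> s \<otimes>\<^bsub>?Q\<^esub> y)"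
    if xy: "near N x y" and y: "y \<in> carrier ?Q" and s: "s \<in> carrier (PS m)" "s {#} = 0" for N x y s
  proof -
    from xy obtain d where d: "d \<in> carrier (PS m)" "low N d" "x = y \<oplus>\<^bsub>?Q\<^esub> \<pi> d"
      by (auto simp: near_def)
    have "\<pi> s \<otimes>\<^bsub>?Q\<^esub> x = \<pi> s \<otimes>\<^bsub>?Q\<^esub> y \<oplus>\<^bsub>?Q\<^esub> \<pi> (s \<otimes>\<^bsub>PS m\<^esub> d)"
      using d y s by (simp add: Q.r_distr del: PS_sel)
    moreover have "low (Suc N) (s \<otimes>\<^bsub>PS m\<^esub> d)" using low_mult[of s N d] s d by simp
    ultimately show ?thesis unfolding near_def using S.m_closed[OF s(1) d(1)] by blast
  qed
  have near: "near N (\<psi> h) (\<psi>' h)" if "h \<in> carrier (PS n)" for N h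
    using that
  proof (induction N arbitrary: h)
    case 0
    have "\<psi> h \<ominus>\<^bsub>?Q\<^esub> \<psi>' h \<in> carrier ?Q" using 0 by simp
    then obtain d where d: "d \<in> carrier (PS m)" "\<psi> h \<ominus>\<^bsub>?Q\<^esub> \<psi>' h = \<pi> d"
      unfolding J.Quot_sel \<pi>_def by auto
    have "\<psi> h = \<psi>' h \<oplus>\<^bsub>?Q\<^esub> \<pi> d"
      using d(2)[symmetric] F.hom_closed[OF 0] F'.hom_closed[OF 0]
      by (simp add: Q.minus_eq Q.a_ac Q.r_neg2 Q.a_lcomm[of "\<psi>' h"] Q.r_neg)
    thus ?case using d(1) by (auto simp: near_def low_def)
  next
    case (Suc N)
    note IH = Suc.IH
    obtain u where u: "\<And>i. i < n \<Longrightarrow> u i \<in> carrier (PS n)"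
      and hu: "h = (\<lambda>a. ps_const (h {#}) a + (\<Sum>i<n. ps_mult (ps_var i) (u i) a))"
      using hadamard[OF Suc.prems] by blast
    have xu: "ps_var i \<otimes>\<^bsub>PS n\<^esub> u i \<in> carrier (PS n)" if "i < n" for i
      using R.m_closed[OF ps_var_closed[OF that] u[OF that]] .
    define s where "s k = ps_const (h {#}) \<oplus>\<^bsub>PS n\<^esub> (\<Oplus>\<^bsub>PS n\<^esub>i\<in>{..<k}. ps_var i \<otimes>\<^bsub>PS n\<^esub> u i)" for k
    have s_closed: "s k \<in> carrier (PS n)" if "k \<le> n" for k
      unfolding s_def using that xu by (intro R.a_closed ps_const_closed R.finsum_closed) auto
    have "near (Suc N) (\<psi> (s k)) (\<psi>' (s k))" if "k \<le> n" for k
      using that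
    proof (induction k)
      case 0
      have "s 0 = ps_const (h {#})" by (simp add: s_def)
      thus ?case using near_refl const F'.hom_closed[OF ps_const_closed] by simp
    next
      case (Suc k)
      hence k: "k < n" by simp
      have fs: "(\<Oplus>\<^bsub>PS n\<^esub>i\<in>{..<k}. ps_var i \<otimes>\<^bsub>PS n\<^esub> u i) \<in> carrier (PS n)"
        using k xu by (intro R.finsum_closed) auto
      have step: "s (Suc k) = s k \<oplus>\<^bsub>PS n\<^esub> (ps_var k \<otimes>\<^bsub>PS n\<^esub> u k)"
        unfolding s_def lessThan_Suc using k xu fs
        by (subst R.finsum_insert) (auto simp: R.a_ac simp del: PS_sel)
      obtain x where x: "x \<in> carrier (PS m)" "x {#} = 0" "\<psi> (ps_var k) = \<pi> x"
        using max[OF k] unfolding \<pi>_def by blast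
      have "near (Suc N) (\<pi> x \<otimes>\<^bsub>?Q\<^esub> \<psi> (u k)) (\<pi> x \<otimes>\<^bsub>?Q\<^esub> \<psi>' (u k))"
        using u[OF k] x(1,2) by (intro near_mult IH F'.hom_closed)
      hence "near (Suc N) (\<psi> (s k) \<oplus>\<^bsub>?Q\<^esub> (\<pi> x \<otimes>\<^bsub>?Q\<^esub> \<psi> (u k)))
          (\<psi>' (s k) \<oplus>\<^bsub>?Q\<^esub> (\<pi> x \<otimes>\<^bsub>?Q\<^esub> \<psi>' (u k)))"
      proof (rule near_add[rotated])
        show "near (Suc N) (\<psi> (s k)) (\<psi>' (s k))" using Suc.IH k by simp
      qed (use k x(1) u[OF k] s_closed[of k] in simp_all)
      thus ?case unfolding step
        using x(3) var[OF k] k u[OF k] s_closed[of k] ps_var_closed[OF k] xu[OF k]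
        by (simp del: PS_sel)
    qed
    moreover have "s n = h"
      by (subst hu) (simp add: s_def PS_finsum xu[simplified])
    ultimately show ?case using order_refl by metis
  qed
  obtain a where a: "a \<in> carrier (PS m)" "\<psi> h = \<pi> a"
    using F.hom_closed[OF h] unfolding J.Quot_sel \<pi>_def by auto
  obtain b where b: "b \<in> carrier (PS m)" "\<psi>' h = \<pi> b"
    using F'.hom_closed[OF h] unfolding J.Quot_sel \<pi>_def by auto
  have "a \<ominus>\<^bsub>PS m\<^esub> b \<in> J"
  proof (rule ideal_closed[OF J])
    fix N
    from near[OF h, of N] obtain d where d: "d \<in> carrier (PS m)" "low N d" "\<pi> a = \<pi> b \<oplus>\<^bsub>?Q\<^esub> \<pi> d"
      unfolding near_def a b by blast
    hence "\<pi> a = \<pi> (b \<oplus>\<^bsub>PS m\<^esub> d)" using b by (simp del: PS_sel)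
    hence "a \<ominus>\<^bsub>PS m\<^esub> (b \<oplus>\<^bsub>PS m\<^esub> d) \<in> J"
      using a b d S.a_closed[OF b(1) d(1)] unfolding \<pi>_def by (simp add: J.rcos_eq_iff del: PS_sel)
    moreover have "\<forall>c. size c < N \<longrightarrow> (a \<ominus>\<^bsub>PS m\<^esub> b) c = (a \<ominus>\<^bsub>PS m\<^esub> (b \<oplus>\<^bsub>PS m\<^esub> d)) c"
      using a b d S.a_closed[OF b(1) d(1)] by (simp add: PS_minus low_def)
    ultimately show "\<exists>j\<in>J. \<forall>c. size c < N \<longrightarrow> (a \<ominus>\<^bsub>PS m\<^esub> b) c = j c" by blast
  qed (use a b in simp)
  thus ?thesis using a b unfolding \<pi>_def by (simp add: J.rcos_eq_iff)
qed

lemma hom_unique: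
  assumes \<psi>: "\<psi> \<in> ring_hom (PS n) (PS m)" and \<psi>': "\<psi>' \<in> ring_hom (PS n) (PS m)"
    and const: "\<And>c. \<psi> (ps_const c) = \<psi>' (ps_const c)"
    and var: "\<And>i. i < n \<Longrightarrow> \<psi> (ps_var i) = \<psi>' (ps_var i)"
    and max: "\<And>i. i < n \<Longrightarrow> \<psi> (ps_var i) {#} = 0"
    and h: "h \<in> carrier (PS n)"
  shows "\<psi> h = \<psi>' h"
proof -
  interpret S: cring "PS m" by (rule PS_cring)
  interpret Z: ideal "{\<zero>\<^bsub>PS m\<^esub>}" "PS m" by (rule S.zeroideal)
  have comp: "(\<lambda>x. {\<zero>\<^bsub>PS m\<^esub>} +>\<^bsub>PS m\<^esub> \<xi> x) \<in> ring_hom (PS n) (PS m Quot {\<zero>\<^bsub>PS m\<^esub>})"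
    if "\<xi> \<in> ring_hom (PS n) (PS m)" for \<xi>
    using ring_hom_trans[OF that Z.rcos_ring_hom] by (simp add: comp_def)
  have "{\<zero>\<^bsub>PS m\<^esub>} +>\<^bsub>PS m\<^esub> \<psi> h = {\<zero>\<^bsub>PS m\<^esub>} +>\<^bsub>PS m\<^esub> \<psi>' h"
  proof (rule hom_into_quotient_unique[OF Z.ideal_axioms comp[OF \<psi>] comp[OF \<psi>'] _ _ _ h])
    show "\<exists>s\<in>carrier (PS m). s {#} = 0 \<and>
        {\<zero>\<^bsub>PS m\<^esub>} +>\<^bsub>PS m\<^esub> \<psi> (ps_var i) = {\<zero>\<^bsub>PS m\<^esub>} +>\<^bsub>PS m\<^esub> s" if "i < n" for i
      using max[OF that] ring_hom_closed[OF \<psi> ps_var_closed[OF that]] by blast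
  qed (simp_all add: const var)
  hence "\<psi> h \<ominus>\<^bsub>PS m\<^esub> \<psi>' h = \<zero>\<^bsub>PS m\<^esub>"
    using Z.rcos_eq_iff ring_hom_closed[OF \<psi> h] ring_hom_closed[OF \<psi>' h] by blast
  thus ?thesis
    using ring_hom_closed[OF \<psi> h] ring_hom_closed[OF \<psi>' h] S.r_right_minus_eq by blast
qed

text \<open>
  Instead of summing a geometric series, apply closedness to the principal ideal of \<open>f\<close>: with
  \<open>s = 1 - f / f(0)\<close>, the element \<open>1 - s\<^sup>N\<close> is a multiple of \<open>f\<close>, and \<open>s\<^sup>N\<close> has order \<open>N\<close>.
\<close>

lemma nonzero_constant_term_unit:
  assumes f: "f \<in> carrier (PS n)" and c: "f {#} \<noteq> 0"
  obtains w where "w \<in> carrier (PS n)" "ps_mult f w = ps_const 1"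
proof -
  interpret cring "PS n" by (rule PS_cring)
  interpret J: ideal "PIdl\<^bsub>PS n\<^esub> f" "PS n" by (rule cgenideal_ideal[OF f])
  define s where "s = ps_const 1 \<ominus>\<^bsub>PS n\<^esub> ps_mult (ps_const (inverse (f {#}))) f"
  have f': "ps_mult (ps_const (inverse (f {#}))) f \<in> PIdl\<^bsub>PS n\<^esub> f"
    unfolding cgenideal_def by force
  have s: "s \<in> carrier (PS n)" unfolding s_def using J.Icarr[OF f'] by simp
  have s0: "s {#} = 0" unfolding s_def using c J.Icarr[OF f'] by (simp add: PS_minus ps_mult_const) (simp add: ps_const_def)
  have "\<exists>p\<in>carrier (PS n). low N p \<and> ps_const 1 \<ominus>\<^bsub>PS n\<^esub> p \<in> PIdl\<^bsub>PS n\<^esub> f" for N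
  proof (induction N)
    case 0
    have "ps_const 1 \<ominus>\<^bsub>PS n\<^esub> ps_const 1 = \<zero>\<^bsub>PS n\<^esub>" by (simp add: PS_minus)
    thus ?case using J.zero_closed by (intro bexI[of _ "ps_const 1"]) (auto simp: low_def)
  next
    case (Suc N)
    then obtain p where p: "p \<in> carrier (PS n)" "low N p" "ps_const 1 \<ominus>\<^bsub>PS n\<^esub> p \<in> PIdl\<^bsub>PS n\<^esub> f" by blast
    have "ps_const 1 \<ominus>\<^bsub>PS n\<^esub> (s \<otimes>\<^bsub>PS n\<^esub> p)
        = (ps_const 1 \<ominus>\<^bsub>PS n\<^esub> p) \<oplus>\<^bsub>PS n\<^esub> (ps_mult (ps_const (inverse (f {#}))) f \<otimes>\<^bsub>PS n\<^esub> p)"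
    proof -
      have "ps_mult s p = (\<lambda>a. p a - ps_mult (ps_mult (ps_const (inverse (f {#}))) f) p a)"
        using ps_mult_add_left[of s "ps_mult (ps_const (inverse (f {#}))) f" p] J.Icarr[OF f']
        by (simp add: s_def PS_minus ps_mult_const fun_eq_iff)
      thus ?thesis using p(1) m_closed[OF s p(1)] by (simp add: PS_minus algebra_simps)
    qed
    moreover have "\<dots> \<in> PIdl\<^bsub>PS n\<^esub> f"
      by (intro J.a_closed p J.I_r_closed f')
    ultimately show ?case
      using low_mult[of s N p, OF s0 p(2)] m_closed[OF s p(1)] by auto
  qed
  note powers = this
  have "ps_const 1 \<in> PIdl\<^bsub>PS n\<^esub> f"
  proof (rule ideal_closed[OF J.ideal_axioms ps_const_closed])
    fix N
    from powers[of N] obtain p where p: "p \<in> carrier (PS n)" "low N p"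
      "ps_const 1 \<ominus>\<^bsub>PS n\<^esub> p \<in> PIdl\<^bsub>PS n\<^esub> f" by blast
    thus "\<exists>j\<in>PIdl\<^bsub>PS n\<^esub> f. \<forall>a. size a < N \<longrightarrow> ps_const 1 a = j a"
      by (intro bexI[OF _ p(3)]) (simp add: PS_minus low_def)
  qed
  then obtain w where w: "w \<in> carrier (PS n)" "ps_const 1 = ps_mult w f"
    unfolding cgenideal_def PS_sel by blast
  show thesis by (rule that[OF w(1)]) (simp only: w(2) ps_mult_comm[of f w])
qed

text \<open>
  An isomorphism of \<open>k\<close>-algebras between quotients of power series rings is local. A lift \<open>f\<close> of \<open>s\<close> with a
  constant term would be a unit, so \<open>s\<close> would be a unit modulo \<open>J\<close>. This is impossible unless both
  quotients are \<open>0\<close>, in which case \<open>f = 0\<close> is a lift.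
\<close>

lemma iso_lift_maximal:
  assumes I: "ideal I (PS n)" and J: "ideal J (PS m)"
    and \<phi>: "\<phi> \<in> ring_iso (PS n Quot I) (PS m Quot J)"
    and const: "\<And>c. \<phi> (I +>\<^bsub>PS n\<^esub> ps_const c) = J +>\<^bsub>PS m\<^esub> ps_const c"
    and s: "s \<in> carrier (PS m)" "s {#} = 0"
  shows "\<exists>f\<in>carrier (PS n). f {#} = 0 \<and> \<phi> (I +>\<^bsub>PS n\<^esub> f) = J +>\<^bsub>PS m\<^esub> s"
proof -
  interpret S: cring "PS m" by (rule PS_cring)
  interpret R: cring "PS n" by (rule PS_cring)
  interpret J: ideal J "PS m" by (rule J)
  interpret I: ideal I "PS n" by (rule I)
  have hom: "\<phi> \<in> ring_hom (PS n Quot I) (PS m Quot J)" using \<phi> by (simp add: ring_iso_def)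
  have "J +>\<^bsub>PS m\<^esub> s \<in> \<phi> ` carrier (PS n Quot I)"
    using \<phi> s by (simp add: ring_iso_def bij_betw_def J.Quot_sel)
  then obtain f where f: "f \<in> carrier (PS n)" "\<phi> (I +>\<^bsub>PS n\<^esub> f) = J +>\<^bsub>PS m\<^esub> s"
    by (auto simp: I.Quot_sel)
  show ?thesis
  proof (cases "f {#} = 0")
    case False
    obtain w where w: "w \<in> carrier (PS n)" "ps_mult f w = ps_const 1"
      by (rule nonzero_constant_term_unit[OF f(1) False])
    have "\<phi> (I +>\<^bsub>PS n\<^esub> w) \<in> carrier (PS m Quot J)"
      using ring_hom_closed[OF hom] w by (simp add: I.Quot_sel)
    then obtain t where t: "t \<in> carrier (PS m)" "\<phi> (I +>\<^bsub>PS n\<^esub> w) = J +>\<^bsub>PS m\<^esub> t"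
      by (auto simp: J.Quot_sel)
    have "J +>\<^bsub>PS m\<^esub> ps_const 1 = \<phi> ((I +>\<^bsub>PS n\<^esub> f) \<otimes>\<^bsub>PS n Quot I\<^esub> (I +>\<^bsub>PS n\<^esub> w))"
      unfolding ring_hom_mult[OF I.rcos_ring_hom f(1) w(1), symmetric] by (simp add: w const)
    also have "\<dots> = (J +>\<^bsub>PS m\<^esub> s) \<otimes>\<^bsub>PS m Quot J\<^esub> (J +>\<^bsub>PS m\<^esub> t)"
      using ring_hom_mult[OF hom] f w t by (simp add: I.Quot_sel)
    also have "\<dots> = J +>\<^bsub>PS m\<^esub> ps_mult s t"
      using ring_hom_mult[OF J.rcos_ring_hom s(1) t(1)] by simp
    finally have u: "ps_const 1 \<ominus>\<^bsub>PS m\<^esub> ps_mult s t \<in> J"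
      using PS_mult_closed[OF s(1) t(1)] by (simp add: J.rcos_eq_iff)
    have "(ps_const 1 \<ominus>\<^bsub>PS m\<^esub> ps_mult s t) {#} \<noteq> 0"
      using PS_mult_closed[OF s(1) t(1)] s(2) by (simp add: PS_minus) (simp add: ps_const_def ps_mult_def)
    then obtain w' where w': "w' \<in> carrier (PS m)"
        "ps_mult (ps_const 1 \<ominus>\<^bsub>PS m\<^esub> ps_mult s t) w' = ps_const 1"
      using nonzero_constant_term_unit[OF J.Icarr[OF u]] by blast
    hence "\<one>\<^bsub>PS m\<^esub> \<in> J" using J.I_r_closed[OF u w'(1)] by simp
    hence "J = carrier (PS m)" by (rule J.one_imp_carrier)
    hence "s \<ominus>\<^bsub>PS m\<^esub> ps_const 0 \<in> J" using s by simp
    hence "J +>\<^bsub>PS m\<^esub> s = J +>\<^bsub>PS m\<^esub> ps_const 0" using s by (subst J.rcos_eq_iff) auto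
    hence "\<phi> (I +>\<^bsub>PS n\<^esub> ps_const 0) = J +>\<^bsub>PS m\<^esub> s" using const by simp
    moreover have "ps_const 0 {#} = 0" by (simp add: ps_const_def)
    ultimately show ?thesis using ps_const_closed by blast
  qed (use f in blast)
qed

end

section \<open>Power series rings over power series rings\<close>

lemma (in coordinate_extension) constant_coeff_hom: "(\<lambda>h. co h {#}) \<in> ring_hom T R"
  by (rule ring_hom_memI) (simp_all add: co_closed co_add co_mult co_one)

lemma (in coordinate_extension) coordinate_extension_transport:
  assumes T': "cring T'" and \<theta>: "\<theta> \<in> ring_hom T' T" and \<theta>': "\<theta>' \<in> ring_hom T T'"
    and inv1: "\<And>h. h \<in> carrier T \<Longrightarrow> \<theta> (\<theta>' h) = h"
    and inv2: "\<And>h. h \<in> carrier T' \<Longrightarrow> \<theta>' (\<theta> h) = h"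
  shows "coordinate_extension R T' m (\<lambda>r. \<theta>' (\<iota> r)) (\<lambda>j. \<theta>' (t j)) (\<lambda>h. co (\<theta> h))"
proof -
  interpret T': cring T' by (rule T')
  interpret \<theta>: ring_hom_cring T' T \<theta> by unfold_locales (rule \<theta>)
  interpret \<theta>': ring_hom_cring T T' \<theta>' by unfold_locales (rule \<theta>')
  show ?thesis
  proof unfold_locales
    show "(\<lambda>r. \<theta>' (\<iota> r)) \<in> ring_hom R T'"
      using ring_hom_trans[OF iota_hom \<theta>'] by (simp add: comp_def)
    fix h assume h: "h \<in> carrier T'"
    obtain u where u: "\<And>j. j < m \<Longrightarrow> u j \<in> carrier T"
      "\<theta> h = \<iota> (co (\<theta> h) {#}) \<oplus> (\<Oplus>j\<in>{..<m}. t j \<otimes> u j)"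
      using expansion[OF \<theta>.hom_closed[OF h]] by blast
    have tu: "(\<lambda>j. t j \<otimes> u j) \<in> {..<m} \<rightarrow> carrier T" using u(1) t_closed by auto
    have "h = \<theta>' (\<theta> h)" using inv2[OF h] by simp
    also have "\<dots> = \<theta>' (\<iota> (co (\<theta> h) {#})) \<oplus>\<^bsub>T'\<^esub> \<theta>' (\<Oplus>j\<in>{..<m}. t j \<otimes> u j)"
      using T.finsum_closed[OF tu] h by (subst u(2)) (simp add: co_closed)
    also have "\<theta>' (\<Oplus>j\<in>{..<m}. t j \<otimes> u j) = (\<Oplus>\<^bsub>T'\<^esub>j\<in>{..<m}. \<theta>' (t j) \<otimes>\<^bsub>T'\<^esub> \<theta>' (u j))"
      unfolding \<theta>'.hom_finsum[OF tu]
      by (rule T'.finsum_cong') (use u(1) t_closed in auto)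
    finally show "\<exists>u. (\<forall>j<m. u j \<in> carrier T') \<and>
        h = \<theta>' (\<iota> (co (\<theta> h) {#})) \<oplus>\<^bsub>T'\<^esub> (\<Oplus>\<^bsub>T'\<^esub>j\<in>{..<m}. \<theta>' (t j) \<otimes>\<^bsub>T'\<^esub> u j)"
      using u(1) by (intro exI[of _ "\<lambda>j. \<theta>' (u j)"]) simp
  qed (simp_all add: co_closed co_supp co_add co_mult co_iota co_t inv1 t_closed)
qed

text \<open>
  The monomials in \<open>n + m\<close> variables are the products of a monomial \<open>b\<close> in the first \<open>n\<close> variables and a
  monomial \<open>shift_vars n a\<close> in the last \<open>m\<close> variables.
\<close>

definition shift_vars :: "nat \<Rightarrow> nat multiset \<Rightarrow> nat multiset"
  where "shift_vars n a = image_mset (\<lambda>j. n + j) a"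

text \<open>
  The coefficient of \<open>y\<^sup>a\<close> in \<open>h(x, y)\<close>, a series in the first \<open>n\<close> variables \<open>x\<close>.
\<close>

definition block_coeff :: "nat \<Rightarrow> (nat multiset \<Rightarrow> 'k::field) \<Rightarrow> nat multiset \<Rightarrow> nat multiset \<Rightarrow> 'k"
  where "block_coeff n h a = (\<lambda>b. if set_mset b \<subseteq> {..<n} then h (b + shift_vars n a) else 0)"

lemma filter_shift_vars [simp]:
  "filter_mset (\<lambda>i. i < n) (shift_vars n a) = {#}"
  "filter_mset (\<lambda>i. \<not> i < n) (shift_vars n a) = shift_vars n a"
  by (induction a) (auto simp: shift_vars_def)

lemma unshift_shift_vars [simp]: "image_mset (\<lambda>i. i - n) (shift_vars n a) = a"
  by (simp add: shift_vars_def multiset.map_comp comp_def)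

lemma shift_unshift_vars:
  "shift_vars n (image_mset (\<lambda>i. i - n) (filter_mset (\<lambda>i. \<not> i < n) e)) = filter_mset (\<lambda>i. \<not> i < n) e"
  by (induction e) (auto simp: shift_vars_def)

lemma filter_lower_block:
  "set_mset b \<subseteq> {..<n} \<Longrightarrow> filter_mset (\<lambda>i. i < n) b = b"
  "set_mset b \<subseteq> {..<n} \<Longrightarrow> filter_mset (\<lambda>i. \<not> i < n) b = {#}"
  for b :: "nat multiset"
  by (induction b) auto

lemma block_coeff_mult:
  "block_coeff n (ps_mult h k) a = (\<lambda>b. \<Sum>c | c \<subseteq># a. ps_mult (block_coeff n h c) (block_coeff n k (a - c)) b)"
proof
  fix b :: "nat multiset"
  show "block_coeff n (ps_mult h k) a b = (\<Sum>c | c \<subseteq># a. ps_mult (block_coeff n h c) (block_coeff n k (a - c)) b)"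
  proof (cases "set_mset b \<subseteq> {..<n}")
    case True
    let ?e = "b + shift_vars n a"
    have "(\<Sum>c | c \<subseteq># a. ps_mult (block_coeff n h c) (block_coeff n k (a - c)) b)
        = (\<Sum>(c, d)\<in>{c. c \<subseteq># a} \<times> {d. d \<subseteq># b}. block_coeff n h c d * block_coeff n k (a - c) (b - d))"
      by (simp add: ps_mult_def sum.cartesian_product)
    also have "\<dots> = (\<Sum>e | e \<subseteq># ?e. h e * k (?e - e))"
    proof (rule sum.reindex_bij_witness[of _
          "\<lambda>e. (image_mset (\<lambda>i. i - n) (filter_mset (\<lambda>i. \<not> i < n) e), filter_mset (\<lambda>i. i < n) e)"
          "\<lambda>(c, d). d + shift_vars n c"])
      fix x assume "x \<in> {c. c \<subseteq># a} \<times> {d. d \<subseteq># b}"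
      then obtain c d where x: "x = (c, d)" "c \<subseteq># a" "d \<subseteq># b" by auto
      have d: "set_mset d \<subseteq> {..<n}" using x True by (meson mset_subset_eqD subset_iff)
      have bd: "set_mset (b - d) \<subseteq> {..<n}" using True by (meson in_diffD subset_iff)
      have sc: "shift_vars n c \<subseteq># shift_vars n a"
        unfolding shift_vars_def using x by (simp add: image_mset_subseteq_mono)
      show "(image_mset (\<lambda>i. i - n) (filter_mset (\<lambda>i. \<not> i < n) (case x of (c, d) \<Rightarrow> d + shift_vars n c)),
          filter_mset (\<lambda>i. i < n) (case x of (c, d) \<Rightarrow> d + shift_vars n c)) = x"
        using x d by (simp add: filter_lower_block)
      show "(case x of (c, d) \<Rightarrow> d + shift_vars n c) \<in> {e. e \<subseteq># ?e}"
        using x sc by (simp add: subset_mset.add_mono)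
      have "?e - (d + shift_vars n c) = (b - d) + (shift_vars n a - shift_vars n c)"
        using x(3) sc by (simp add: subseteq_mset_def multiset_eq_iff)
      also have "shift_vars n a - shift_vars n c = shift_vars n (a - c)"
        unfolding shift_vars_def using x(2) by (simp add: image_mset_Diff)
      finally show "h (case x of (c, d) \<Rightarrow> d + shift_vars n c) * k (?e - (case x of (c, d) \<Rightarrow> d + shift_vars n c))
          = (case x of (c, d) \<Rightarrow> block_coeff n h c d * block_coeff n k (a - c) (b - d))"
        using x d bd by (simp add: block_coeff_def)
    next
      fix e assume "e \<in> {e. e \<subseteq># ?e}"
      hence "e \<subseteq># ?e" by simp
      hence e: "filter_mset P e \<subseteq># filter_mset P ?e" for P by (rule multiset_filter_mono)
      show "(case (image_mset (\<lambda>i. i - n) (filter_mset (\<lambda>i. \<not> i < n) e), filter_mset (\<lambda>i. i < n) e)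
          of (c, d) \<Rightarrow> d + shift_vars n c) = e"
        by (simp add: shift_unshift_vars multiset_partition[symmetric])
      show "(image_mset (\<lambda>i. i - n) (filter_mset (\<lambda>i. \<not> i < n) e), filter_mset (\<lambda>i. i < n) e)
          \<in> {c. c \<subseteq># a} \<times> {d. d \<subseteq># b}"
        using e[of "\<lambda>i. i < n"] image_mset_subseteq_mono[OF e[of "\<lambda>i. \<not> i < n"], of "\<lambda>i. i - n"] True
        by (simp add: filter_lower_block)
    qed
    finally show ?thesis using True by (simp add: block_coeff_def ps_mult_def)
  next
    case False
    have "block_coeff n h c d * block_coeff n k c' (b - d) = 0" if "d \<subseteq># b" for c c' d
    proof (rule ccontr)
      assume "block_coeff n h c d * block_coeff n k c' (b - d) \<noteq> 0"
      hence "set_mset d \<subseteq> {..<n}" "set_mset (b - d) \<subseteq> {..<n}"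
        by (auto simp: block_coeff_def split: if_splits)
      moreover have "set_mset b = set_mset d \<union> set_mset (b - d)"
        using that by (metis set_mset_union subset_mset.add_diff_inverse)
      ultimately show False using False by simp
    qed
    hence "ps_mult (block_coeff n h c) (block_coeff n k c') b = 0" for c c'
      unfolding ps_mult_def by (intro sum.neutral) simp
    moreover have "block_coeff n (ps_mult h k) a b = 0" using False by (simp add: block_coeff_def)
    ultimately show ?thesis by simp
  qed
qed

context abs_value begin

lemma block_coeff_closed:
  assumes "h \<in> carrier (PS m)" shows "block_coeff n h a \<in> carrier (PS n)"
proof (rule PS_memI)
  show "dconv (block_coeff n h a)"
    by (rule dconv_dom[OF dconv_shift[OF PS_dconv[OF assms], of "shift_vars n a"]])
       (simp add: block_coeff_def)
qed (simp add: block_coeff_def split: if_splits)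

lemma block_coeff_empty: "block_coeff n h {#} = ps_restrict n h"
  by (auto simp: block_coeff_def ps_restrict_def shift_vars_def fun_eq_iff)

lemma ps_restrict_eq_self: "h \<in> carrier (PS n) \<Longrightarrow> ps_restrict n h = h"
  using PS_supp[of h n] by (auto simp: ps_restrict_def fun_eq_iff)

lemma block_coeff_lower:
  assumes "h \<in> carrier (PS n)"
  shows "block_coeff n h a = (if a = {#} then h else (\<lambda>b. 0))"
proof (cases "a = {#}")
  case False
  then obtain j where "j \<in># a" by blast
  hence "n + j \<in># b + shift_vars n a" for b by (simp add: shift_vars_def)
  hence "\<not> set_mset (b + shift_vars n a) \<subseteq> {..<n}" for b
    using not_add_less1 by blast
  hence "h (b + shift_vars n a) = 0" for b using PS_supp[OF assms] by blast
  thus ?thesis using False by (auto simp: block_coeff_def fun_eq_iff)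
qed (simp add: block_coeff_empty ps_restrict_eq_self[OF assms])

lemma block_coeff_var:
  "block_coeff n (ps_var (n + j)) a = (if a = {#j#} then ps_const 1 else (\<lambda>b. 0))"
proof
  fix b
  have "b + shift_vars n a = {#n + j#} \<longleftrightarrow> b = {#} \<and> a = {#j#}" if "set_mset b \<subseteq> {..<n}"
  proof
    assume eq: "b + shift_vars n a = {#n + j#}"
    have "b = filter_mset (\<lambda>i. i < n) (b + shift_vars n a)" using that by (simp add: filter_lower_block)
    also have "\<dots> = {#}" unfolding eq by simp
    finally have b: "b = {#}" .
    hence "image_mset (\<lambda>i. i - n) (shift_vars n a) = image_mset (\<lambda>i. i - n) {#n + j#}"
      using eq by (intro arg_cong[of _ _ "image_mset _"]) simp
    with b show "b = {#} \<and> a = {#j#}" by simp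
  qed (simp add: shift_vars_def)
  thus "block_coeff n (ps_var (n + j)) a b = (if a = {#j#} then ps_const 1 else (\<lambda>b. 0)) b"
    by (auto simp: block_coeff_def ps_var_def ps_const_def)
qed

lemma ps_var_constant_term [simp]: "ps_var i {#} = 0"
  by (simp add: ps_var_def)

lemma inclusion_hom: "n \<le> k \<Longrightarrow> (\<lambda>h. h) \<in> ring_hom (PS n) (PS k)"
  by (rule ring_hom_memI) (auto intro: PS_mono)

lemma ring_hom_comp: "f \<in> ring_hom A B \<Longrightarrow> g \<in> ring_hom B C \<Longrightarrow> (\<lambda>x. g (f x)) \<in> ring_hom A C"
  using ring_hom_trans[of f A B g C] by (simp add: comp_def)

lemma translation_exists:
  assumes f: "\<And>j. j < m \<Longrightarrow> f j \<in> carrier (PS n)" "\<And>j. j < m \<Longrightarrow> f j {#} = 0"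
  shows "\<exists>\<sigma>\<in>ring_hom (PS (n + m)) (PS (n + m)). (\<forall>h\<in>carrier (PS n). \<sigma> h = h) \<and>
    (\<forall>j<m. \<sigma> (ps_var (n + j)) = (\<lambda>a. ps_var (n + j) a + f j a))"
proof -
  define g where "g i = (if i < n then ps_var i else (\<lambda>a. ps_var i a + f (i - n) a))" for i
  have "g i \<in> carrier (PS (n + m))" if "i < n + m" for i
    using that f(1)[of "i - n"] PS_mono[of n "n + m" "f (i - n)"]
    by (auto simp: g_def intro!: PS_add_closed ps_var_closed)
  moreover have "g i {#} = 0" if "i < n + m" for i
    using that f(2)[of "i - n"] by (auto simp: g_def)
  ultimately obtain \<sigma> where \<sigma>: "\<sigma> \<in> ring_hom (PS (n + m)) (PS (n + m))"
    "\<And>c. \<sigma> (ps_const c) = ps_const c" "\<And>i. i < n + m \<Longrightarrow> \<sigma> (ps_var i) = g i"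
    using substitution_exists[of "n + m" g "n + m"] by blast
  have "\<sigma> h = h" if h: "h \<in> carrier (PS n)" for h
    by (rule hom_unique[OF ring_hom_comp[OF inclusion_hom \<sigma>(1)] inclusion_hom _ _ _ h])
       (simp_all add: \<sigma> g_def)
  thus ?thesis using \<sigma> by (intro bexI[of _ \<sigma>]) (simp_all add: g_def)
qed

text \<open>
  The ring in \<open>n + m\<close> variables, over the ring in the first \<open>n\<close>, has the coordinates \<open>t\<^sub>j = y\<^sub>j - f\<^sub>j\<close>. Since
  the translation \<open>\<sigma>\<close> by \<open>f\<close> maps \<open>t\<^sub>j\<close> to \<open>y\<^sub>j\<close>, the coefficients with respect to \<open>t\<close> are the
  coefficients of \<open>\<sigma> h\<close> with respect to \<open>y\<close>. The constant coefficient of \<open>h\<close> is \<open>h(x, f(x))\<close>, and the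
  second conclusion records its value on \<open>y\<^sub>j\<close>.
\<close>

lemma power_series_coordinate_extension:
  assumes f: "\<And>j. j < m \<Longrightarrow> f j \<in> carrier (PS n)" "\<And>j. j < m \<Longrightarrow> f j {#} = 0"
  shows "\<exists>t co. coordinate_extension (PS n) (PS (n + m)) m (\<lambda>r. r) t co \<and>
    (\<forall>j<m. co (ps_var (n + j)) {#} = f j)"
proof -
  let ?T = "PS (n + m)"
  interpret R: cring "PS n" by (rule PS_cring)
  interpret T: cring "PS (n + m)" by (rule PS_cring)
  obtain \<sigma> where \<sigma>: "\<sigma> \<in> ring_hom ?T ?T" "\<And>h. h \<in> carrier (PS n) \<Longrightarrow> \<sigma> h = h"
    "\<And>j. j < m \<Longrightarrow> \<sigma> (ps_var (n + j)) = (\<lambda>a. ps_var (n + j) a + f j a)"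
    using translation_exists[of m f n, OF f] by blast
  have f': "(\<lambda>a. - f j a) \<in> carrier (PS n)" "- f j {#} = 0" if "j < m" for j
    using PS_uminus_closed[OF f(1)[OF that]] f(2)[OF that] by simp_all
  obtain \<tau> where \<tau>: "\<tau> \<in> ring_hom ?T ?T" "\<And>h. h \<in> carrier (PS n) \<Longrightarrow> \<tau> h = h"
    "\<And>j. j < m \<Longrightarrow> \<tau> (ps_var (n + j)) = (\<lambda>a. ps_var (n + j) a + - f j a)"
    using translation_exists[of m "\<lambda>j a. - f j a" n, OF f'] by blast
  interpret \<sigma>: ring_hom_cring "PS (n + m)" "PS (n + m)" \<sigma> by unfold_locales (rule \<sigma>(1))
  interpret \<tau>: ring_hom_cring "PS (n + m)" "PS (n + m)" \<tau> by unfold_locales (rule \<tau>(1))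
  have fT: "f j \<in> carrier ?T" if "j < m" for j
    using f(1)[OF that] PS_mono[of n "n + m"] by simp
  have var: "ps_var (n + j) \<in> carrier ?T" if "j < m" for j
    using that by (simp add: ps_var_closed)
  have \<tau>\<sigma>: "\<tau> (\<sigma> h) = h" if h: "h \<in> carrier ?T" for h
  proof (rule hom_unique[OF ring_hom_comp[OF \<sigma>(1) \<tau>(1)] inclusion_hom[OF order_refl] _ _ _ h])
    fix i assume i: "i < n + m"
    show "\<tau> (\<sigma> (ps_var i)) = ps_var i"
    proof (cases "i < n")
      case False
      then obtain j where j: "i = n + j" "j < m" using i by (metis add_diff_inverse_nat nat_add_left_cancel_less)
      have "\<tau> (\<sigma> (ps_var i)) = \<tau> (ps_var (n + j) \<oplus>\<^bsub>?T\<^esub> f j)" using j \<sigma>(3) by simp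
      also have "\<dots> = \<tau> (ps_var (n + j)) \<oplus>\<^bsub>?T\<^esub> \<tau> (f j)"
        by (rule \<tau>.hom_add[OF var[OF j(2)] fT[OF j(2)]])
      finally show ?thesis using j \<tau>(3) \<tau>(2)[OF f(1)[OF j(2)]] by simp
    qed (simp add: \<sigma>(2) \<tau>(2) ps_var_closed)
    thus "\<tau> (\<sigma> (ps_var i)) {#} = 0" by (simp add: ps_var_def)
  qed (simp add: \<sigma>(2) \<tau>(2))
  define t where "t j = ps_var (n + j) \<ominus>\<^bsub>?T\<^esub> f j" for j
  define co where "co h = block_coeff n (\<sigma> h)" for h
  have t: "t j \<in> carrier ?T" if "j < m" for j
    unfolding t_def by (rule T.minus_closed[OF var[OF that] fT[OF that]])
  have \<tau>t: "\<tau> (ps_var (n + j)) = t j" if "j < m" for j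
    using \<tau>(3)[OF that] var[OF that] fT[OF that] by (simp add: t_def PS_minus)
  have \<sigma>t: "\<sigma> (t j) = ps_var (n + j)" if j: "j < m" for j
  proof -
    have "\<sigma> (t j) = \<sigma> (ps_var (n + j)) \<ominus>\<^bsub>?T\<^esub> \<sigma> (f j)"
      unfolding t_def T.minus_eq using var[OF j] fT[OF j] by (simp del: PS_sel)
    also have "\<dots> = (\<lambda>a. ps_var (n + j) a + f j a) \<ominus>\<^bsub>?T\<^esub> f j"
      using \<sigma>(2)[OF f(1)[OF j]] \<sigma>(3)[OF j] by simp
    also have "\<dots> = ps_var (n + j)"
      by (subst PS_minus[OF PS_add_closed[OF var[OF j] fT[OF j]] fT[OF j]]) simp
    finally show ?thesis .
  qed
  have "coordinate_extension (PS n) ?T m (\<lambda>r. r) t co"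
  proof unfold_locales
    show "(\<lambda>r. r) \<in> ring_hom (PS n) ?T" by (rule inclusion_hom) simp
  next
    fix j assume "j < m" thus "t j \<in> carrier ?T" by (rule t)
  next
    fix h a assume h: "h \<in> carrier ?T"
    show "co h a \<in> carrier (PS n)" unfolding co_def by (rule block_coeff_closed[OF \<sigma>.hom_closed[OF h]])
    show "co h a = \<zero>\<^bsub>PS n\<^esub>" if "\<not> set_mset a \<subseteq> {..<m}"
    proof -
      from that obtain j where "j \<in># a" "\<not> j < m" by auto
      hence "n + j \<in># b + shift_vars n a" "\<not> n + j < n + m" for b by (auto simp: shift_vars_def)
      hence "\<not> set_mset (b + shift_vars n a) \<subseteq> {..<n + m}" for b by blast
      hence "\<sigma> h (b + shift_vars n a) = 0" for b using PS_supp[OF \<sigma>.hom_closed[OF h]] by blast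
      thus ?thesis by (auto simp: co_def block_coeff_def fun_eq_iff)
    qed
    fix k assume k: "k \<in> carrier ?T"
    show "co (h \<oplus>\<^bsub>?T\<^esub> k) a = co h a \<oplus>\<^bsub>PS n\<^esub> co k a"
      using \<sigma>.hom_add[OF h k] by (simp add: co_def block_coeff_def fun_eq_iff)
    have "co (h \<otimes>\<^bsub>?T\<^esub> k) a = block_coeff n (ps_mult (\<sigma> h) (\<sigma> k)) a"
      using \<sigma>.hom_mult[OF h k] by (simp add: co_def)
    also have "\<dots> = (\<Oplus>\<^bsub>PS n\<^esub>b\<in>{b. b \<subseteq># a}. co h b \<otimes>\<^bsub>PS n\<^esub> co k (a - b))"
      unfolding block_coeff_mult
      by (subst PS_finsum) (auto simp: co_def intro!: PS_mult_closed block_coeff_closed \<sigma>.hom_closed h k)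
    finally show "co (h \<otimes>\<^bsub>?T\<^esub> k) a = (\<Oplus>\<^bsub>PS n\<^esub>b\<in>{b. b \<subseteq># a}. co h b \<otimes>\<^bsub>PS n\<^esub> co k (a - b))" .
  next
    fix r a assume "r \<in> carrier (PS n)"
    thus "co r a = (if a = {#} then r else \<zero>\<^bsub>PS n\<^esub>)" by (simp add: co_def \<sigma>(2) block_coeff_lower)
  next
    fix j a assume "j < m"
    thus "co (t j) a = (if a = {#j#} then \<one>\<^bsub>PS n\<^esub> else \<zero>\<^bsub>PS n\<^esub>)"
      by (simp add: co_def \<sigma>t block_coeff_var)
  next
    fix h assume h: "h \<in> carrier ?T"
    obtain u where u: "\<And>j. j < m \<Longrightarrow> u j \<in> carrier ?T"
      "\<And>a. \<sigma> h a = ps_restrict n (\<sigma> h) a + (\<Sum>j<m. ps_mult (ps_var (n + j)) (u j) a)"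
      using partial_hadamard[OF \<sigma>.hom_closed[OF h]] by blast
    have yu: "(\<lambda>j. ps_var (n + j) \<otimes>\<^bsub>?T\<^esub> u j) \<in> {..<m} \<rightarrow> carrier ?T"
      using var u(1) by (auto simp del: PS_sel)
    have co0: "co h {#} = ps_restrict n (\<sigma> h)" by (simp add: co_def block_coeff_empty)
    have co0R: "co h {#} \<in> carrier (PS n)" unfolding co_def by (rule block_coeff_closed[OF \<sigma>.hom_closed[OF h]])
    hence co0T: "co h {#} \<in> carrier ?T" by (rule PS_mono[rotated]) simp
    have "\<sigma> h = co h {#} \<oplus>\<^bsub>?T\<^esub> (\<Oplus>\<^bsub>?T\<^esub>j\<in>{..<m}. ps_var (n + j) \<otimes>\<^bsub>?T\<^esub> u j)"
      unfolding PS_finsum[OF yu] co0 using u(2) by (simp add: fun_eq_iff)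
    hence "\<tau> (\<sigma> h) = \<tau> (co h {#}) \<oplus>\<^bsub>?T\<^esub> \<tau> (\<Oplus>\<^bsub>?T\<^esub>j\<in>{..<m}. ps_var (n + j) \<otimes>\<^bsub>?T\<^esub> u j)"
      using \<tau>.hom_add[OF co0T T.finsum_closed[OF yu]] by (simp only:)
    also have "\<tau> (\<Oplus>\<^bsub>?T\<^esub>j\<in>{..<m}. ps_var (n + j) \<otimes>\<^bsub>?T\<^esub> u j)
        = (\<Oplus>\<^bsub>?T\<^esub>j\<in>{..<m}. t j \<otimes>\<^bsub>?T\<^esub> \<tau> (u j))"
      unfolding \<tau>.hom_finsum[OF yu]
      by (rule T.finsum_cong') (use u(1) t var \<tau>t in \<open>auto simp del: PS_sel\<close>)
    finally have "\<tau> (\<sigma> h) = \<tau> (co h {#}) \<oplus>\<^bsub>?T\<^esub> (\<Oplus>\<^bsub>?T\<^esub>j\<in>{..<m}. t j \<otimes>\<^bsub>?T\<^esub> \<tau> (u j))" .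
    note exp = this[unfolded \<tau>\<sigma>[OF h] \<tau>(2)[OF co0R]]
    show "\<exists>u. (\<forall>j<m. u j \<in> carrier ?T) \<and>
        h = co h {#} \<oplus>\<^bsub>?T\<^esub> (\<Oplus>\<^bsub>?T\<^esub>j\<in>{..<m}. t j \<otimes>\<^bsub>?T\<^esub> u j)"
    proof (intro exI conjI allI impI)
      show "\<tau> (u j) \<in> carrier ?T" if "j < m" for j using u(1)[OF that] by simp
    qed (rule exp)
  qed
  moreover have "co (ps_var (n + j)) {#} = f j" if j: "j < m" for j
  proof -
    have "ps_restrict n (\<lambda>a. ps_var (n + j) a + f j a) = ps_restrict n (f j)"
      by (auto simp: ps_restrict_def ps_var_def fun_eq_iff)
    thus ?thesis
      using \<sigma>(3)[OF j] ps_restrict_eq_self[OF f(1)[OF j]] by (simp add: co_def block_coeff_empty)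
  qed
  ultimately show ?thesis by blast
qed

text \<open>
  Exchanging the two blocks of variables makes the situation symmetric in \<open>R\<close> and \<open>S\<close>.
\<close>

lemma swap_exists:
  "\<exists>\<theta>\<in>ring_hom (PS (n + m)) (PS (m + n)). (\<forall>c. \<theta> (ps_const c) = ps_const c) \<and>
    (\<forall>i<n. \<theta> (ps_var i) = ps_var (m + i)) \<and> (\<forall>j<m. \<theta> (ps_var (n + j)) = ps_var j)"
proof -
  define g where "g i = (if i < n then ps_var (m + i) else ps_var (i - n) :: nat multiset \<Rightarrow> 'k)" for i
  have "g i \<in> carrier (PS (m + n))" "g i {#} = 0" if "i < n + m" for i
    using that by (auto simp: g_def intro!: ps_var_closed)
  then obtain \<theta> where "\<theta> \<in> ring_hom (PS (n + m)) (PS (m + n))" "\<And>c. \<theta> (ps_const c) = ps_const c"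
    "\<And>i. i < n + m \<Longrightarrow> \<theta> (ps_var i) = g i"
    using substitution_exists[of "n + m" g "m + n"] by blast
  thus ?thesis by (intro bexI[of _ \<theta>]) (simp_all add: g_def)
qed

lemma swap_inverse:
  assumes \<theta>: "\<theta> \<in> ring_hom (PS (n + m)) (PS (m + n))" "\<And>c. \<theta> (ps_const c) = ps_const c"
    "\<And>i. i < n \<Longrightarrow> \<theta> (ps_var i) = ps_var (m + i)" "\<And>j. j < m \<Longrightarrow> \<theta> (ps_var (n + j)) = ps_var j"
    and \<theta>': "\<theta>' \<in> ring_hom (PS (m + n)) (PS (n + m))" "\<And>c. \<theta>' (ps_const c) = ps_const c"
    "\<And>i. i < m \<Longrightarrow> \<theta>' (ps_var i) = ps_var (n + i)" "\<And>j. j < n \<Longrightarrow> \<theta>' (ps_var (m + j)) = ps_var j"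
    and h: "h \<in> carrier (PS (n + m))"
  shows "\<theta>' (\<theta> h) = h"
proof (rule hom_unique[OF ring_hom_comp[OF \<theta>(1) \<theta>'(1)] inclusion_hom[OF order_refl] _ _ _ h])
  fix i assume i: "i < n + m"
  show "\<theta>' (\<theta> (ps_var i)) = ps_var i"
  proof (cases "i < n")
    case False
    then obtain j where "i = n + j" "j < m" using i by (metis add_diff_inverse_nat nat_add_left_cancel_less)
    thus ?thesis using \<theta>(4) \<theta>'(3) by simp
  qed (simp add: \<theta> \<theta>')
  thus "\<theta>' (\<theta> (ps_var i)) {#} = 0" by (simp add: ps_var_def)
qed (simp add: \<theta> \<theta>')


lemma gr_of_constant:
  assumes I: "ideal I R" and R: "cring R" and r: "r \<in> carrier R"
  shows "gr_of R I (\<lambda>i. if i = 0 then r else \<zero>\<^bsub>R\<^esub>) = gr_const R I (I +>\<^bsub>R\<^esub> r)"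
proof -
  interpret cring R by (rule R)
  show ?thesis
    using ideal_power_1[OF I] a_rcos_zero[OF ideal_power_ideal[OF I] ideal_power_zero[OF I]]
    by (auto simp: gr_of_def gr_const_def fun_eq_iff)
qed

text \<open>
  The two coordinate extensions are \<open>E\<close>, over \<open>R\<close> with coordinates \<open>y\<^sub>j - f\<^sub>j\<close>, and \<open>F\<close>, over \<open>S\<close> with
  coordinates \<open>x\<^sub>i - g\<^sub>i\<close>. The fact \<open>compat\<close> says that their constant coefficients correspond under \<open>\<phi>\<close>. It
  makes the ideals \<open>K\<close> of both equal, and it also gives the compatibility with the structure maps.
\<close>

lemma gr_polynomial_rings_isomorphic:
  assumes I: "ideal I (PS n)" and J: "ideal J (PS m)"
    and \<phi>: "\<phi> \<in> ring_iso (PS n Quot I) (PS m Quot J)"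
    and const: "\<And>c. \<phi> (I +>\<^bsub>PS n\<^esub> ps_const c) = J +>\<^bsub>PS m\<^esub> ps_const c"
  shows "\<exists>\<Phi>. algebra_iso (carrier (PS n Quot I))
     (\<lambda>c. ring.indexed_const (gr_ring (PS n) I) (gr_const (PS n) I c)) (mpoly_ring (gr_ring (PS n) I) m)
     (\<lambda>c. ring.indexed_const (gr_ring (PS m) J) (gr_const (PS m) J (\<phi> c))) (mpoly_ring (gr_ring (PS m) J) n) \<Phi>"
proof -
  interpret R: cring "PS n" by (rule PS_cring)
  interpret S: cring "PS m" by (rule PS_cring)
  interpret T: cring "PS (n + m)" by (rule PS_cring)
  interpret I: ideal I "PS n" by (rule I)
  interpret J: ideal J "PS m" by (rule J)
  let ?A = "PS n Quot I" and ?B = "PS m Quot J" and ?T = "PS (n + m)"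
  have \<phi>_hom: "\<phi> \<in> ring_hom ?A ?B" and \<phi>_inj: "inj_on \<phi> (carrier ?A)"
    using \<phi> by (auto simp: ring_iso_def bij_betw_def)
  have "\<exists>f\<in>carrier (PS n). f {#} = 0 \<and> \<phi> (I +>\<^bsub>PS n\<^esub> f) = J +>\<^bsub>PS m\<^esub> ps_var j" if "j < m" for j
    by (rule iso_lift_maximal[OF I J \<phi> const ps_var_closed[OF that] ps_var_constant_term])
  then obtain f where f: "\<And>j. j < m \<Longrightarrow> f j \<in> carrier (PS n)" "\<And>j. j < m \<Longrightarrow> f j {#} = 0"
    "\<And>j. j < m \<Longrightarrow> \<phi> (I +>\<^bsub>PS n\<^esub> f j) = J +>\<^bsub>PS m\<^esub> ps_var j" by metis
  define \<psi> where "\<psi> = inv_into (carrier ?A) \<phi>"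
  have \<psi>: "\<psi> \<in> ring_iso ?B ?A"
    unfolding \<psi>_def by (rule ring_iso_set_sym[OF I.quotient_is_ring \<phi>])
  have \<psi>\<phi>: "\<psi> (\<phi> x) = x" if "x \<in> carrier ?A" for x
    unfolding \<psi>_def by (rule inv_into_f_f[OF \<phi>_inj that])
  have \<phi>\<psi>: "\<phi> (\<psi> y) = y" if "y \<in> carrier ?B" for y
    unfolding \<psi>_def using \<phi> that by (intro f_inv_into_f) (simp add: ring_iso_def bij_betw_def)
  have const': "\<psi> (J +>\<^bsub>PS m\<^esub> ps_const c) = I +>\<^bsub>PS n\<^esub> ps_const c" for c
    unfolding const[symmetric] by (rule \<psi>\<phi>) (simp add: I.Quot_sel)
  have "\<exists>g\<in>carrier (PS m). g {#} = 0 \<and> \<phi> (I +>\<^bsub>PS n\<^esub> ps_var i) = J +>\<^bsub>PS m\<^esub> g" if i: "i < n" for i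
  proof -
    obtain g where g: "g \<in> carrier (PS m)" "g {#} = 0" "\<psi> (J +>\<^bsub>PS m\<^esub> g) = I +>\<^bsub>PS n\<^esub> ps_var i"
      using iso_lift_maximal[OF J I \<psi> const' ps_var_closed[OF i] ps_var_constant_term] by blast
    have "\<phi> (I +>\<^bsub>PS n\<^esub> ps_var i) = J +>\<^bsub>PS m\<^esub> g"
      unfolding g(3)[symmetric] by (rule \<phi>\<psi>) (use g(1) in \<open>simp add: J.Quot_sel\<close>)
    with g show ?thesis by blast
  qed
  then obtain g where g: "\<And>i. i < n \<Longrightarrow> g i \<in> carrier (PS m)" "\<And>i. i < n \<Longrightarrow> g i {#} = 0"
    "\<And>i. i < n \<Longrightarrow> \<phi> (I +>\<^bsub>PS n\<^esub> ps_var i) = J +>\<^bsub>PS m\<^esub> g i" by metis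
  obtain t co where co: "coordinate_extension (PS n) ?T m (\<lambda>r. r) t co"
    and co_var: "\<And>j. j < m \<Longrightarrow> co (ps_var (n + j)) {#} = f j"
    using power_series_coordinate_extension[of m f n, OF f(1,2)] by blast
  obtain t' co' where co': "coordinate_extension (PS m) (PS (m + n)) n (\<lambda>r. r) t' co'"
    and co'_var: "\<And>i. i < n \<Longrightarrow> co' (ps_var (m + i)) {#} = g i"
    using power_series_coordinate_extension[of n g m, OF g(1,2)] by blast
  obtain \<theta> where \<theta>: "\<theta> \<in> ring_hom (PS (n + m)) (PS (m + n))" "\<And>c. \<theta> (ps_const c) = ps_const c"
    "\<And>i. i < n \<Longrightarrow> \<theta> (ps_var i) = ps_var (m + i)" "\<And>j. j < m \<Longrightarrow> \<theta> (ps_var (n + j)) = ps_var j"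
    using swap_exists[of n m] by blast
  obtain \<theta>' where \<theta>': "\<theta>' \<in> ring_hom (PS (m + n)) (PS (n + m))" "\<And>c. \<theta>' (ps_const c) = ps_const c"
    "\<And>i. i < m \<Longrightarrow> \<theta>' (ps_var i) = ps_var (n + i)" "\<And>j. j < n \<Longrightarrow> \<theta>' (ps_var (m + j)) = ps_var j"
    using swap_exists[of m n] by blast
  interpret E: coordinate_extension "PS n" ?T m "\<lambda>r. r" t co by (rule co)
  interpret E': coordinate_extension "PS m" "PS (m + n)" n "\<lambda>r. r" t' co' by (rule co')
  interpret F: coordinate_extension "PS m" ?T n "\<lambda>r. \<theta>' r" "\<lambda>i. \<theta>' (t' i)" "\<lambda>h. co' (\<theta> h)"
    by (rule E'.coordinate_extension_transport[OF PS_cring \<theta>(1) \<theta>'(1)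
          swap_inverse[OF \<theta>' \<theta>] swap_inverse[OF \<theta> \<theta>']])
  have compat: "\<phi> (I +>\<^bsub>PS n\<^esub> co h {#}) = J +>\<^bsub>PS m\<^esub> co' (\<theta> h) {#}" if h: "h \<in> carrier ?T" for h
  proof (rule hom_into_quotient_unique[OF J _ _ _ _ _ h])
    show "(\<lambda>h. \<phi> (I +>\<^bsub>PS n\<^esub> co h {#})) \<in> ring_hom ?T ?B"
      by (rule ring_hom_comp[OF ring_hom_comp[OF E.constant_coeff_hom I.rcos_ring_hom] \<phi>_hom])
    show "(\<lambda>h. J +>\<^bsub>PS m\<^esub> co' (\<theta> h) {#}) \<in> ring_hom ?T ?B"
      by (rule ring_hom_comp[OF F.constant_coeff_hom J.rcos_ring_hom])
    show "\<phi> (I +>\<^bsub>PS n\<^esub> co (ps_const c) {#}) = J +>\<^bsub>PS m\<^esub> co' (\<theta> (ps_const c)) {#}" for c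
      using E.co_iota[of "ps_const c" "{#}"] E'.co_iota[of "ps_const c" "{#}"] by (simp add: \<theta>(2) const)
    fix i assume i: "i < n + m"
    have "\<exists>s\<in>carrier (PS m). s {#} = 0 \<and> \<phi> (I +>\<^bsub>PS n\<^esub> co (ps_var i) {#}) = J +>\<^bsub>PS m\<^esub> s
        \<and> co' (\<theta> (ps_var i)) {#} = s"
    proof (cases "i < n")
      case True
      have "co (ps_var i) {#} = ps_var i" using E.co_iota[OF ps_var_closed[OF True], of "{#}"] by simp
      thus ?thesis using g[OF True] co'_var[OF True] \<theta>(3)[OF True] by auto
    next
      case False
      then obtain j where j: "i = n + j" "j < m" using i by (metis add_diff_inverse_nat nat_add_left_cancel_less)
      have "co' (ps_var j) {#} = ps_var j" using E'.co_iota[OF ps_var_closed[OF j(2)], of "{#}"] by simp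
      thus ?thesis
        using f[OF j(2)] co_var[OF j(2)] \<theta>(4)[OF j(2)] ps_var_closed[OF j(2)] j(1)
        by (intro bexI[of _ "ps_var j"]) simp_all
    qed
    thus "\<phi> (I +>\<^bsub>PS n\<^esub> co (ps_var i) {#}) = J +>\<^bsub>PS m\<^esub> co' (\<theta> (ps_var i)) {#}"
      and "\<exists>s\<in>carrier (PS m). s {#} = 0 \<and> \<phi> (I +>\<^bsub>PS n\<^esub> co (ps_var i) {#}) = J +>\<^bsub>PS m\<^esub> s" by auto
  qed
  have K_eq: "F.K J = E.K I"
  proof -
    have "co h {#} \<in> I \<longleftrightarrow> co' (\<theta> h) {#} \<in> J" if h: "h \<in> carrier ?T" for h
    proof -
      have c: "co h {#} \<in> carrier (PS n)" "co' (\<theta> h) {#} \<in> carrier (PS m)"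
        using E.co_closed[OF h] F.co_closed[OF h] by auto
      have "\<phi> (I +>\<^bsub>PS n\<^esub> ps_const 0) = J +>\<^bsub>PS m\<^esub> ps_const 0" by (rule const)
      hence "co h {#} \<ominus>\<^bsub>PS n\<^esub> ps_const 0 \<in> I \<longleftrightarrow> co' (\<theta> h) {#} \<ominus>\<^bsub>PS m\<^esub> ps_const 0 \<in> J"
        using inj_on_eq_iff[OF \<phi>_inj, of "I +>\<^bsub>PS n\<^esub> co h {#}" "I +>\<^bsub>PS n\<^esub> ps_const 0"] compat[OF h] c
        by (simp add: I.rcos_eq_iff J.rcos_eq_iff I.Quot_sel)
      thus ?thesis using c by (simp add: PS_minus) (simp add: ps_const_def)
    qed
    thus ?thesis unfolding F.K_def[OF J] E.K_def[OF I] by auto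
  qed
  let ?X = "rees_ring ?T (E.K I)"
  obtain \<Phi> where \<Phi>: "\<Phi> \<in> ring_iso (mpoly_ring (gr_ring (PS n) I) m) (mpoly_ring (gr_ring (PS m) J) n)"
    "\<And>h. h \<in> carrier ?X \<Longrightarrow> \<Phi> (E.gr_coeffs I h) = F.gr_coeffs J h"
  proof (rule ring_iso_of_equal_fibres[OF E.gr_coeffs_hom[OF I]])
    show "F.gr_coeffs J \<in> ring_hom ?X (mpoly_ring (gr_ring (PS m) J) n)"
      using F.gr_coeffs_hom[OF J] unfolding K_eq .
    show "ring ?X" by (rule T.rees_ring[OF E.K_ideal[OF I]])
    show "E.gr_coeffs I ` carrier ?X = carrier (mpoly_ring (gr_ring (PS n) I) m)"
      using E.gr_coeffs_closed[OF I] E.gr_coeffs_surj[OF I] by (auto, metis imageI)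
    show "F.gr_coeffs J ` carrier ?X = carrier (mpoly_ring (gr_ring (PS m) J) n)"
      using F.gr_coeffs_closed[OF J] F.gr_coeffs_surj[OF J] unfolding K_eq by (auto, metis imageI)
    show "E.gr_coeffs I h = E.gr_coeffs I k \<longleftrightarrow> F.gr_coeffs J h = F.gr_coeffs J k"
      if "h \<in> carrier ?X" "k \<in> carrier ?X" for h k
      using E.gr_coeffs_eq_iff[OF I, of h k] F.gr_coeffs_eq_iff[OF J, of h k] that unfolding K_eq by simp
  qed blast
  have "\<Phi> (ring.indexed_const (gr_ring (PS n) I) (gr_const (PS n) I c))
      = ring.indexed_const (gr_ring (PS m) J) (gr_const (PS m) J (\<phi> c))" if c: "c \<in> carrier ?A" for c
  proof -
    from c obtain r where r: "r \<in> carrier (PS n)" "c = I +>\<^bsub>PS n\<^esub> r" by (auto simp: I.Quot_sel)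
    have rT: "r \<in> carrier ?T" using PS_mono[of n "n + m" r] r by simp
    have co_r: "co r {#} = r" using E.co_iota[OF r(1), of "{#}"] by simp
    define h where "h = (\<lambda>i::nat. if i = 0 then r else \<zero>\<^bsub>?T\<^esub>)"
    have "{i. h i \<noteq> \<zero>\<^bsub>?T\<^esub>} \<subseteq> {0}" by (auto simp: h_def)
    hence h: "h \<in> rees_set ?T (E.K I)"
      using rT T.ideal_power_zero[OF E.K_ideal[OF I]]
      by (auto simp: rees_set_def h_def ideal_power_0 simp del: PS_sel intro: finite_subset)
    have "E.gr_coeffs I h = ring.indexed_const (gr_ring (PS n) I) (gr_const (PS n) I c)"
      unfolding h_def E.gr_coeffs_const[OF I rT] ring.indexed_const_def[OF R.gr_ring_is_ring[OF I]]
        co_r gr_of_constant[OF I PS_cring r(1)] r(2) ..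
    moreover have "F.gr_coeffs J h = ring.indexed_const (gr_ring (PS m) J) (gr_const (PS m) J (\<phi> c))"
      using compat[OF rT] co_r unfolding h_def F.gr_coeffs_const[OF J rT]
        ring.indexed_const_def[OF S.gr_ring_is_ring[OF J]] gr_of_constant[OF J PS_cring F.co_closed[OF rT]] r(2)
      by (simp cong: if_cong)
    ultimately show ?thesis using \<Phi>(2)[of h] h by simp
  qed
  thus ?thesis using \<Phi>(1) unfolding algebra_iso_def by blast
qed

end

section \<open>Formal and convergent power series\<close>

definition trivial_abs :: "'k::field \<Rightarrow> real"
  where "trivial_abs x = (if x = 0 then 0 else 1)"

lemma abs_value_trivial: "abs_value trivial_abs"
  by unfold_locales (auto simp: trivial_abs_def)

text \<open>
  Coefficients are bounded by \<open>1\<close>, weights are distinct positive integers, and \<open>\<Sum>\<^sub>k 1 / k\<^sup>2\<close> is finite.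
\<close>

lemma dconv_trivial: "abs_value.dconv trivial_abs f"
proof -
  interpret abs_value "trivial_abs :: 'a \<Rightarrow> real" by (rule abs_value_trivial)
  have sm: "summable (\<lambda>k::nat. 1 / real k ^ 2)"
    using inverse_power_summable[of 2, where ?'a = real] by (simp add: field_simps)
  have "dnorm_le 2 f (suminf (\<lambda>k. 1 / real k ^ 2))"
    unfolding dnorm_le_def
  proof safe
    fix F :: "nat multiset set" assume F: "finite F"
    have "(\<Sum>a\<in>F. trivial_abs (f a) / real (wt a) ^ 2) \<le> (\<Sum>a\<in>F. 1 / real (wt a) ^ 2)"
      by (intro sum_mono divide_right_mono) (simp_all add: trivial_abs_def)
    also have "\<dots> = (\<Sum>k\<in>wt ` F. 1 / real k ^ 2)"
      by (subst sum.reindex) (auto simp: inj_on_def)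
    also have "\<dots> \<le> (suminf (\<lambda>k. 1 / real k ^ 2))"
      by (rule sum_le_suminf[OF sm]) (use F in auto)
    finally show "(\<Sum>a\<in>F. trivial_abs (f a) / real (wt a) ^ 2) \<le> (suminf (\<lambda>k. 1 / real k ^ 2))" .
  qed
  thus ?thesis by (rule dconvI)
qed

lemma formal_eq_convergent_trivial: "formal_ps_ring = convergent_ps_ring trivial_abs"
proof
  fix n
  interpret abs_value "trivial_abs :: 'a \<Rightarrow> real" by (rule abs_value_trivial)
  have "carrier (formal_ps_ring n :: (nat multiset \<Rightarrow> 'a) ring) = carrier (convergent_ps_ring trivial_abs n)"
    by (auto simp: PS_carrier formal_ps_ring_sel dconv_trivial)
  thus "formal_ps_ring n = convergent_ps_ring (trivial_abs :: 'a \<Rightarrow> real) n"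
    by (simp add: convergent_ps_ring_def)
qed

theorem lemma2p2:
  fixes P :: "nat \<Rightarrow> (nat multiset \<Rightarrow> 'k::field) ring"
    and R S :: "(nat multiset \<Rightarrow> 'k) ring"
    and I J :: "(nat multiset \<Rightarrow> 'k) set"
    and n m :: nat
    and \<phi> :: "(nat multiset \<Rightarrow> 'k) set \<Rightarrow> (nat multiset \<Rightarrow> 'k) set"
  assumes "P = formal_ps_ring \<or> (\<exists>v. complete_valued_field v \<and> P = convergent_ps_ring v)"
    and "R = P n" and "S = P m"
    and "ideal I R" and "ideal J S"
    and "algebra_iso UNIV (\<lambda>c. I +>\<^bsub>R\<^esub> ps_const c) (R Quot I)
                          (\<lambda>c. J +>\<^bsub>S\<^esub> ps_const c) (S Quot J) \<phi>"
  shows "\<exists>\<Phi>. algebra_iso (carrier (R Quot I))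
           (\<lambda>c. ring.indexed_const (gr_ring R I) (gr_const R I c))
           (mpoly_ring (gr_ring R I) m)
           (\<lambda>c. ring.indexed_const (gr_ring S J) (gr_const S J (\<phi> c)))
           (mpoly_ring (gr_ring S J) n) \<Phi>"
proof -
  from assms(1) obtain v :: "'k \<Rightarrow> real" where v: "abs_value v" "P = convergent_ps_ring v"
  proof
    assume "P = formal_ps_ring"
    thus thesis using that abs_value_trivial formal_eq_convergent_trivial by metis
  next
    assume "\<exists>v. complete_valued_field v \<and> P = convergent_ps_ring v"
    then obtain v :: "'k \<Rightarrow> real" where "complete_valued_field v" "P = convergent_ps_ring v" by blast
    moreover from this have "abs_value v" by unfold_locales (auto simp: complete_valued_field_def)
    ultimately show thesis using that by blast
  qed
  interpret abs_value v by (rule v(1))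
  have R: "R = PS n" and S: "S = PS m" using assms(2,3) v(2) by simp_all
  have "\<phi> \<in> ring_iso (PS n Quot I) (PS m Quot J)"
    "\<phi> (I +>\<^bsub>PS n\<^esub> ps_const c) = J +>\<^bsub>PS m\<^esub> ps_const c" for c
    using assms(6) by (auto simp: R S algebra_iso_def)
  thus ?thesis
    using gr_polynomial_rings_isomorphic assms(4,5) unfolding R S by blast
qed

end
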